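(* Let $\mathbb{D}=\{\zeta\in\mathbb{C}:|\zeta|<1\}$. Given a $\mathscr{C}^1$ embedding $G:\overline{\mathbb{D}}\hookrightarrow\mathbb{C}^2$ which is holomorphic on $\mathbb{D}$, a compact set $K\subset\mathbb{D}$, and a number $\epsilon>0$, there is a complete injective holomorphic immersion $F:\mathbb{D}\to\mathbb{C}^2$ such that $|F-G|<\epsilon$ on $K$ and $d_{\rm H}(\overline{F(\mathbb{D})},G(\overline{\mathbb{D}}))<\epsilon$.
   Context: $d_{\rm H}$ denotes the Hausdorff distance between subsets of Euclidean space. An immersion $\varphi:Z\to\mathbb{C}^2$ is complete if the Riemannian metric on $Z$ obtained by pulling back the Euclidean metric on $\mathbb{C}^2=\mathbb{R}^4$ via $\varphi$ is complete; equivalently, for every proper path $\gamma:[0,1)\to Z$ the path $\varphi\circ\gamma$ has infinite Euclidean length. *)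

theory Defs
  imports "HOL-Complex_Analysis.Complex_Analysis"
begin

text \<open>
  \<open>\<complex>\<^sup>2\<close> is rendered as \<^typ>\<open>complex \<times> complex\<close>, whose library norm and inner product are
  the Euclidean ones of \<open>\<real>\<^sup>4\<close>.
\<close>

definition holomorphic_map_on :: "(complex \<Rightarrow> complex \<times> complex) \<Rightarrow> complex set \<Rightarrow> bool"
  where "holomorphic_map_on f S \<longleftrightarrow>
    (\<lambda>z. fst (f z)) holomorphic_on S \<and> (\<lambda>z. snd (f z)) holomorphic_on S"

text \<open>
  The derivative is taken within \<open>S\<close>, so that regularity and injectivity of the differential
  are required up to the boundary when \<open>S\<close> is a closed disc (where the derivative within
  \<open>S\<close> is unique). The map is moreover a homeomorphism onto its image.
\<close>

definition C1_embedding_on ::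
    "('a::euclidean_space \<Rightarrow> 'b::euclidean_space) \<Rightarrow> 'a set \<Rightarrow> bool"
  where "C1_embedding_on f S \<longleftrightarrow>
    (\<exists>f' :: 'a \<Rightarrow> 'a \<Rightarrow>\<^sub>L 'b.
       (\<forall>x\<in>S. (f has_derivative blinfun_apply (f' x)) (at x within S)) \<and>
       continuous_on S f' \<and>
       (\<forall>x\<in>S. inj (blinfun_apply (f' x)))) \<and>
    embedding_map (top_of_set S) euclidean f"

text \<open>For open \<open>Z\<close>.\<close>

definition immersion_on ::
    "('a::euclidean_space \<Rightarrow> 'b::euclidean_space) \<Rightarrow> 'a set \<Rightarrow> bool"
  where "immersion_on f Z \<longleftrightarrow>
    (\<forall>x\<in>Z. f differentiable (at x) \<and> inj (frechet_derivative f (at x)))"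

definition pullback_metric ::
    "('a::euclidean_space \<Rightarrow> 'b::euclidean_space) \<Rightarrow> 'a \<Rightarrow> 'a \<Rightarrow> 'a \<Rightarrow> real"
  where "pullback_metric f x v w =
    frechet_derivative f (at x) v \<bullet> frechet_derivative f (at x) w"

text \<open>
  Lengths are \<^typ>\<open>ennreal\<close>-valued because a \<^const>\<open>valid_path\<close> may have unbounded speed near
  one of its finitely many exceptional points, and hence infinite length.
\<close>

definition pullback_length ::
    "('a::euclidean_space \<Rightarrow> 'b::euclidean_space) \<Rightarrow> (real \<Rightarrow> 'a) \<Rightarrow> ennreal"
  where "pullback_length f \<gamma> =
    (\<integral>\<^sup>+ t\<in>{0..1}. ennreal (sqrt (pullback_metric f (\<gamma> t)
        (vector_derivative \<gamma> (at t)) (vector_derivative \<gamma> (at t)))) \<partial>lborel)"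

text \<open>
  The Riemannian distance on \<open>Z\<close>; it is a metric when \<open>Z\<close> is open and connected
  and \<open>f\<close> is a \<open>C\<^sup>1\<close> immersion on \<open>Z\<close>.
\<close>

definition pullback_dist ::
    "('a::euclidean_space \<Rightarrow> 'b::euclidean_space) \<Rightarrow> 'a set \<Rightarrow> 'a \<Rightarrow> 'a \<Rightarrow> real"
  where "pullback_dist f Z x y =
    enn2real (INF \<gamma>\<in>{\<gamma>. valid_path \<gamma> \<and> path_image \<gamma> \<subseteq> Z \<and>
                        pathstart \<gamma> = x \<and> pathfinish \<gamma> = y}. pullback_length f \<gamma>)"

definition complete_immersion_on ::
    "('a::euclidean_space \<Rightarrow> 'b::euclidean_space) \<Rightarrow> 'a set \<Rightarrow> bool"
  where "complete_immersion_on f Z \<longleftrightarrow>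
    immersion_on f Z \<and> Metric_space.mcomplete Z (pullback_dist f Z)"

text \<open>With values in \<^typ>\<open>ennreal\<close>, as one of the sets may be unbounded.\<close>

definition hausdorff_dist :: "'a::metric_space set \<Rightarrow> 'a set \<Rightarrow> ennreal"
  where "hausdorff_dist A B =
    max (SUP a\<in>A. INF b\<in>B. ennreal (dist a b)) (SUP b\<in>B. INF a\<in>A. ennreal (dist a b))"

end

theory Submission
  imports Defs
begin

text \<open>
  The theorem reduces to one complete disc in the unit ball. Dilating the disc slightly and
  taking Taylor polynomials, \<open>G\<close> may be replaced by a polynomial curve that embeds the closed
  disc. Bezout's identity for the derivatives of its two coordinates provides a holomorphic
  direction field transverse to the curve, hence a polynomial map \<open>\<Psi>\<close> on \<open>\<complex>\<^sup>2\<close> that restricts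
  to the curve on the first axis, is injective on the product of the unit disc and a small disc,
  and there does not shrink distances by more than a constant factor (\<open>ex_expanding_tube\<close>). If
  \<open>f\<close> is a complete injective immersion of the disc into the unit ball whose first coordinate is
  uniformly close to \<open>z\<close> on a large disc, then \<open>\<Psi> (f\<^sub>1, \<delta> f\<^sub>2)\<close> with small \<open>\<delta>\<close> solves the
  problem: lengths change by a bounded factor only, and the image stays in a thin tube around the
  curve while following it closely on the large disc.

  Such an \<open>f\<close> comes from stretching a parabola repeatedly inside the ball. Let \<open>F\<close> be a polynomial
  embedding of \<open>\<complex>\<close> with \<open>F 0 = 0\<close> and \<open>\<Omega>\<close> the component of \<open>0\<close> in \<open>{z. |F z| < s}\<close>. For \<open>s < s'\<close>
  the shell between the spheres of radius \<open>s\<close> and \<open>s'\<close> contains finitely many plates, small flat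
  balls tangent to concentric spheres, such that every path that crosses the shell and misses
  the plates has length at least one (\<open>ex_labyrinth\<close>): the plates nearly close up each
  family of consecutive layers, so a path has to move sideways by a fixed multiple of the plate
  size \<open>t\<close>, although the layers take up only a thickness of order \<open>t\<^sup>2\<close>. The plates are ordered
  so that a real hyperplane separates each of them from the inner ball and all earlier plates. Hence a
  shear parallel to that hyperplane, with a polynomial that is tiny on one side and huge
  on the plate, moves the curve off the plate without spoiling what was achieved before
  (\<open>shear_off_plates\<close>). The sheared curve \<open>F'\<close> is again a polynomial embedding, is close to
  \<open>F\<close> on \<open>\<Omega>\<close>, and paths from \<open>\<Omega>\<close> out of the component \<open>\<Omega>'\<close> belonging to \<open>s'\<close> have image of
  length at least one (\<open>stretching_step\<close>).

  Iterating with radii increasing to \<open>1\<close> and rapidly decreasing errors yields a limit on the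
  union of the domains. It is an injective immersion because holomorphic embeddings of
  compact sets are stable under small perturbations (\<open>holomorphic_embedding_stable\<close>), and
  it is complete because an escaping path makes infinitely many crossings of length one. By the maximum
  principle the domains have no holes, so the union is simply connected and the Riemann mapping
  theorem turns it into the disc. The union may have a complicated shape, but it contains a
  disc of radius almost one and is mapped into the unit ball; the first coordinate of the
  reparametrised map therefore has derivative of modulus almost one at the origin, and the Schwarz lemma
  forces it to be close to a rotation on compact sets
  (\<open>ex_complete_disc_near_coordinate_disc\<close>).
\<close>


section \<open>Lengths of paths and completeness of the induced metric\<close>

definition C1_on :: "('a::euclidean_space \<Rightarrow> 'b::euclidean_space) \<Rightarrow> 'a set \<Rightarrow> bool"
  where "C1_on f Z \<longleftrightarrow> (\<exists>f' :: 'a \<Rightarrow> 'a \<Rightarrow>\<^sub>L 'b.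
    (\<forall>x\<in>Z. (f has_derivative blinfun_apply (f' x)) (at x)) \<and> continuous_on Z f')"

lemma C1_on_imp_continuous_on: "C1_on f Z \<Longrightarrow> continuous_on Z f"
  unfolding C1_on_def by (meson continuous_at_imp_continuous_on has_derivative_continuous)

definition path_speed :: "('a::euclidean_space \<Rightarrow> 'b::euclidean_space) \<Rightarrow> (real \<Rightarrow> 'a) \<Rightarrow> real \<Rightarrow> real"
  where "path_speed f \<gamma> t = norm (frechet_derivative f (at (\<gamma> t)) (vector_derivative \<gamma> (at t)))"

definition arc_length ::
    "('a::euclidean_space \<Rightarrow> 'b::euclidean_space) \<Rightarrow> (real \<Rightarrow> 'a) \<Rightarrow> real \<Rightarrow> real \<Rightarrow> ennreal"
  where "arc_length f \<gamma> a b = (\<integral>\<^sup>+ t\<in>{a..b}. ennreal (path_speed f \<gamma> t) \<partial>lborel)"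

lemma pullback_length_eq_arc_length: "pullback_length f \<gamma> = arc_length f \<gamma> 0 1"
  by (simp add: pullback_length_def arc_length_def path_speed_def pullback_metric_def norm_eq_sqrt_inner)

lemma path_speed_nonneg [simp]: "0 \<le> path_speed f \<gamma> t"
  by (simp add: path_speed_def)

text \<open>
  A valid path is \<open>C\<^sup>1\<close> off finitely many break points, and finite sets do not affect lengths.
  All statements about lengths below start from this decomposition.
\<close>

lemma valid_path_C1_image:
  fixes f :: "'a::euclidean_space \<Rightarrow> 'b::euclidean_space"
  assumes "C1_on f Z" "valid_path \<gamma>" "path_image \<gamma> \<subseteq> Z"
  obtains S D where "finite S"
    "\<And>t. t \<in> {0..1} - S \<Longrightarrow> ((f \<circ> \<gamma>) has_vector_derivative D t) (at t)"
    "\<And>t. t \<in> {0..1} - S \<Longrightarrow> path_speed f \<gamma> t = norm (D t)"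
    "continuous_on ({0..1} - S) D"
    "\<And>t. t \<in> {0..1} - S \<Longrightarrow> \<gamma> differentiable at t"
proof -
  obtain f' where f': "\<And>x. x \<in> Z \<Longrightarrow> (f has_derivative blinfun_apply (f' x)) (at x)"
    and cf': "continuous_on Z f'"
    using assms(1) by (auto simp: C1_on_def)
  obtain S where S: "finite S" "\<gamma> C1_differentiable_on ({0..1} - S)" and cg: "continuous_on {0..1} \<gamma>"
    using assms(2) by (auto simp: valid_path_def piecewise_C1_differentiable_on_def)
  have im: "\<gamma> t \<in> Z" if "t \<in> {0..1}" for t
    using assms(3) that by (auto simp: path_image_def)
  define g' where "g' = (\<lambda>t. vector_derivative \<gamma> (at t))"
  have dg: "\<gamma> differentiable at t" "(\<gamma> has_vector_derivative g' t) (at t)" if "t \<in> {0..1} - S" for t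
    using S(2) that by (auto simp: C1_differentiable_on_eq g'_def vector_derivative_works)
  have cg': "continuous_on ({0..1} - S) g'"
    using S(2) by (auto simp: C1_differentiable_on_eq g'_def)
  show thesis
  proof (rule that[of S "\<lambda>t. blinfun_apply (f' (\<gamma> t)) (g' t)"])
    fix t assume t: "t \<in> {0..1} - S"
    have "(f has_derivative blinfun_apply (f' (\<gamma> t))) (at (\<gamma> t))"
      using f' im t by auto
    then show "((f \<circ> \<gamma>) has_vector_derivative blinfun_apply (f' (\<gamma> t)) (g' t)) (at t)"
      using dg(2)[OF t] vector_derivative_diff_chain_within[of \<gamma> "g' t" t UNIV f]
      by (simp add: has_derivative_at_withinI)
    show "path_speed f \<gamma> t = norm (blinfun_apply (f' (\<gamma> t)) (g' t))"
      using frechet_derivative_at[OF f'[of "\<gamma> t"]] im t by (auto simp: path_speed_def g'_def)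
    show "\<gamma> differentiable at t" using dg(1)[OF t] .
  next
    have "continuous_on ({0..1} - S) (\<lambda>t. f' (\<gamma> t))"
      by (rule continuous_on_compose2[OF cf' continuous_on_subset[OF cg]]) (auto intro: im)
    then show "continuous_on ({0..1} - S) (\<lambda>t. blinfun_apply (f' (\<gamma> t)) (g' t))"
      using cg' by (intro continuous_intros)
  qed (fact S(1))
qed

lemma path_speed_measurable:
  fixes f :: "'a::euclidean_space \<Rightarrow> 'b::euclidean_space"
  assumes "C1_on f Z" "valid_path \<gamma>" "path_image \<gamma> \<subseteq> Z"
  shows "(\<lambda>t. ennreal (path_speed f \<gamma> t) * indicator {0..1} t) \<in> borel_measurable borel"
proof -
  obtain S and D :: "real \<Rightarrow> 'b" where S: "finite S"
    "\<And>t. t \<in> {0..1} - S \<Longrightarrow> path_speed f \<gamma> t = norm (D t)"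
    "continuous_on ({0..1} - S) D"
    by (rule valid_path_C1_image[OF assms]) blast
  have [simp]: "S \<in> sets borel" by (simp add: borel_closed finite_imp_closed S)
  have "(\<lambda>t. indicator ({0..1} - S) t *\<^sub>R norm (D t)) \<in> borel_measurable borel"
    using S by (intro borel_measurable_continuous_on_indicator continuous_intros)
       auto
  then have *: "(\<lambda>t. ennreal (indicator ({0..1} - S) t *\<^sub>R norm (D t))) \<in> borel_measurable borel"
    by measurable
  show ?thesis
    by (rule measurable_discrete_difference[OF * countable_finite[OF \<open>finite S\<close>]])
       (auto simp: S(2) indicator_def)
qed

lemma arc_length_superadditive:
  assumes "C1_on f Z" "valid_path \<gamma>" "path_image \<gamma> \<subseteq> Z"
    and "0 \<le> a" "a \<le> b" "b \<le> c" "c \<le> 1"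
  shows "arc_length f \<gamma> a b + arc_length f \<gamma> b c = arc_length f \<gamma> a c"
proof -
  define g where "g = (\<lambda>t. ennreal (path_speed f \<gamma> t) * indicator {0..1} t)"
  have [measurable]: "g \<in> borel_measurable borel"
    using path_speed_measurable[OF assms(1-3)] by (simp add: g_def)
  have arc: "arc_length f \<gamma> x y = (\<integral>\<^sup>+ t. g t * indicator {x..y} t \<partial>lborel)" if "0 \<le> x" "y \<le> 1" for x y
    unfolding arc_length_def g_def using that by (intro nn_integral_cong) (auto simp: indicator_def)
  have "arc_length f \<gamma> a b + arc_length f \<gamma> b c
      = (\<integral>\<^sup>+ t. g t * indicator {a..b} t + g t * indicator {b..c} t \<partial>lborel)"
    using assms by (simp add: arc nn_integral_add)
  also have "\<dots> = (\<integral>\<^sup>+ t. g t * indicator {a..c} t \<partial>lborel)"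
    using assms by (intro nn_integral_cong_AE) (use AE_lborel_singleton[of b] in \<open>eventually_elim, auto simp: indicator_def\<close>)
  finally show ?thesis using assms by (simp add: arc)
qed

text \<open>
  The speed may be unbounded near a break point, so continuity of the derivative is not at hand.
  The fundamental theorem of calculus for the gauge integral copes with a finite exceptional
  set, and its value is bounded by the length as soon as the length is finite.
\<close>

lemma displacement_le_arc_length:
  fixes f :: "'a::euclidean_space \<Rightarrow> 'b::euclidean_space"
  assumes "C1_on f Z" "valid_path \<gamma>" "path_image \<gamma> \<subseteq> Z"
    and "0 \<le> a" "a \<le> b" "b \<le> 1"
  shows "ennreal (norm (f (\<gamma> b) - f (\<gamma> a))) \<le> arc_length f \<gamma> a b"
proof (cases "arc_length f \<gamma> a b = top")
  case False
  obtain S and D :: "real \<Rightarrow> 'b" where S: "finite S"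
    "\<And>t. t \<in> {0..1} - S \<Longrightarrow> ((f \<circ> \<gamma>) has_vector_derivative D t) (at t)"
    "\<And>t. t \<in> {0..1} - S \<Longrightarrow> path_speed f \<gamma> t = norm (D t)"
    "continuous_on ({0..1} - S) D"
    by (rule valid_path_C1_image[OF assms(1-3)]) blast
  define D' where "D' = (\<lambda>t. indicator ({a..b} - S) t *\<^sub>R D t)"
  have [simp]: "S \<in> sets borel" by (simp add: borel_closed finite_imp_closed S)
  have m: "(\<lambda>t. indicator ({a..b} - S) t *\<^sub>R norm (D t)) \<in> borel_measurable borel"
    using S assms by (intro borel_measurable_continuous_on_indicator continuous_intros continuous_on_subset[OF S(4)])
       auto
  have eq: "norm (D' t) = indicator ({a..b} - S) t *\<^sub>R norm (D t)" for t
    by (simp add: D'_def)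
  obtain r where r: "arc_length f \<gamma> a b = ennreal r" "0 \<le> r"
    using False by (cases "arc_length f \<gamma> a b") auto
  have "(\<integral>\<^sup>+ t. norm (D' t) \<partial>lborel) = arc_length f \<gamma> a b"
    unfolding arc_length_def
  proof (rule nn_integral_cong_AE)
    have "AE t in lborel. t \<notin> S"
      using S(1) by (intro AE_not_in) (auto intro: finite_imp_null_set_lborel)
    then show "AE t in lborel. ennreal (norm (D' t)) = ennreal (path_speed f \<gamma> t) * indicator {a..b} t"
    proof eventually_elim
      case (elim t)
      then show ?case using S(3)[of t] assms(4-6) by (auto simp: D'_def indicator_def)
    qed
  qed
  then have "((\<lambda>t. norm (D' t)) has_integral r) UNIV"
    using m r by (intro nn_integral_has_integral) (auto simp: eq)
  then have N: "((\<lambda>t. norm (D' t)) has_integral r) {a..b}"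
    by (subst has_integral_restrict_UNIV[symmetric], rule has_integral_eq[rotated])
       (auto simp: D'_def indicator_def)
  have "continuous_on {0..1} (f \<circ> \<gamma>)"
    using C1_on_imp_continuous_on[OF assms(1)] assms(2,3) valid_path_imp_path[OF assms(2)]
    by (intro continuous_on_compose) (auto simp: path_def path_image_def elim: continuous_on_subset)
  then have "continuous_on {a..b} (f \<circ> \<gamma>)"
    by (rule continuous_on_subset) (use assms in auto)
  then have "(D' has_integral ((f \<circ> \<gamma>) b - (f \<circ> \<gamma>) a)) {a..b}"
    using S(1) S(2)[unfolded o_def] assms by (intro fundamental_theorem_of_calculus_interior_strong[of S]) (auto simp: D'_def o_def)
  then have "norm ((f \<circ> \<gamma>) b - (f \<circ> \<gamma>) a) \<le> r"
    using N integral_norm_bound_integral[of D' "{a..b}" "\<lambda>t. norm (D' t)"]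
    by (metis has_integral_integrable has_integral_integrable_integral integral_unique order_refl)
  then show ?thesis using r by (simp add: ennreal_leI)
qed simp


text \<open>
  Reversing a path and concatenating two paths are both affine reparametrisations on the
  pieces; this chain rule serves for both.
\<close>

lemma path_speed_affine:
  fixes f :: "'a::euclidean_space \<Rightarrow> 'b::euclidean_space"
  assumes g: "\<gamma> differentiable at (c + m * t)" and f: "f differentiable at (\<gamma> (c + m * t))"
    and ev: "eventually (\<lambda>s. h s = \<gamma> (c + m * s)) (nhds t)"
  shows "path_speed f h t = \<bar>m\<bar> * path_speed f \<gamma> (c + m * t)"
proof -
  define D where "D = vector_derivative \<gamma> (at (c + m * t))"
  have "(\<gamma> has_vector_derivative D) (at (c + m * t))"
    using g by (simp add: D_def vector_derivative_works)
  moreover have "((\<lambda>s. c + m * s) has_vector_derivative m) (at t)"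
    by (auto intro!: derivative_eq_intros simp: has_vector_derivative_def)
  ultimately have "((\<gamma> \<circ> (\<lambda>s. c + m * s)) has_vector_derivative m *\<^sub>R D) (at t)"
    by (intro vector_diff_chain_at) auto
  then have "(h has_vector_derivative m *\<^sub>R D) (at t)"
    unfolding has_vector_derivative_def
    by (rule has_derivative_transform_eventually)
       (use ev eventually_nhds_x_imp_x[OF ev] in \<open>auto simp: eventually_at_filter elim: eventually_mono\<close>)
  moreover have "h t = \<gamma> (c + m * t)"
    using eventually_nhds_x_imp_x[OF ev] .
  ultimately have "path_speed f h t = norm (frechet_derivative f (at (\<gamma> (c + m * t))) (m *\<^sub>R D))"
    by (simp add: path_speed_def vector_derivative_at)
  also have "\<dots> = \<bar>m\<bar> * path_speed f \<gamma> (c + m * t)"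
    using linear_frechet_derivative[OF f] by (simp add: path_speed_def D_def linear_scale)
  finally show ?thesis .
qed

lemma C1_on_imp_differentiable: "C1_on f Z \<Longrightarrow> x \<in> Z \<Longrightarrow> f differentiable at x"
  by (auto simp: C1_on_def differentiable_def)

lemma pullback_length_reversepath:
  fixes f :: "'a::euclidean_space \<Rightarrow> 'b::euclidean_space"
  assumes "C1_on f Z" "valid_path \<gamma>" "path_image \<gamma> \<subseteq> Z"
  shows "pullback_length f (reversepath \<gamma>) = pullback_length f \<gamma>"
proof -
  define g where "g = (\<lambda>t. ennreal (path_speed f \<gamma> t) * indicator {0..1} t)"
  have m: "g \<in> borel_measurable borel"
    using path_speed_measurable[OF assms(1-3)] by (simp add: g_def)
  obtain S where S: "finite S" "\<And>t. t \<in> {0..1} - S \<Longrightarrow> \<gamma> differentiable at t"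
    by (rule valid_path_C1_image[OF assms]) blast
  have im: "\<gamma> t \<in> Z" if "t \<in> {0..1}" for t
    using assms(3) that by (auto simp: path_image_def)
  have "pullback_length f \<gamma> = (\<integral>\<^sup>+ t. g (1 + (-1) * t) \<partial>lborel)"
    using nn_integral_real_affine[OF m, of "-1" 1]
    by (simp add: pullback_length_eq_arc_length arc_length_def g_def)
  also have "\<dots> = pullback_length f (reversepath \<gamma>)"
    unfolding pullback_length_eq_arc_length arc_length_def
  proof (rule nn_integral_cong_AE)
    have "AE t in lborel. t \<notin> (\<lambda>s. 1 - s) ` S"
      using S(1) by (intro AE_not_in) (auto intro: finite_imp_null_set_lborel)
    then show "AE t in lborel. g (1 + (-1) * t) = ennreal (path_speed f (reversepath \<gamma>) t) * indicator {0..1} t"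
    proof eventually_elim
      case (elim t)
      have "path_speed f (reversepath \<gamma>) t = path_speed f \<gamma> (1 + (-1) * t)" if "t \<in> {0..1}"
      proof -
        have "1 - t \<notin> S"
          using elim image_eqI[of t "\<lambda>s. 1 - s" "1 - t" S] by auto
        then show ?thesis
          using that C1_on_imp_differentiable[OF assms(1) im[of "1 - t"]] S(2)[of "1-t"]
          by (subst path_speed_affine[of \<gamma> 1 "-1" t f]) (auto simp: reversepath_def)
      qed
      then show ?case by (auto simp: g_def indicator_def)
    qed
  qed
  finally show ?thesis by simp
qed

lemma pullback_length_joinpaths:
  fixes f :: "'a::euclidean_space \<Rightarrow> 'b::euclidean_space"
  assumes "C1_on f Z" and 1: "valid_path \<gamma>" "path_image \<gamma> \<subseteq> Z" and 2: "valid_path \<gamma>'" "path_image \<gamma>' \<subseteq> Z"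
  shows "pullback_length f (\<gamma> +++ \<gamma>') = pullback_length f \<gamma> + pullback_length f \<gamma>'"
proof -
  define g where "g = (\<lambda>\<gamma> t. ennreal (path_speed f \<gamma> t) * indicator {0..1} t)"
  have m [measurable]: "g \<gamma> \<in> borel_measurable borel" "g \<gamma>' \<in> borel_measurable borel"
    using path_speed_measurable[OF assms(1) 1] path_speed_measurable[OF assms(1) 2] by (auto simp: g_def)
  obtain S where S: "finite S" "\<And>t. t \<in> {0..1} - S \<Longrightarrow> \<gamma> differentiable at t"
    by (rule valid_path_C1_image[OF assms(1) 1]) blast
  obtain S' where S': "finite S'" "\<And>t. t \<in> {0..1} - S' \<Longrightarrow> \<gamma>' differentiable at t"
    by (rule valid_path_C1_image[OF assms(1) 2]) blast
  have im: "\<gamma> t \<in> Z" "\<gamma>' t \<in> Z" if "t \<in> {0..1}" for t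
    using 1 2 that by (auto simp: path_image_def)
  have "pullback_length f \<gamma> = 2 * (\<integral>\<^sup>+ t. g \<gamma> (0 + 2 * t) \<partial>lborel)"
    using nn_integral_real_affine[OF m(1), of 2 0]
    by (simp add: pullback_length_eq_arc_length arc_length_def g_def)
  moreover have "pullback_length f \<gamma>' = 2 * (\<integral>\<^sup>+ t. g \<gamma>' (-1 + 2 * t) \<partial>lborel)"
    using nn_integral_real_affine[OF m(2), of 2 "-1"]
    by (simp add: pullback_length_eq_arc_length arc_length_def g_def)
  ultimately have "pullback_length f \<gamma> + pullback_length f \<gamma>'
      = (\<integral>\<^sup>+ t. 2 * g \<gamma> (0 + 2 * t) + 2 * g \<gamma>' (-1 + 2 * t) \<partial>lborel)"
    by (simp add: nn_integral_add nn_integral_cmult)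
  also have "\<dots> = pullback_length f (\<gamma> +++ \<gamma>')"
    unfolding pullback_length_eq_arc_length arc_length_def
  proof (rule nn_integral_cong_AE)
    have "AE t in lborel. t \<notin> (\<lambda>s. s / 2) ` S \<union> (\<lambda>s. (s + 1) / 2) ` S' \<union> {1/2}"
      using S(1) S'(1) by (intro AE_not_in) (auto intro!: finite_imp_null_set_lborel)
    then show "AE t in lborel. 2 * g \<gamma> (0 + 2 * t) + 2 * g \<gamma>' (-1 + 2 * t)
        = ennreal (path_speed f (\<gamma> +++ \<gamma>') t) * indicator {0..1} t"
    proof eventually_elim
      case (elim t)
      have A: "path_speed f (\<gamma> +++ \<gamma>') t = 2 * path_speed f \<gamma> (0 + 2 * t)" if t: "0 \<le> t" "t < 1/2"
      proof -
        have "2 * t \<notin> S"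
          using elim image_eqI[of t "\<lambda>s. s / 2" "2 * t" S] by auto
        moreover have "eventually (\<lambda>s. (\<gamma> +++ \<gamma>') s = \<gamma> (0 + 2 * s)) (nhds t)"
          using eventually_nhds_in_open[of "{..<1/2}" t] t
          by (auto simp: joinpaths_def elim!: eventually_mono)
        ultimately show ?thesis
          using t C1_on_imp_differentiable[OF assms(1) im(1)[of "2*t"]] S(2)[of "2*t"]
          by (subst path_speed_affine[of \<gamma> 0 2 t f]) auto
      qed
      have B: "path_speed f (\<gamma> +++ \<gamma>') t = 2 * path_speed f \<gamma>' (-1 + 2 * t)" if t: "1/2 < t" "t \<le> 1"
      proof -
        have "2 * t - 1 \<notin> S'"
          using elim image_eqI[of t "\<lambda>s. (s+1) / 2" "2 * t - 1" S'] by auto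
        moreover have "eventually (\<lambda>s. (\<gamma> +++ \<gamma>') s = \<gamma>' (-1 + 2 * s)) (nhds t)"
          using eventually_nhds_in_open[of "{1/2<..}" t] t
          by (auto simp: joinpaths_def elim!: eventually_mono)
        ultimately show ?thesis
          using t C1_on_imp_differentiable[OF assms(1) im(2)[of "2*t - 1"]] S'(2)[of "2*t - 1"]
          by (subst path_speed_affine[of \<gamma>' "-1" 2 t f]) auto
      qed
      have "t \<noteq> 1/2" using elim by auto
      then consider "t < 0" | "0 \<le> t" "t < 1/2" | "1/2 < t" "t \<le> 1" | "1 < t" by linarith
      then show ?case
        by cases (use A B in \<open>auto simp: g_def indicator_def ennreal_mult\<close>)
    qed
  qed
  finally show ?thesis by simp
qed

text \<open>
  Short segments have short images. This makes the induced distance finite on convex sets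
  and continuous with respect to the Euclidean one.
\<close>

lemma pullback_length_linepath_le:
  fixes f :: "'a::euclidean_space \<Rightarrow> 'b::euclidean_space"
  assumes "C1_on f Z" "compact C" "C \<subseteq> Z"
  obtains B where "B \<ge> 0"
    "\<And>x y. closed_segment x y \<subseteq> C \<Longrightarrow> pullback_length f (linepath x y) \<le> ennreal (B * norm (y - x))"
proof -
  obtain f' where f': "\<And>x. x \<in> Z \<Longrightarrow> (f has_derivative blinfun_apply (f' x)) (at x)"
    and cf': "continuous_on Z f'"
    using assms(1) by (auto simp: C1_on_def)
  have "bounded (f' ` C)"
    using assms cf' by (meson compact_continuous_image compact_imp_bounded continuous_on_subset)
  then obtain B where B: "B > 0" "\<And>x. x \<in> C \<Longrightarrow> norm (f' x) \<le> B"
    by (auto simp: bounded_pos)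
  show thesis
  proof (rule that[of B])
    fix x y assume xy: "closed_segment x y \<subseteq> C"
    have "pullback_length f (linepath x y) \<le> (\<integral>\<^sup>+ t. ennreal (B * norm (y - x)) * indicator {0..1::real} t \<partial>lborel)"
      unfolding pullback_length_eq_arc_length arc_length_def
    proof (intro nn_integral_mono)
      fix t :: real
      have "path_speed f (linepath x y) t \<le> B * norm (y - x)" if "t \<in> {0..1}"
      proof -
        have p: "linepath x y t \<in> C"
          using xy that by (auto simp: linepath_in_path)
        then have "path_speed f (linepath x y) t = norm (blinfun_apply (f' (linepath x y t)) (y - x))"
          using frechet_derivative_at[OF f'[of "linepath x y t"]] assms(3) by (auto simp: path_speed_def)
        also have "\<dots> \<le> norm (f' (linepath x y t)) * norm (y - x)"
          by (rule norm_blinfun)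
        also have "\<dots> \<le> B * norm (y - x)"
          by (intro mult_right_mono B p) auto
        finally show ?thesis .
      qed
      then show "ennreal (path_speed f (linepath x y) t) * indicator {0..1} t
          \<le> ennreal (B * norm (y - x)) * indicator {0..1} t"
        by (auto simp: indicator_def intro!: ennreal_leI)
    qed
    also have "\<dots> = ennreal (B * norm (y - x))"
      by (simp add: nn_integral_cmult_indicator)
    finally show "pullback_length f (linepath x y) \<le> ennreal (B * norm (y - x))" .
  qed (use B in auto)
qed

text \<open>
  The infimum that defines the distance is finite because segments have finite length, so its
  conversion to a real number loses nothing.
\<close>

lemma pullback_dist_less_iff:
  fixes f :: "'a::euclidean_space \<Rightarrow> 'b::euclidean_space"
  assumes "C1_on f Z" "convex Z" "x \<in> Z" "y \<in> Z"
  shows "pullback_dist f Z x y < c \<longleftrightarrow>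
    (\<exists>\<gamma>. valid_path \<gamma> \<and> path_image \<gamma> \<subseteq> Z \<and> pathstart \<gamma> = x \<and> pathfinish \<gamma> = y \<and> pullback_length f \<gamma> < ennreal c)"
proof -
  define I where "I = (INF \<gamma>\<in>{\<gamma>. valid_path \<gamma> \<and> path_image \<gamma> \<subseteq> Z \<and>
                        pathstart \<gamma> = x \<and> pathfinish \<gamma> = y}. pullback_length f \<gamma>)"
  have seg: "closed_segment x y \<subseteq> Z"
    using assms by (simp add: closed_segment_subset)
  obtain B where B: "B \<ge> 0"
    "\<And>u v. closed_segment u v \<subseteq> closed_segment x y \<Longrightarrow> pullback_length f (linepath u v) \<le> ennreal (B * norm (v - u))"
    by (rule pullback_length_linepath_le[OF assms(1) compact_segment seg]) blast
  have "I \<le> pullback_length f (linepath x y)"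
    unfolding I_def using seg by (intro INF_lower) auto
  also have "\<dots> \<le> ennreal (B * norm (y - x))"
    by (rule B(2)) auto
  also have "\<dots> < top" by simp
  finally have "I = ennreal (pullback_dist f Z x y)"
    by (simp add: pullback_dist_def I_def)
  then have "pullback_dist f Z x y < c \<longleftrightarrow> I < ennreal c"
    by (simp add: pullback_dist_def ennreal_less_iff)
  also have "\<dots> \<longleftrightarrow> (\<exists>\<gamma>. valid_path \<gamma> \<and> path_image \<gamma> \<subseteq> Z \<and> pathstart \<gamma> = x \<and> pathfinish \<gamma> = y \<and> pullback_length f \<gamma> < ennreal c)"
    by (auto simp: I_def INF_less_iff)
  finally show ?thesis .
qed

lemma pullback_dist_commute:
  fixes f :: "'a::euclidean_space \<Rightarrow> 'b::euclidean_space"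
  assumes "C1_on f Z"
  shows "pullback_dist f Z x y = pullback_dist f Z y x"
proof -
  let ?P = "\<lambda>x y. {\<gamma>. valid_path \<gamma> \<and> path_image \<gamma> \<subseteq> Z \<and> pathstart \<gamma> = x \<and> pathfinish \<gamma> = y}"
  have "(INF \<gamma>\<in>?P u v. pullback_length f \<gamma>) \<le> (INF \<gamma>\<in>?P v u. pullback_length f \<gamma>)" for u v
  proof (rule INF_mono)
    fix \<gamma> assume "\<gamma> \<in> ?P v u"
    then show "\<exists>\<gamma>'\<in>?P u v. pullback_length f \<gamma>' \<le> pullback_length f \<gamma>"
      using pullback_length_reversepath[OF assms, of \<gamma>]
      by (intro bexI[of _ "reversepath \<gamma>"]) (auto simp: valid_path_imp_reverse)
  qed
  then have "(INF \<gamma>\<in>?P x y. pullback_length f \<gamma>) = (INF \<gamma>\<in>?P y x. pullback_length f \<gamma>)"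
    by (intro order_antisym)
  then show ?thesis
    by (simp only: pullback_dist_def)
qed

text \<open>
  Definiteness rests on injectivity: the length of a path is at least the distance of the images
  of its end points.
\<close>

lemma Metric_space_pullback_dist:
  fixes f :: "'a::euclidean_space \<Rightarrow> 'b::euclidean_space"
  assumes "C1_on f Z" "convex Z" "inj_on f Z"
  shows "Metric_space Z (pullback_dist f Z)"
proof
  show "0 \<le> pullback_dist f Z x y" for x y by (simp add: pullback_dist_def)
  show "pullback_dist f Z x y = pullback_dist f Z y x" for x y by (rule pullback_dist_commute[OF assms(1)])
  show "pullback_dist f Z x y = 0 \<longleftrightarrow> x = y" if xy: "x \<in> Z" "y \<in> Z" for x y
  proof
    assume 0: "pullback_dist f Z x y = 0"
    have "norm (f y - f x) < c" if "c > 0" for c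
    proof -
      obtain \<gamma> where \<gamma>: "valid_path \<gamma>" "path_image \<gamma> \<subseteq> Z" "pathstart \<gamma> = x" "pathfinish \<gamma> = y" "pullback_length f \<gamma> < ennreal c"
        using pullback_dist_less_iff[OF assms(1,2) xy, of c] 0 \<open>c > 0\<close> by auto
      have "ennreal (norm (f y - f x)) \<le> pullback_length f \<gamma>"
        using displacement_le_arc_length[OF assms(1) \<gamma>(1,2), of 0 1] \<gamma>(3,4)
        by (simp add: pullback_length_eq_arc_length pathstart_def pathfinish_def)
      from le_less_trans[OF this \<gamma>(5)] have "ennreal (norm (f y - f x)) < ennreal c" .
      then show ?thesis by (simp add: ennreal_less_iff)
    qed
    then have "f y = f x" by (metis eq_iff_diff_eq_0 less_irrefl zero_less_norm_iff)
    then show "x = y" using assms(3) xy by (auto dest: inj_onD)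
  next
    assume "x = y"
    have "pullback_length f (linepath x x) = 0"
      using xy C1_on_imp_differentiable[OF assms(1), of x] linear_frechet_derivative[of f "at x"]
      by (simp add: pullback_length_eq_arc_length arc_length_def path_speed_def linepath_def linear_0)
    then have "pullback_dist f Z x y < c" if "c > 0" for c
      using xy that \<open>x = y\<close> pullback_dist_less_iff[OF assms(1,2) xy, of c]
      by (auto intro!: exI[of _ "linepath x x"])
    then show "pullback_dist f Z x y = 0"
      by (metis \<open>\<And>y x. 0 \<le> pullback_dist f Z x y\<close> less_irrefl order_le_less)
  qed
  show "pullback_dist f Z x z \<le> pullback_dist f Z x y + pullback_dist f Z y z"
    if xyz: "x \<in> Z" "y \<in> Z" "z \<in> Z" for x y z
  proof (rule field_le_epsilon)
    fix e :: real assume "e > 0"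
    obtain \<gamma>1 where 1: "valid_path \<gamma>1" "path_image \<gamma>1 \<subseteq> Z" "pathstart \<gamma>1 = x" "pathfinish \<gamma>1 = y"
      "pullback_length f \<gamma>1 < ennreal (pullback_dist f Z x y + e/2)"
      using pullback_dist_less_iff[OF assms(1,2) xyz(1,2), of "pullback_dist f Z x y + e/2"] \<open>e > 0\<close> by auto
    obtain \<gamma>2 where 2: "valid_path \<gamma>2" "path_image \<gamma>2 \<subseteq> Z" "pathstart \<gamma>2 = y" "pathfinish \<gamma>2 = z"
      "pullback_length f \<gamma>2 < ennreal (pullback_dist f Z y z + e/2)"
      using pullback_dist_less_iff[OF assms(1,2) xyz(2,3), of "pullback_dist f Z y z + e/2"] \<open>e > 0\<close> by auto
    have "pullback_length f (\<gamma>1 +++ \<gamma>2) < ennreal (pullback_dist f Z x y + e/2) + ennreal (pullback_dist f Z y z + e/2)"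
      using pullback_length_joinpaths[OF assms(1) 1(1,2) 2(1,2)] 1(5) 2(5) by (simp add: add_strict_mono)
    also have "\<dots> = ennreal (pullback_dist f Z x y + pullback_dist f Z y z + e)"
      using \<open>e > 0\<close> by (subst ennreal_plus[symmetric]) (auto simp: pullback_dist_def)
    finally have "pullback_dist f Z x z < pullback_dist f Z x y + pullback_dist f Z y z + e"
      using 1 2 pullback_dist_less_iff[OF assms(1,2) xyz(1,3)]
      by (auto intro!: exI[of _ "\<gamma>1 +++ \<gamma>2"] valid_path_join simp: path_image_join)
    then show "pullback_dist f Z x z \<le> pullback_dist f Z x y + pullback_dist f Z y z + e" by simp
  qed
qed

text \<open>
  A ball of radius \<open>c\<close> around a point of \<open>K n\<close> stays in the compact set \<open>K (Suc n)\<close>. So a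
  Cauchy sequence eventually lies in a compact set, has a subsequence that converges in the
  Euclidean topology, and converges to the same point in the induced distance.
\<close>

lemma mcomplete_pullback_dist:
  fixes f :: "'a::euclidean_space \<Rightarrow> 'b::euclidean_space"
  assumes f: "C1_on f Z" "inj_on f Z" and Z: "convex Z" "open Z"
    and K: "\<And>n. compact (K n)" "\<And>n. K n \<subseteq> Z" "Z \<subseteq> (\<Union>n. K n)" and "c > 0"
    and long: "\<And>n \<gamma>. \<lbrakk>valid_path \<gamma>; path_image \<gamma> \<subseteq> Z; pathstart \<gamma> \<in> K n; pathfinish \<gamma> \<notin> K (Suc n)\<rbrakk>
        \<Longrightarrow> ennreal c \<le> pullback_length f \<gamma>"
  shows "Metric_space.mcomplete Z (pullback_dist f Z)"
proof -
  have M: "Metric_space Z (pullback_dist f Z)"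
    by (rule Metric_space_pullback_dist[OF f(1) Z(1) f(2)])
  show ?thesis
    unfolding Metric_space.mcomplete_def[OF M]
  proof (intro allI impI)
    fix \<sigma> assume \<sigma>: "Metric_space.MCauchy Z (pullback_dist f Z) \<sigma>"
    then have \<sigma>Z: "\<sigma> n \<in> Z" for n by (auto simp: Metric_space.MCauchy_def[OF M])
    obtain N where N': "\<forall>n n'. N \<le> n \<longrightarrow> N \<le> n' \<longrightarrow> pullback_dist f Z (\<sigma> n) (\<sigma> n') < c"
      using \<sigma> \<open>c > 0\<close> unfolding Metric_space.MCauchy_def[OF M] by blast
    then have N: "pullback_dist f Z (\<sigma> N) (\<sigma> n) < c" if "n \<ge> N" for n
      using that by blast
    obtain m where m: "\<sigma> N \<in> K m" using \<sigma>Z K(3) by blast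
    have inK: "\<sigma> n \<in> K (Suc m)" if n: "n \<ge> N" for n
    proof (rule ccontr)
      assume "\<sigma> n \<notin> K (Suc m)"
      moreover obtain \<gamma> where "valid_path \<gamma>" "path_image \<gamma> \<subseteq> Z" "pathstart \<gamma> = \<sigma> N"
          "pathfinish \<gamma> = \<sigma> n" "pullback_length f \<gamma> < ennreal c"
        using N[OF n] pullback_dist_less_iff[OF f(1) Z(1) \<sigma>Z \<sigma>Z, of N n c] by blast
      ultimately show False
        using long[where \<gamma> = \<gamma> and n = m] m by (metis leD)
    qed
    define \<tau> where "\<tau> = (\<lambda>n. \<sigma> (n + N))"
    have \<tau>K: "\<forall>n. \<tau> n \<in> K (Suc m)" using inK by (simp add: \<tau>_def)
    obtain x r where x: "x \<in> K (Suc m)" and r: "strict_mono r" "(\<tau> \<circ> r) \<longlonglongrightarrow> x"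
      by (rule seq_compactE[OF compact_imp_seq_compact[OF K(1)] \<tau>K])
    have xZ: "x \<in> Z" using x K(2) by blast
    obtain e where e: "e > 0" "cball x e \<subseteq> Z" using Z(2) xZ open_contains_cball by blast
    obtain B where B: "B \<ge> 0"
      "\<And>u v. closed_segment u v \<subseteq> cball x e \<Longrightarrow> pullback_length f (linepath u v) \<le> ennreal (B * norm (v - u))"
      by (rule pullback_length_linepath_le[OF f(1) compact_cball e(2)]) blast
    define s where "s = (\<lambda>n. r n + N)"
    have s: "strict_mono s" using r(1) by (simp add: s_def strict_mono_def)
    have sx: "(\<lambda>n. \<sigma> (s n)) \<longlonglongrightarrow> x" using r(2) by (simp add: s_def o_def \<tau>_def)
    have "limitin (Metric_space.mtopology Z (pullback_dist f Z)) (\<sigma> \<circ> s) x sequentially"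
      unfolding Metric_space.limitin_metric[OF M]
    proof (intro conjI xZ allI impI)
      fix \<epsilon> :: real assume "\<epsilon> > 0"
      have "eventually (\<lambda>n. dist (\<sigma> (s n)) x < min e (\<epsilon> / (B + 1))) sequentially"
        using sx e(1) \<open>\<epsilon> > 0\<close> B(1) by (intro tendstoD) auto
      then show "eventually (\<lambda>n. (\<sigma> \<circ> s) n \<in> Z \<and> pullback_dist f Z ((\<sigma> \<circ> s) n) x < \<epsilon>) sequentially"
      proof eventually_elim
        case (elim n)
        have seg: "closed_segment (\<sigma> (s n)) x \<subseteq> cball x e"
          using elim e(1) by (intro closed_segment_subset) (auto simp: dist_commute)
        have "B * norm (x - \<sigma> (s n)) < \<epsilon>"
        proof -
          have "B * norm (x - \<sigma> (s n)) \<le> (B + 1) * norm (x - \<sigma> (s n))"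
            by (simp add: distrib_right)
          also have "\<dots> < (B + 1) * (\<epsilon> / (B + 1))"
            using elim B(1) by (intro mult_strict_left_mono) (auto simp: dist_norm norm_minus_commute)
          finally show ?thesis using B(1) by simp
        qed
        then have "pullback_length f (linepath (\<sigma> (s n)) x) < ennreal \<epsilon>"
          using B(2)[OF seg] by (meson ennreal_lessI \<open>\<epsilon> > 0\<close> le_less_trans)
        moreover have "closed_segment (\<sigma> (s n)) x \<subseteq> Z" using seg e(2) by (rule order_trans)
        ultimately have "pullback_dist f Z (\<sigma> (s n)) x < \<epsilon>"
          by (auto simp: pullback_dist_less_iff[OF f(1) Z(1) \<sigma>Z xZ] intro!: exI[of _ "linepath (\<sigma> (s n)) x"])
        then show ?case using \<sigma>Z by simp
      qed
    qed
    then show "\<exists>x. limitin (Metric_space.mtopology Z (pullback_dist f Z)) \<sigma> x sequentially"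
      using Metric_space.MCauchy_convergent_subsequence[OF M \<sigma> s] by blast
  qed
qed


section \<open>A labyrinth of plates in a spherical shell\<close>

text \<open>
  A lower bound for the length of a curve on an interval. The total variation of \<open>c\<close> is the
  least superadditive interval function dominating its displacements; quantifying over all such
  functions allows the bound to be applied to the length of another curve that moves
  at least as fast as \<open>c\<close>.
\<close>

definition variation_ge :: "(real \<Rightarrow> 'a::real_normed_vector) \<Rightarrow> real \<Rightarrow> real \<Rightarrow> real \<Rightarrow> bool"
  where "variation_ge c \<alpha> \<beta> v \<longleftrightarrow>
    (\<forall>L :: real \<Rightarrow> real \<Rightarrow> ennreal.
      (\<forall>x y z. \<alpha> \<le> x \<longrightarrow> x \<le> y \<longrightarrow> y \<le> z \<longrightarrow> z \<le> \<beta> \<longrightarrow> L x y + L y z \<le> L x z) \<longrightarrow>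
      (\<forall>x y. \<alpha> \<le> x \<longrightarrow> x \<le> y \<longrightarrow> y \<le> \<beta> \<longrightarrow> ennreal (norm (c y - c x)) \<le> L x y) \<longrightarrow>
      ennreal v \<le> L \<alpha> \<beta>)"

lemma variation_geD:
  assumes "variation_ge c \<alpha> \<beta> v"
    and "\<And>x y z. \<lbrakk>\<alpha> \<le> x; x \<le> y; y \<le> z; z \<le> \<beta>\<rbrakk> \<Longrightarrow> L x y + L y z \<le> L x z"
    and "\<And>x y. \<lbrakk>\<alpha> \<le> x; x \<le> y; y \<le> \<beta>\<rbrakk> \<Longrightarrow> ennreal (norm (c y - c x)) \<le> L x y"
  shows "ennreal v \<le> L \<alpha> \<beta>"
  using assms unfolding variation_ge_def by blast

lemma variation_ge_displacement:
  assumes "\<alpha> \<le> s" "s \<le> \<beta>" "v \<le> norm (c s - c \<alpha>)"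
  shows "variation_ge c \<alpha> \<beta> v"
  unfolding variation_ge_def
proof (intro allI impI)
  fix L :: "real \<Rightarrow> real \<Rightarrow> ennreal"
  assume 1: "\<forall>x y z. \<alpha> \<le> x \<longrightarrow> x \<le> y \<longrightarrow> y \<le> z \<longrightarrow> z \<le> \<beta> \<longrightarrow> L x y + L y z \<le> L x z"
    and 2: "\<forall>x y. \<alpha> \<le> x \<longrightarrow> x \<le> y \<longrightarrow> y \<le> \<beta> \<longrightarrow> ennreal (norm (c y - c x)) \<le> L x y"
  have "ennreal v \<le> ennreal (norm (c s - c \<alpha>))" using assms(3) by (rule ennreal_leI)
  also have "\<dots> \<le> L \<alpha> s" using 2 assms by simp
  also have "\<dots> \<le> L \<alpha> s + L s \<beta>" by simp
  also have "\<dots> \<le> L \<alpha> \<beta>" using 1 assms by simp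
  finally show "ennreal v \<le> L \<alpha> \<beta>" .
qed

lemma variation_ge_add:
  assumes "\<alpha> \<le> m" "m \<le> \<beta>" "0 \<le> v" "0 \<le> w" "variation_ge c \<alpha> m v" "variation_ge c m \<beta> w"
  shows "variation_ge c \<alpha> \<beta> (v + w)"
  unfolding variation_ge_def
proof (intro allI impI)
  fix L :: "real \<Rightarrow> real \<Rightarrow> ennreal"
  assume 1: "\<forall>x y z. \<alpha> \<le> x \<longrightarrow> x \<le> y \<longrightarrow> y \<le> z \<longrightarrow> z \<le> \<beta> \<longrightarrow> L x y + L y z \<le> L x z"
    and 2: "\<forall>x y. \<alpha> \<le> x \<longrightarrow> x \<le> y \<longrightarrow> y \<le> \<beta> \<longrightarrow> ennreal (norm (c y - c x)) \<le> L x y"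
  have "ennreal v \<le> L \<alpha> m"
    by (rule variation_geD[OF assms(5)]) (use 1 2 assms in auto)
  moreover have "ennreal w \<le> L m \<beta>"
    by (rule variation_geD[OF assms(6)]) (use 1 2 assms in auto)
  ultimately have "ennreal (v + w) \<le> L \<alpha> m + L m \<beta>"
    using assms by (simp add: ennreal_plus add_mono)
  also have "\<dots> \<le> L \<alpha> \<beta>" using 1 assms by simp
  finally show "ennreal (v + w) \<le> L \<alpha> \<beta>" .
qed

lemma variation_ge_initial:
  assumes "variation_ge c \<alpha> m v" "\<alpha> \<le> m" "m \<le> \<beta>" "0 \<le> v"
  shows "variation_ge c \<alpha> \<beta> v"
  using variation_ge_add[OF assms(2,3,4) order_refl assms(1)] variation_ge_displacement[of m m \<beta> 0 c] assms
  by simp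

lemma variation_ge_mono:
  assumes "variation_ge c \<alpha> \<beta> w" "v \<le> w"
  shows "variation_ge c \<alpha> \<beta> v"
  unfolding variation_ge_def
proof (intro allI impI)
  fix L :: "real \<Rightarrow> real \<Rightarrow> ennreal"
  assume 1: "\<forall>x y z. \<alpha> \<le> x \<longrightarrow> x \<le> y \<longrightarrow> y \<le> z \<longrightarrow> z \<le> \<beta> \<longrightarrow> L x y + L y z \<le> L x z"
    and 2: "\<forall>x y. \<alpha> \<le> x \<longrightarrow> x \<le> y \<longrightarrow> y \<le> \<beta> \<longrightarrow> ennreal (norm (c y - c x)) \<le> L x y"
  have "ennreal v \<le> ennreal w" using assms(2) by (rule ennreal_leI)
  also have "\<dots> \<le> L \<alpha> \<beta>"
    by (rule variation_geD[OF assms(1)]) (use 1 2 in auto)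
  finally show "ennreal v \<le> L \<alpha> \<beta>" .
qed

text \<open>
  Project the points of a cubic grid near the sphere radially to it. They come as close to every
  point of the sphere as the mesh permits, and two different grid points with congruent coordinates
  modulo \<open>m\<close> are at least \<open>m\<close> meshes apart. Hence the number of residue classes, unlike the number of points, depends
  only on the required ratio \<open>\<kappa>\<close> of separation and density.
\<close>

lemma separated_sphere_nets:
  fixes \<kappa> :: real
  assumes "\<kappa> > 0"
  obtains M :: nat where "M > 0"
    "\<And>\<theta>. \<lbrakk>0 < \<theta>; \<theta> \<le> 1\<rbrakk> \<Longrightarrow> \<exists>E :: nat \<Rightarrow> 'a::euclidean_space set.
       (\<forall>c. finite (E c) \<and> (\<forall>e\<in>E c. norm e = 1) \<and>
            (\<forall>e\<in>E c. \<forall>e'\<in>E c. e \<noteq> e' \<longrightarrow> \<kappa> * \<theta> < dist e e')) \<and>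
       (\<forall>x. norm x = 1 \<longrightarrow> (\<exists>c<M. \<exists>e\<in>E c. dist x e \<le> \<theta>))"
proof -
  define d where "d = real DIM('a)"
  have d: "d > 0" by (simp add: d_def)
  define m :: int where "m = \<lceil>2 * d * (\<kappa> + 1)\<rceil> + 1"
  have m: "2 * d * (\<kappa> + 1) < of_int m" by (simp add: m_def) linarith
  have "0 < 2 * d * (\<kappa> + 1)" using d assms by simp
  then have "0 < real_of_int m" using m by linarith
  then have mpos: "m > 0" by simp
  define C :: "('a \<Rightarrow> int) set" where "C = PiE Basis (\<lambda>_. {0..<m})"
  have finC: "finite C" by (simp add: C_def finite_PiE)
  obtain h where h: "bij_betw h {0..<card C} C" using ex_bij_betw_nat_finite[OF finC] by blast
  have neC: "C \<noteq> {}" using mpos by (auto simp: C_def PiE_eq_empty_iff)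
  show thesis
  proof (rule that[of "card C"])
    show "card C > 0" using finC neC by (simp add: card_gt_0_iff)
    fix \<theta> :: real assume \<theta>: "0 < \<theta>" "\<theta> \<le> 1"
\<comment> \<open>The mesh: rounding down all coordinates moves a point by at most half of \<open>\<theta>\<close>, and the radial projection by as much again.\<close>
    define \<tau> where "\<tau> = \<theta> / (2 * d)"
    have \<tau>: "\<tau> > 0" using \<theta> d by (simp add: \<tau>_def)
    define k :: "'a \<Rightarrow> 'a \<Rightarrow> int" where "k = (\<lambda>x. restrict (\<lambda>i. \<lfloor>(x \<bullet> i) / \<tau>\<rfloor>) Basis)"
    define P :: "('a \<Rightarrow> int) \<Rightarrow> 'a" where "P = (\<lambda>g. \<Sum>i\<in>Basis. (\<tau> * of_int (g i)) *\<^sub>R i)"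
    define e where "e = (\<lambda>x. P (k x) /\<^sub>R norm (P (k x)))"
    define r where "r = (\<lambda>x. restrict (\<lambda>i. k x i mod m) Basis)"
    define E where "E = (\<lambda>c. e ` {x. norm x = 1 \<and> r x = h c})"
    have Pi: "P g \<bullet> i = \<tau> * of_int (g i)" if "i \<in> Basis" for g i
      using that by (simp add: P_def)
    have near: "norm (x - P (k x)) \<le> \<theta> / 2" for x
    proof -
      have "norm (x - P (k x)) \<le> (\<Sum>i\<in>Basis. \<bar>(x - P (k x)) \<bullet> i\<bar>)"
        by (rule norm_le_l1)
      also have "\<dots> \<le> (\<Sum>i\<in>(Basis::'a set). \<tau>)"
      proof (rule sum_mono)
        fix i :: 'a assume i: "i \<in> Basis"
        have "\<tau> * of_int \<lfloor>(x \<bullet> i) / \<tau>\<rfloor> \<le> x \<bullet> i" "x \<bullet> i \<le> \<tau> * of_int \<lfloor>(x \<bullet> i) / \<tau>\<rfloor> + \<tau>"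
          using floor_divide_lower[OF \<tau>, of "x \<bullet> i"] floor_divide_upper[OF \<tau>, of "x \<bullet> i"]
          by (simp_all add: algebra_simps)
        then show "\<bar>(x - P (k x)) \<bullet> i\<bar> \<le> \<tau>"
          using i by (simp add: inner_diff_left Pi k_def)
      qed
      also have "\<dots> = \<theta> / 2" using d by (simp add: \<tau>_def d_def)
      finally show ?thesis .
    qed
    have nP: "P (k x) \<noteq> 0" "norm (P (k x) - e x) \<le> \<theta> / 2" "norm (e x) = 1" if "norm x = 1" for x
    proof -
      show *: "P (k x) \<noteq> 0"
        using near[of x] that \<theta> by auto
      then show "norm (e x) = 1" by (simp add: e_def)
      have "P (k x) - e x = (1 - inverse (norm (P (k x)))) *\<^sub>R P (k x)"
        by (simp add: e_def scaleR_left_diff_distrib)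
      then have "norm (P (k x) - e x) = \<bar>(1 - inverse (norm (P (k x)))) * norm (P (k x))\<bar>"
        by (simp add: abs_mult)
      also have "\<dots> = \<bar>norm (P (k x)) - norm x\<bar>"
        using * that by (simp add: left_diff_distrib)
      also have "\<dots> \<le> norm (P (k x) - x)" by (rule norm_triangle_ineq3)
      also have "\<dots> \<le> \<theta> / 2" using near[of x] by (simp add: norm_minus_commute)
      finally show "norm (P (k x) - e x) \<le> \<theta> / 2" .
    qed
    have fin: "finite (E c)" for c
    proof -
      define n :: int where "n = \<lceil>1 / \<tau>\<rceil> + 1"
      have "k x \<in> PiE Basis (\<lambda>_. {- n..n})" if "norm x = 1" for x
      proof (rule PiE_I)
        fix i :: 'a assume i: "i \<in> Basis"
        have "\<bar>(x \<bullet> i) / \<tau>\<bar> \<le> 1 / \<tau>"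
          using Basis_le_norm[OF i, of x] that \<tau> by (simp add: abs_divide divide_right_mono)
        then have "- (1/\<tau>) \<le> (x \<bullet> i) / \<tau>" "(x \<bullet> i) / \<tau> \<le> 1/\<tau>" by linarith+
        then show "k x i \<in> {- n..n}"
          using i by (auto simp: k_def n_def) linarith+
      qed (simp add: k_def)
      then have "E c \<subseteq> (\<lambda>g. P g /\<^sub>R norm (P g)) ` PiE Basis (\<lambda>_. {- n..n})"
        by (auto simp: E_def e_def)
      then show ?thesis by (rule finite_subset) (simp add: finite_PiE)
    qed
    have sep: "\<kappa> * \<theta> < dist (e x) (e y)" if xy: "norm x = 1" "norm y = 1" "r x = r y" "e x \<noteq> e y" for x y
    proof -
      have "k x \<noteq> k y" using xy(4) by (auto simp: e_def)
      then obtain i where i: "i \<in> Basis" "k x i \<noteq> k y i"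
        by (auto simp: k_def restrict_def fun_eq_iff split: if_splits)
      have "k x i mod m = k y i mod m"
        using xy(3) i(1) by (metis r_def restrict_apply')
      then have "m dvd (k x i - k y i)" by (simp add: mod_eq_dvd_iff)
      then have "m \<le> \<bar>k x i - k y i\<bar>" using i(2) zdvd_imp_le[of m "\<bar>k x i - k y i\<bar>"] by simp
      then have "of_int m \<le> \<bar>of_int (k x i) - of_int (k y i) :: real\<bar>"
        by (metis of_int_abs of_int_diff of_int_le_iff)
      then have "\<tau> * of_int m \<le> \<tau> * \<bar>of_int (k x i) - of_int (k y i)\<bar>"
        using \<tau> by simp
      also have "\<dots> = \<bar>(P (k x) - P (k y)) \<bullet> i\<bar>"
        using \<tau> i(1) by (simp add: inner_diff_left Pi abs_mult right_diff_distrib[symmetric])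
      also have "\<dots> \<le> norm (P (k x) - P (k y))" by (rule Basis_le_norm[OF i(1)])
      also have "\<dots> \<le> norm (P (k x) - e x) + norm (e x - e y) + norm (P (k y) - e y)"
        using norm_triangle_ineq[of "P (k x) - e x" "e x - e y"]
          norm_triangle_ineq[of "P (k x) - e y" "e y - P (k y)"] by (simp add: norm_minus_commute)
      also have "\<dots> \<le> dist (e x) (e y) + \<theta>"
        using nP(2)[OF xy(1)] nP(2)[OF xy(2)] by (simp add: dist_norm)
      finally have 1: "\<tau> * of_int m \<le> dist (e x) (e y) + \<theta>" .
      have "\<tau> * (2 * d * (\<kappa> + 1)) < \<tau> * of_int m" using m \<tau> by simp
      moreover have "\<tau> * (2 * d * (\<kappa> + 1)) = \<kappa> * \<theta> + \<theta>" using d by (simp add: \<tau>_def field_simps)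
      ultimately show ?thesis using 1 by linarith
    qed
    show "\<exists>E :: nat \<Rightarrow> 'a set.
       (\<forall>c. finite (E c) \<and> (\<forall>e\<in>E c. norm e = 1) \<and>
            (\<forall>e\<in>E c. \<forall>e'\<in>E c. e \<noteq> e' \<longrightarrow> \<kappa> * \<theta> < dist e e')) \<and>
       (\<forall>x. norm x = 1 \<longrightarrow> (\<exists>c<card C. \<exists>e\<in>E c. dist x e \<le> \<theta>))"
    proof (intro exI[of _ E] conjI allI ballI impI)
      fix c show "finite (E c)" by (rule fin)
      fix u assume u: "u \<in> E c"
      then show "norm u = 1" by (auto simp: E_def nP)
      fix v assume v: "v \<in> E c" "u \<noteq> v"
      then show "\<kappa> * \<theta> < dist u v" using sep u by (auto simp: E_def)
    next
      fix x :: 'a assume x: "norm x = 1"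
      have "r x \<in> C" using mpos by (auto simp: r_def C_def)
      then have "r x \<in> h ` {0..<card C}" by (simp add: bij_betw_imp_surj_on[OF h])
      then obtain c where c: "c < card C" "r x = h c" by auto
      have "dist x (e x) \<le> norm (x - P (k x)) + norm (P (k x) - e x)"
        using norm_triangle_ineq[of "x - P (k x)" "P (k x) - e x"] by (simp add: dist_norm)
      also have "\<dots> \<le> \<theta>" using near[of x] nP(2)[OF x] by simp
      finally show "\<exists>c<card C. \<exists>e\<in>E c. dist x e \<le> \<theta>"
        using c x by (auto simp: E_def intro!: exI[of _ c])
    qed
  qed
qed

text \<open>
  A flat ball of codimension one and radius \<open>t\<close>, tangent to the sphere of radius \<open>\<rho>\<close> at \<open>\<rho> u\<close>.
\<close>

definition plate :: "'a::real_inner \<Rightarrow> real \<Rightarrow> real \<Rightarrow> 'a set"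
  where "plate u \<rho> t = {x. x \<bullet> u = \<rho> \<and> norm (x - \<rho> *\<^sub>R u) \<le> t}"

lemma norm_axis_decomposition:
  assumes "norm u = 1"
  shows "(norm x)\<^sup>2 = (x \<bullet> u)\<^sup>2 + (norm (x - (x \<bullet> u) *\<^sub>R u))\<^sup>2"
proof -
  have uu: "u \<bullet> u = 1" using assms by (simp add: norm_eq_1)
  show ?thesis
    unfolding power2_norm_eq_inner
    by (simp add: inner_diff_left inner_diff_right uu inner_commute power2_eq_square)
qed

lemma norm_minus_axis_le:
  assumes "norm u = 1"
  shows "norm (x - (x \<bullet> u) *\<^sub>R u) \<le> norm (x - s *\<^sub>R u)"
proof -
  have uu: "u \<bullet> u = 1" using assms by (simp add: norm_eq_1)
  have "(x - s *\<^sub>R u) - ((x - s *\<^sub>R u) \<bullet> u) *\<^sub>R u = x - (x \<bullet> u) *\<^sub>R u"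
    by (simp add: inner_diff_left uu algebra_simps)
  then have "(norm (x - s *\<^sub>R u))\<^sup>2 = ((x - s *\<^sub>R u) \<bullet> u)\<^sup>2 + (norm (x - (x \<bullet> u) *\<^sub>R u))\<^sup>2"
    using norm_axis_decomposition[OF assms, of "x - s *\<^sub>R u"] by (simp only:)
  then have "(norm (x - (x \<bullet> u) *\<^sub>R u))\<^sup>2 \<le> (norm (x - s *\<^sub>R u))\<^sup>2"
    by simp
  then show ?thesis by (rule power2_le_imp_le) simp
qed

text \<open>
  Let \<open>D\<close> be the distance of \<open>u\<close> and \<open>u'\<close>. Seen from \<open>u'\<close>, the centre of the plate at \<open>u\<close> lies
  \<open>\<rho> D\<^sup>2 / 2\<close> below the tangent hyperplane, whereas moving on the plate gains at most \<open>t D\<close>.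
\<close>

lemma plate_below_same_layer:
  assumes "norm u = 1" "norm u' = 1" "x \<in> plate u \<rho> t" "0 < \<rho>" "2 * t < \<rho> * dist u u'"
  shows "x \<bullet> u' < \<rho>"
proof -
  define D where "D = dist u u'"
  have uu: "u \<bullet> u = 1" "u' \<bullet> u' = 1" using assms(1,2) by (simp_all add: norm_eq_1)
  have x: "x \<bullet> u = \<rho>" "norm (x - \<rho> *\<^sub>R u) \<le> t" using assms(3) by (auto simp: plate_def)
  have t: "0 \<le> t" using x(2) norm_ge_zero order_trans by blast
  have D: "D > 0"
  proof (rule ccontr)
    assume "\<not> D > 0" then have "D = 0" by (simp add: D_def)
    then show False using assms(5) t by (simp add: D_def)
  qed
  have "D\<^sup>2 = 2 - 2 * (u \<bullet> u')"
    unfolding D_def dist_norm power2_norm_eq_inner by (simp add: inner_diff_left inner_diff_right uu inner_commute)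
  then have i: "u \<bullet> u' = 1 - D\<^sup>2 / 2" by linarith
  have "(x - \<rho> *\<^sub>R u) \<bullet> u' = (x - \<rho> *\<^sub>R u) \<bullet> (u' - u)"
    by (simp add: inner_diff_left inner_diff_right uu x(1))
  also have "\<dots> \<le> norm (x - \<rho> *\<^sub>R u) * norm (u' - u)" by (rule norm_cauchy_schwarz)
  also have "\<dots> \<le> t * D" using x(2) by (simp add: D_def dist_norm norm_minus_commute mult_right_mono)
  finally have "x \<bullet> u' \<le> \<rho> * (u \<bullet> u') + t * D" by (simp add: inner_diff_left)
  also have "\<dots> = \<rho> - D * (\<rho> * D - 2 * t) / 2" by (simp add: i power2_eq_square field_simps)
  also have "\<dots> < \<rho>" using D assms(5) by (simp add: D_def)
  finally show ?thesis .
qed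

lemma plate_below_outer_layer:
  assumes "norm u = 1" "norm u' = 1" "x \<in> plate u \<rho> t" "\<rho>\<^sup>2 + t\<^sup>2 < \<rho>'\<^sup>2" "0 \<le> \<rho>'"
  shows "x \<bullet> u' < \<rho>'"
proof -
  have x: "x \<bullet> u = \<rho>" "norm (x - \<rho> *\<^sub>R u) \<le> t" using assms(3) by (auto simp: plate_def)
  have "(norm x)\<^sup>2 \<le> \<rho>\<^sup>2 + t\<^sup>2"
    using norm_axis_decomposition[OF assms(1), of x] x by (simp add: power_mono)
  then have "norm x < \<rho>'" using assms(4,5) by (meson le_less_trans power2_less_imp_less)
  moreover have "x \<bullet> u' \<le> norm x" using norm_cauchy_schwarz[of x u'] assms(2) by simp
  ultimately show ?thesis by simp
qed

text \<open>
  A curve that stays within \<open>t / 4\<close> of its starting point remains within \<open>t / 2\<close> of the axis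
  through \<open>e\<close>. While its norm grows beyond that of the points of the plate, its component along \<open>e\<close>
  passes the height of the plate, and at that moment the curve meets the plate.
\<close>

lemma displacement_crossing_layers:
  fixes c :: "real \<Rightarrow> 'a::real_inner"
  assumes "\<alpha> \<le> \<beta>" and cont: "continuous_on {\<alpha>..\<beta>} c" and e: "norm e = 1"
    and start: "norm (c \<alpha> - norm (c \<alpha>) *\<^sub>R e) \<le> t / 4" and "t < 2 * norm (c \<alpha>)"
    and "0 < t" "norm (c \<alpha>) \<le> \<rho>" "0 < \<rho>" "\<rho>\<^sup>2 + t\<^sup>2 \<le> (norm (c \<beta>))\<^sup>2"
    and avoid: "\<And>s. s \<in> {\<alpha>..\<beta>} \<Longrightarrow> c s \<notin> plate e \<rho> t"
  obtains s where "\<alpha> \<le> s" "s \<le> \<beta>" "t / 4 \<le> norm (c s - c \<alpha>)"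
proof (rule ccontr)
  assume no: "\<not> thesis"
  note found = that
  have near: "norm (c s - c \<alpha>) < t / 4" if "s \<in> {\<alpha>..\<beta>}" for s
    using found[of s] no that by (meson atLeastAtMost_iff not_le)
  have axis: "norm (c s - norm (c \<alpha>) *\<^sub>R e) \<le> t / 2" if "s \<in> {\<alpha>..\<beta>}" for s
  proof -
    have "norm (c s - norm (c \<alpha>) *\<^sub>R e) \<le> norm (c s - c \<alpha>) + norm (c \<alpha> - norm (c \<alpha>) *\<^sub>R e)"
      by (metis dist_norm dist_triangle)
    then show ?thesis using near[OF that] start by simp
  qed
  have lat: "norm (c s - (c s \<bullet> e) *\<^sub>R e) \<le> t / 2" if "s \<in> {\<alpha>..\<beta>}" for s
    using norm_minus_axis_le[OF e, of "c s" "norm (c \<alpha>)"] axis[OF that] by simp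
  have ee: "e \<bullet> e = 1" using e by (simp add: norm_eq_1)
  have "\<bar>(c \<beta> - norm (c \<alpha>) *\<^sub>R e) \<bullet> e\<bar> \<le> t / 2"
    using Cauchy_Schwarz_ineq2[of "c \<beta> - norm (c \<alpha>) *\<^sub>R e" e] axis[of \<beta>] assms(1) e by simp
  then have pos: "0 < c \<beta> \<bullet> e"
    using assms(5) by (simp only: inner_diff_left inner_scaleR_left ee)
  have "(c \<beta> \<bullet> e)\<^sup>2 \<ge> (norm (c \<beta>))\<^sup>2 - (t / 2)\<^sup>2"
    using norm_axis_decomposition[OF e, of "c \<beta>"] lat[of \<beta>] assms(1)
      power_mono[of "norm (c \<beta> - (c \<beta> \<bullet> e) *\<^sub>R e)" "t / 2" 2] by simp
  moreover have "(t / 2)\<^sup>2 \<le> t\<^sup>2" using \<open>0 < t\<close> by (simp add: power2_eq_square)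
  ultimately have "\<rho>\<^sup>2 \<le> (c \<beta> \<bullet> e)\<^sup>2" using assms(9) by linarith
  then have end_: "\<rho> \<le> c \<beta> \<bullet> e" using pos by (meson less_imp_le power2_le_imp_le)
  have start': "c \<alpha> \<bullet> e \<le> \<rho>"
    using norm_cauchy_schwarz[of "c \<alpha>" e] e assms(7) by simp
  have "continuous_on {\<alpha>..\<beta>} (\<lambda>s. c s \<bullet> e)" using cont by (intro continuous_intros)
  then obtain s where s: "\<alpha> \<le> s" "s \<le> \<beta>" "c s \<bullet> e = \<rho>"
    using IVT'[of "\<lambda>s. c s \<bullet> e" \<alpha> \<rho> \<beta>] start' end_ assms(1) by auto
  then have "c s \<in> plate e \<rho> t" using lat[of s] \<open>0 < t\<close> by (auto simp: plate_def)
  then show False using avoid s by auto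
qed

text \<open>
  The plates are arranged in layers on spheres whose squared radii increase by \<open>2 t\<^sup>2\<close>, so
  that each layer lies outside the preceding ones; the layers run cyclically through the \<open>M\<close> classes of a
  separated net. Within \<open>M\<close> consecutive layers every direction is close to the centre of some
  plate, so crossing them costs length \<open>t / 4\<close>. As \<open>M\<close> does not depend on \<open>t\<close>, the \<open>4 / t\<close>
  crossings needed for total length one use up a thickness of order \<open>M t\<close> only, which fits into the shell
  once \<open>t\<close> is small.
\<close>

lemma ex_labyrinth:
  fixes a b :: real
  assumes "0 < a" "a < b"
  obtains t :: real and xs :: "('a::euclidean_space \<times> real) list" where "0 < t"
    "\<And>u \<rho>. (u, \<rho>) \<in> set xs \<Longrightarrow> norm u = 1 \<and> a < \<rho>"
    "sorted_wrt (\<lambda>(u, \<rho>) (u', \<rho>'). \<forall>x\<in>plate u \<rho> t. x \<bullet> u' < \<rho>') xs"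
    "\<And>c \<alpha> \<beta>. \<lbrakk>\<alpha> \<le> \<beta>; continuous_on {\<alpha>..\<beta>} c; norm (c \<alpha>) \<le> a; b \<le> norm (c \<beta>);
        \<And>s u \<rho>. \<lbrakk>s \<in> {\<alpha>..\<beta>}; (u, \<rho>) \<in> set xs\<rbrakk> \<Longrightarrow> c s \<notin> plate u \<rho> t\<rbrakk> \<Longrightarrow> variation_ge c \<alpha> \<beta> 1"
proof -
\<comment> \<open>Plates of one layer do not interfere if their centres are more than \<open>2 t / a\<close> apart on the unit sphere; with \<open>\<theta> = t / (4 b)\<close> below, \<open>\<kappa> \<theta> = 9 t / (4 a)\<close>.\<close>
  define \<kappa> where "\<kappa> = 9 * b / a"
  have "\<kappa> > 0" using assms by (simp add: \<kappa>_def)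
  then obtain M :: nat where M: "M > 0" and net: "\<And>\<theta>. \<lbrakk>0 < \<theta>; \<theta> \<le> 1\<rbrakk> \<Longrightarrow> \<exists>E :: nat \<Rightarrow> 'a set.
       (\<forall>c. finite (E c) \<and> (\<forall>e\<in>E c. norm e = 1) \<and>
            (\<forall>e\<in>E c. \<forall>e'\<in>E c. e \<noteq> e' \<longrightarrow> \<kappa> * \<theta> < dist e e')) \<and>
       (\<forall>x. norm x = 1 \<longrightarrow> (\<exists>c<M. \<exists>e\<in>E c. dist x e \<le> \<theta>))"
    by (rule separated_sphere_nets[where 'a = 'a]) blast
  have ab: "0 < b\<^sup>2 - a\<^sup>2" using assms by (simp add: power_strict_mono)
  define t where "t = min (min 1 a) ((b\<^sup>2 - a\<^sup>2) / (10 * real M + 2))"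
  have t: "0 < t" "t \<le> 1" "t \<le> a" "t * (10 * real M + 2) \<le> b\<^sup>2 - a\<^sup>2"
  proof -
    show "0 < t" "t \<le> 1" "t \<le> a" using assms ab by (auto simp: t_def)
    have "t \<le> (b\<^sup>2 - a\<^sup>2) / (10 * real M + 2)" by (simp add: t_def)
    then show "t * (10 * real M + 2) \<le> b\<^sup>2 - a\<^sup>2" by (simp add: pos_le_divide_eq add_nonneg_pos)
  qed
  define \<theta> where "\<theta> = t / (4 * b)"
  have \<theta>: "0 < \<theta>" "\<theta> \<le> 1" using t assms by (auto simp: \<theta>_def)
  obtain E :: "nat \<Rightarrow> 'a set" where E: "\<And>c. finite (E c)" "\<And>c e. e \<in> E c \<Longrightarrow> norm e = 1"
      "\<And>c e e'. \<lbrakk>e \<in> E c; e' \<in> E c; e \<noteq> e'\<rbrakk> \<Longrightarrow> \<kappa> * \<theta> < dist e e'"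
      "\<And>x. norm x = 1 \<Longrightarrow> \<exists>c<M. \<exists>e\<in>E c. dist x e \<le> \<theta>"
    using net[OF \<theta>] by metis
  define J where "J = nat \<lceil>4 / t\<rceil>"
  have J: "4 / t \<le> real J" "real J \<le> 4 / t + 1" 
  proof -
    have "0 < 4 / t" using t by simp
    then show "4 / t \<le> real J" "real J \<le> 4 / t + 1" unfolding J_def by linarith+
  qed
  define \<rho> where "\<rho> = (\<lambda>j::nat. sqrt (a\<^sup>2 + 2 * (real j + 1) * t\<^sup>2))"
  have \<rho>2: "(\<rho> j)\<^sup>2 = a\<^sup>2 + 2 * (real j + 1) * t\<^sup>2" for j by (simp add: \<rho>_def)
  have \<rho>a: "a < \<rho> j" for j
    using t(1) assms(1) by (auto simp: \<rho>_def intro!: real_less_rsqrt)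
  have \<rho>pos: "0 < \<rho> j" for j using \<rho>a[of j] assms by simp
  have \<rho>mono: "i \<le> j \<Longrightarrow> \<rho> i \<le> \<rho> j" for i j
    by (auto simp: \<rho>_def intro!: mult_right_mono)
  have \<rho>b: "\<rho> j \<le> b" if "j \<le> J * M" for j
  proof -
    have "real j \<le> (4 / t + 1) * real M"
    proof -
      have "real j \<le> real J * real M" using that by (metis of_nat_le_iff of_nat_mult)
      also have "\<dots> \<le> (4 / t + 1) * real M" using J(2) by (intro mult_right_mono) auto
      finally show ?thesis .
    qed
    then have "2 * (real j + 1) * t\<^sup>2 \<le> 2 * ((4 / t + 1) * real M + 1) * t\<^sup>2"
      by (intro mult_right_mono) auto
    also have "\<dots> = 2 * real M * (4 / t * t\<^sup>2) + (2 * real M + 2) * t\<^sup>2"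
      by (simp add: algebra_simps)
    also have "4 / t * t\<^sup>2 = 4 * t"
      using t(1) by (simp add: power2_eq_square)
    also have "2 * real M * (4 * t) + (2 * real M + 2) * t\<^sup>2 = t * (8 * real M + 2 * real M * t + 2 * t)"
      by (simp add: power2_eq_square algebra_simps)
    also have "\<dots> \<le> t * (8 * real M + 2 * real M * 1 + 2 * 1)"
      using t by (intro mult_left_mono add_mono order_refl) (auto simp: mult_left_le)
    also have "\<dots> \<le> b\<^sup>2 - a\<^sup>2" using t(4) by (simp add: algebra_simps)
    finally have "(\<rho> j)\<^sup>2 \<le> b\<^sup>2" by (simp add: \<rho>2)
    then show ?thesis using assms by (meson less_imp_le less_trans power2_le_imp_le)
  qed
  define R where "R = (\<lambda>(u :: 'a, \<rho>) (u', \<rho>'). \<forall>x\<in>plate u \<rho> t. x \<bullet> u' < \<rho>')"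
  have layers: "\<exists>xs. set xs = {(u, \<rho> j) |u j. j < n \<and> u \<in> E (j mod M)} \<and> sorted_wrt R xs" for n
  proof (induction n)
    case 0
    show ?case by (intro exI[of _ "[]"]) auto
  next
    case (Suc n)
    then obtain xs where xs: "set xs = {(u, \<rho> j) |u j. j < n \<and> u \<in> E (j mod M)}" "sorted_wrt R xs" by blast
    obtain us where us: "set us = E (n mod M)" "distinct us" using finite_distinct_list[OF E(1)] by blast
    have "sorted_wrt (\<lambda>u u'. u \<in> set us \<and> u' \<in> set us \<and> u \<noteq> u') us"
      using us(2) by (auto simp: sorted_wrt_iff_nth_less distinct_conv_nth)
    then have "sorted_wrt (\<lambda>u u'. R (u, \<rho> n) (u', \<rho> n)) us"
    proof (rule sorted_wrt_mono_rel[rotated])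
      fix u u' assume "u \<in> set us \<and> u' \<in> set us \<and> u \<noteq> u'"
      then have u: "u \<in> E (n mod M)" "u' \<in> E (n mod M)" "u \<noteq> u'" using us by auto
      have "2 * t < a * (\<kappa> * \<theta>)" using assms t(1) by (simp add: \<kappa>_def \<theta>_def)
      also have "\<dots> \<le> \<rho> n * dist u u'"
        using \<rho>a[of n] E(3)[OF u] assms \<open>\<kappa> > 0\<close> \<theta> by (intro mult_mono) auto
      finally show "R (u, \<rho> n) (u', \<rho> n)"
        using plate_below_same_layer[OF E(2)[OF u(1)] E(2)[OF u(2)] _ \<rho>pos] by (auto simp: R_def)
    qed
    then have "sorted_wrt R (map (\<lambda>u. (u, \<rho> n)) us)" by (simp add: sorted_wrt_map)
    moreover have "R y z" if yz: "y \<in> set xs" "z \<in> set (map (\<lambda>u. (u, \<rho> n)) us)" for y z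
    proof -
      obtain u j where y: "y = (u, \<rho> j)" "j < n" "u \<in> E (j mod M)" using yz(1) xs(1) by auto
      obtain u' where z: "z = (u', \<rho> n)" "u' \<in> E (n mod M)" using yz(2) us(1) by auto
      have "(\<rho> j)\<^sup>2 + t\<^sup>2 < (\<rho> n)\<^sup>2"
      proof -
        have "(\<rho> j)\<^sup>2 + t\<^sup>2 = a\<^sup>2 + (2 * real j + 3) * t\<^sup>2" by (simp add: \<rho>2 algebra_simps)
        also have "\<dots> < a\<^sup>2 + (2 * (real n + 1)) * t\<^sup>2"
          using t(1) y(2) by (intro add_strict_left_mono mult_strict_right_mono) auto
        finally show ?thesis by (simp add: \<rho>2)
      qed
      then show ?thesis
        using plate_below_outer_layer[OF E(2)[OF y(3)] E(2)[OF z(2)]] \<rho>pos[of n] by (auto simp: R_def y z)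
    qed
    ultimately show ?case
      using xs us by (intro exI[of _ "xs @ map (\<lambda>u. (u, \<rho> n)) us"])
        (auto simp: sorted_wrt_append less_Suc_eq)
  qed
  obtain xs where xs: "set xs = {(u, \<rho> j) |u j. j < J * M \<and> u \<in> E (j mod M)}" "sorted_wrt R xs"
    using layers by blast
  show thesis
  proof (rule that[of t xs])
    show "0 < t" by (rule t)
    show "norm u = 1 \<and> a < r" if "(u, r) \<in> set xs" for u r
      using that xs(1) E(2) \<rho>a by auto
    show "sorted_wrt (\<lambda>(u, \<rho>) (u', \<rho>'). \<forall>x\<in>plate u \<rho> t. x \<bullet> u' < \<rho>') xs"
      using xs(2) by (simp add: R_def)
  next
    fix c :: "real \<Rightarrow> 'a" and \<alpha> \<beta> :: real
    assume ab: "\<alpha> \<le> \<beta>" "continuous_on {\<alpha>..\<beta>} c" "norm (c \<alpha>) \<le> a" "b \<le> norm (c \<beta>)"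
      and avoid: "\<And>s u r. \<lbrakk>s \<in> {\<alpha>..\<beta>}; (u, r) \<in> set xs\<rbrakk> \<Longrightarrow> c s \<notin> plate u r t"
    have "variation_ge c \<alpha> \<beta>' (real n * (t / 4))"
      if "n \<le> J" "\<alpha> \<le> \<beta>'" "\<beta>' \<le> \<beta>" "\<rho> (n * M) \<le> norm (c \<beta>')" for n \<beta>'
      using that
    proof (induction n arbitrary: \<beta>')
      case 0
      then show ?case by (intro variation_ge_displacement[of _ \<alpha>]) auto
    next
      case (Suc n)
      have cont: "continuous_on {\<alpha>..\<beta>'} c" by (rule continuous_on_subset[OF ab(2)]) (use Suc.prems in auto)
      have "continuous_on {\<alpha>..\<beta>'} (\<lambda>s. norm (c s))" using cont by (intro continuous_intros)
      moreover have "norm (c \<alpha>) \<le> \<rho> (n * M)" using ab(3) \<rho>a[of "n * M"] by simp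
      moreover have "\<rho> (n * M) \<le> norm (c \<beta>')"
        using Suc.prems(4) \<rho>mono[of "n * M" "Suc n * M"] by simp
      ultimately obtain m where m: "\<alpha> \<le> m" "m \<le> \<beta>'" "norm (c m) = \<rho> (n * M)"
        using IVT'[of "\<lambda>s. norm (c s)" \<alpha> "\<rho> (n * M)" \<beta>'] Suc.prems by auto
      have IH: "variation_ge c \<alpha> m (real n * (t / 4))"
        using Suc.IH[of m] Suc.prems m by simp
      have cm: "norm (c m) > a" using m(3) \<rho>a by simp
      define x where "x = c m /\<^sub>R norm (c m)"
      have x: "norm x = 1" "c m = norm (c m) *\<^sub>R x" 
      proof -
        have "norm (c m) \<noteq> 0" using cm assms by linarith
        then show "norm x = 1" "c m = norm (c m) *\<^sub>R x" by (simp_all add: x_def)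
      qed
      obtain k e where k: "k < M" "e \<in> E k" "dist x e \<le> \<theta>" using E(4)[OF x(1)] by blast
      define j where "j = n * M + k"
      have j: "j mod M = k" "n * M \<le> j" "j < Suc n * M" "j < J * M"
      proof -
        show "j mod M = k" "n * M \<le> j" using k(1) by (auto simp: j_def)
        show "j < Suc n * M" using k(1) by (auto simp: j_def)
        also have "Suc n * M \<le> J * M" using Suc.prems(1) by (rule mult_le_mono1)
        finally show "j < J * M" .
      qed
      have "norm (c m - norm (c m) *\<^sub>R e) = norm (c m) * dist x e"
        by (subst x(2)) (simp add: dist_norm flip: scaleR_diff_right)
      also have "\<dots> \<le> b * \<theta>"
        using k(3) m(3) \<rho>b[of "n * M"] Suc.prems(1) assms \<theta> by (intro mult_mono) auto
      also have "\<dots> = t / 4" using assms by (simp add: \<theta>_def)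
      finally have start: "norm (c m - norm (c m) *\<^sub>R e) \<le> t / 4" .
      have "(\<rho> j)\<^sup>2 + t\<^sup>2 \<le> (\<rho> (Suc n * M))\<^sup>2"
      proof -
        have "real j + 1 \<le> real (Suc n * M)" using j(3) by linarith
        then have "(2 * (real j + 1) + 1) * t\<^sup>2 \<le> (2 * (real (Suc n * M) + 1)) * t\<^sup>2"
          by (intro mult_right_mono) auto
        then show ?thesis by (simp add: \<rho>2 algebra_simps)
      qed
      also have "\<dots> \<le> (norm (c \<beta>'))\<^sup>2"
        using Suc.prems(4) \<rho>pos[of "Suc n * M"] by (intro power_mono) auto
      finally have out: "(\<rho> j)\<^sup>2 + t\<^sup>2 \<le> (norm (c \<beta>'))\<^sup>2" .
      obtain s where s: "m \<le> s" "s \<le> \<beta>'" "t / 4 \<le> norm (c s - c m)"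
      proof (rule displacement_crossing_layers[of m \<beta>' c e t "\<rho> j"])
        show "continuous_on {m..\<beta>'} c" by (rule continuous_on_subset[OF cont]) (use m in auto)
        show "t < 2 * norm (c m)" using cm t assms by linarith
        show "norm (c m) \<le> \<rho> j" using m(3) \<rho>mono[OF j(2)] by simp
        show "c s \<notin> plate e (\<rho> j) t" if "s \<in> {m..\<beta>'}" for s
          using avoid[of s e "\<rho> j"] that m Suc.prems k(2) j xs(1) by auto
      qed (use m start t \<rho>pos E(2)[OF k(2)] out in auto)
      have "variation_ge c m \<beta>' (t / 4)" by (rule variation_ge_displacement[OF s])
      then have "variation_ge c \<alpha> \<beta>' (real n * (t / 4) + t / 4)"
        using variation_ge_add[OF m(1,2) _ _ IH] t by simp
      moreover have "real n * (t / 4) + t / 4 = real (Suc n) * (t / 4)"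
        by (simp add: field_simps)
      ultimately show ?case by (simp only:)
    qed
    from this[of J \<beta>] have "variation_ge c \<alpha> \<beta> (real J * (t / 4))"
      using ab \<rho>b[of "J * M"] by simp
    moreover have "1 \<le> real J * (t / 4)" using J(1) t(1) by (simp add: field_simps)
    ultimately show "variation_ge c \<alpha> \<beta> 1"
      by (rule variation_ge_mono)
  qed
qed


section \<open>Shearing a polynomial curve off the plates\<close>

definition poly_curve :: "complex poly \<Rightarrow> complex poly \<Rightarrow> complex \<Rightarrow> complex \<times> complex"
  where "poly_curve p q z = (poly p z, poly q z)"

text \<open>
  By the last condition every linear coordinate is a non-constant polynomial, hence a
  proper map, on the curve: only a bounded part of the curve lies over a bounded set of values,
  whichever direction is chosen for a shear.
\<close>

definition poly_embedding :: "complex poly \<Rightarrow> complex poly \<Rightarrow> bool"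
  where "poly_embedding p q \<longleftrightarrow> inj (poly_curve p q) \<and>
    (\<forall>z. poly (pderiv p) z \<noteq> 0 \<or> poly (pderiv q) z \<noteq> 0) \<and>
    (\<forall>a b. (a, b) \<noteq> (0, 0) \<longrightarrow> 0 < degree (smult a p + smult b q))"

text \<open>
  The complex linear functional whose real part is the Euclidean inner product with \<open>u\<close>.
\<close>

definition herm :: "complex \<times> complex \<Rightarrow> complex \<times> complex \<Rightarrow> complex"
  where "herm x u = fst x * cnj (fst u) + snd x * cnj (snd u)"

lemma Re_herm: "Re (herm x u) = x \<bullet> u"
  by (simp add: herm_def inner_prod_def inner_complex_def)

lemma norm_herm_le: "norm (herm x u) \<le> norm x * norm u"
proof (cases "herm x u = 0")
  case False
  define c where "c = cnj (herm x u) / norm (herm x u)"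
  have c: "norm c = 1" using False by (simp add: c_def norm_divide)
  have "norm (herm x u) = Re (c * herm x u)"
    using False by (simp add: c_def complex_norm_square[symmetric] power2_eq_square mult.commute)
  also have "c * herm x u = herm (c * fst x, c * snd x) u"
    by (simp add: herm_def algebra_simps)
  also have "Re \<dots> \<le> norm (c * fst x, c * snd x) * norm u"
    unfolding Re_herm by (rule norm_cauchy_schwarz)
  also have "norm (c * fst x, c * snd x) = norm x"
    using c by (cases x) (simp add: norm_prod_def norm_mult)
  finally show ?thesis .
qed simp

lemma continuous_on_poly_curve: "continuous_on S (poly_curve p q)"
  unfolding poly_curve_def[abs_def] by (intro continuous_intros)

lemma bounded_poly_sublevel:
  fixes p :: "complex poly"
  assumes "0 < degree p"
  shows "bounded {z. norm (poly p z) \<le> C}"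
proof -
  have "eventually (\<lambda>z. norm (poly p z) \<ge> \<bar>C\<bar> + 1) at_infinity"
    using filterlim_poly_at_infinity[OF assms] unfolding filterlim_at_infinity[OF order_refl]
    by (metis abs_ge_zero add_nonneg_pos zero_less_one)
  then obtain B where B: "\<And>z. norm z \<ge> B \<Longrightarrow> norm (poly p z) \<ge> \<bar>C\<bar> + 1"
    by (auto simp: eventually_at_infinity)
  have "{z. norm (poly p z) \<le> C} \<subseteq> cball 0 B"
  proof
    fix z assume "z \<in> {z. norm (poly p z) \<le> C}"
    then have "\<not> norm (poly p z) \<ge> \<bar>C\<bar> + 1" by simp
    then have "\<not> B \<le> norm z" using B by blast
    then show "z \<in> cball 0 B" by simp
  qed
  then show ?thesis by (rule bounded_subset[OF bounded_cball])
qed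

lemma compact_poly_curve_sublevel:
  assumes "poly_embedding p q"
  shows "compact {z. norm (poly_curve p q z) \<le> C}"
proof -
  have "0 < degree (smult 1 p + smult 0 q)"
    using assms unfolding poly_embedding_def by (metis fst_conv one_neq_zero)
  then have "bounded {z. norm (poly p z) \<le> C}" by (intro bounded_poly_sublevel) simp
  moreover have "{z. norm (poly_curve p q z) \<le> C} \<subseteq> {z. norm (poly p z) \<le> C}"
    using norm_fst_le[of "poly p z" "poly q z" for z] by (auto simp: poly_curve_def intro: order_trans)
  moreover have "closed {z. norm (poly_curve p q z) \<le> C}"
    by (intro closed_Collect_le continuous_intros continuous_on_poly_curve)
  ultimately show ?thesis by (metis bounded_subset compact_eq_bounded_closed)
qed

lemma poly_curve_separated_from_compact:
  assumes "poly_embedding p q" "compact T" "\<And>z. poly_curve p q z \<notin> T"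
  obtains d where "0 < d" "\<And>x z. x \<in> T \<Longrightarrow> d \<le> dist x (poly_curve p q z)"
proof -
  obtain B where B: "\<And>x. x \<in> T \<Longrightarrow> norm x \<le> B"
    using compact_imp_bounded[OF assms(2)] by (auto simp: bounded_iff)
  define S where "S = poly_curve p q ` {z. norm (poly_curve p q z) \<le> B + 1}"
  have "compact S"
    unfolding S_def by (intro compact_continuous_image continuous_on_poly_curve compact_poly_curve_sublevel assms)
  moreover have "T \<inter> S = {}" using assms(3) by (auto simp: S_def)
  ultimately obtain d where d: "d > 0" "\<And>x y. x \<in> T \<Longrightarrow> y \<in> S \<Longrightarrow> d \<le> dist x y"
    using separate_compact_closed[OF assms(2) compact_imp_closed, of S] by blast
  show thesis
  proof (rule that[of "min d 1"])
    fix x z assume x: "x \<in> T"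
    show "min d 1 \<le> dist x (poly_curve p q z)"
    proof (cases "norm (poly_curve p q z) \<le> B + 1")
      case True
      then have "d \<le> dist x (poly_curve p q z)" using d(2)[OF x] by (auto simp: S_def)
      then show ?thesis by simp
    next
      case False
      then have "1 \<le> dist x (poly_curve p q z)"
        using B[OF x] norm_triangle_ineq2[of "poly_curve p q z" x] by (simp add: dist_norm norm_minus_commute)
      then show ?thesis by simp
    qed
  qed (use d in auto)
qed

lemma compact_plate:
  fixes u :: "'a::euclidean_space"
  shows "compact (plate u \<rho> t)"
proof -
  have "plate u \<rho> t = {x. x \<bullet> u = \<rho>} \<inter> cball (\<rho> *\<^sub>R u) t"
    by (auto simp: plate_def dist_norm norm_minus_commute)
  moreover have "closed {x. x \<bullet> u = \<rho>}" by (intro closed_Collect_eq continuous_intros)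
  ultimately show ?thesis by (simp add: closed_Int_compact)
qed

text \<open>
  Let \<open>\<lambda>\<close> be the functional \<open>\<lambda>x. herm x u\<close> and \<open>v\<close> a unit vector in its kernel. The shear
  \<open>x + g (\<lambda> x) v\<close> preserves \<open>\<lambda>\<close>. Over the bounded set of values of \<open>\<lambda>\<close> on the plate the curve is
  bounded, so a huge value of \<open>|g|\<close> there throws it far beyond the plate. The monomial
  \<open>g l = l ((l + b) / \<beta>) ^ N\<close> is suitable: for large \<open>b\<close> the discs around \<open>- b\<close> are almost half-planes,
  and with \<open>\<beta>\<close> chosen between the two sides the power tends to \<open>0\<close> uniformly on bounded
  sets of \<open>l\<close> with real part at most \<open>\<rho>'\<close>, and to infinity where the real part is at least \<open>\<rho>\<close>. The factor \<open>l\<close> keeps the origin fixed.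
\<close>

lemma shear_off_plate:
  assumes emb: "poly_embedding p q" and u: "norm u = 1" and \<rho>: "0 < \<rho>" "\<rho>' < \<rho>" and "0 < \<eta>" "0 \<le> R"
  obtains p' q' where "poly_embedding p' q'"
    "\<And>z. poly_curve p' q' z \<notin> plate u \<rho> t"
    "\<And>z. herm (poly_curve p' q' z) u = herm (poly_curve p q z) u"
    "\<And>z. \<lbrakk>poly_curve p q z \<bullet> u \<le> \<rho>'; norm (herm (poly_curve p q z) u) \<le> R\<rbrakk>
       \<Longrightarrow> norm (poly_curve p' q' z - poly_curve p q z) < \<eta>"
    "\<And>z. poly_curve p q z = 0 \<Longrightarrow> poly_curve p' q' z = 0"
proof -
  obtain u1 u2 where u12: "u = (u1, u2)" by (cases u)
  have nz: "(cnj u1, cnj u2) \<noteq> (0, 0)" using u by (auto simp: u12)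
  define l where "l = smult (cnj u1) p + smult (cnj u2) q"
  have inj: "inj (poly_curve p q)"
    and imm: "\<And>z. poly (pderiv p) z \<noteq> 0 \<or> poly (pderiv q) z \<noteq> 0"
    and deg: "\<And>a b. (a, b) \<noteq> (0, 0) \<Longrightarrow> 0 < degree (smult a p + smult b q)"
    using emb by (auto simp: poly_embedding_def)
  have degl: "0 < degree l" unfolding l_def by (rule deg[OF nz])
  have herm_l: "herm (poly_curve p q z) u = poly l z" for z
    by (simp add: herm_def poly_curve_def l_def u12 mult.commute)
  obtain M where M: "\<And>z. norm (poly l z) \<le> \<rho> + t \<Longrightarrow> norm (poly_curve p q z) \<le> M"
  proof -
    have "compact (closure {z. norm (poly l z) \<le> \<rho> + t})"
      using bounded_poly_sublevel[OF degl] by simp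
    then have "bounded (poly_curve p q ` closure {z. norm (poly l z) \<le> \<rho> + t})"
      by (intro compact_imp_bounded compact_continuous_image continuous_on_poly_curve)
    then obtain M where M: "\<And>z. z \<in> closure {z. norm (poly l z) \<le> \<rho> + t} \<Longrightarrow> norm (poly_curve p q z) \<le> M"
      by (auto simp: bounded_iff)
    show thesis
      by (rule that[of M], rule M, rule subsetD[OF closure_subset]) simp
  qed
  define b where "b = R\<^sup>2 / (2 * (\<rho> - \<rho>')) + 1"
  have b: "b > 0" using \<rho> by (auto simp: b_def intro!: add_nonneg_pos)
  have "2 * (\<rho> - \<rho>') * b = R\<^sup>2 + 2 * (\<rho> - \<rho>')" using \<rho> by (simp add: b_def distrib_left)
  then have "R\<^sup>2 < 2 * (\<rho> - \<rho>') * b" using \<rho> by simp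
  have key: "R\<^sup>2 + 2 * b * \<rho>' + b\<^sup>2 < (\<rho> + b)\<^sup>2"
  proof -
    have "0 < \<rho>\<^sup>2" using \<rho> by simp
    moreover have "(\<rho> + b)\<^sup>2 = \<rho>\<^sup>2 + 2 * (\<rho> - \<rho>') * b + 2 * b * \<rho>' + b\<^sup>2"
      by (simp add: power2_eq_square algebra_simps)
    ultimately show ?thesis using \<open>R\<^sup>2 < 2 * (\<rho> - \<rho>') * b\<close> by linarith
  qed
  define s where "s = sqrt (max 0 (R\<^sup>2 + 2 * b * \<rho>' + b\<^sup>2))"
  have s: "0 \<le> s" "s < \<rho> + b"
  proof -
    show "0 \<le> s" by (simp add: s_def)
    have "s < sqrt ((\<rho> + b)\<^sup>2)" unfolding s_def real_sqrt_less_iff using key \<rho> b by simp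
    then show "s < \<rho> + b" using \<rho> b by simp
  qed
  define \<beta> where "\<beta> = (s + (\<rho> + b)) / 2"
  have \<beta>: "0 < \<beta>" "s < \<beta>" "\<beta> < \<rho> + b" using s \<rho> b by (auto simp: \<beta>_def)
  have "eventually (\<lambda>N. R * (s / \<beta>) ^ N < \<eta>) sequentially"
    using \<beta> s \<open>0 < \<eta>\<close> by (intro order_tendstoD(2)[OF tendsto_mult_right_zero[OF LIMSEQ_realpow_zero]]) auto
  moreover have "eventually (\<lambda>N. M + \<rho> + t < \<rho> * ((\<rho> + b) / \<beta>) ^ N) sequentially"
  proof -
    have x: "1 < (\<rho> + b) / \<beta>" using \<beta> by simp
    obtain n where n: "(M + \<rho> + t) / \<rho> < ((\<rho> + b) / \<beta>) ^ n" using real_arch_pow[OF x] by blast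
    have "M + \<rho> + t < \<rho> * ((\<rho> + b) / \<beta>) ^ N" if "n \<le> N" for N
    proof -
      have "(M + \<rho> + t) / \<rho> < ((\<rho> + b) / \<beta>) ^ N"
        using n power_increasing[OF that, of "(\<rho> + b) / \<beta>"] x by linarith
      then show ?thesis using \<rho> by (simp add: pos_divide_less_eq mult.commute)
    qed
    then show ?thesis unfolding eventually_sequentially by blast
  qed
\<comment> \<open>The degree of the shear exceeds that of the curve, so no linear coordinate can become constant.\<close>
  moreover have "eventually (\<lambda>N. degree p + degree q + 1 \<le> N) sequentially"
    by (rule eventually_ge_at_top)
  ultimately have "eventually (\<lambda>N. R * (s / \<beta>) ^ N < \<eta> \<and> M + \<rho> + t < \<rho> * ((\<rho> + b) / \<beta>) ^ N
      \<and> degree p + degree q + 1 \<le> N) sequentially"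
    by eventually_elim auto
  then obtain N where N: "R * (s / \<beta>) ^ N < \<eta>" "M + \<rho> + t < \<rho> * ((\<rho> + b) / \<beta>) ^ N" "degree p + degree q + 1 \<le> N"
    using eventually_happens'[OF sequentially_bot] by blast
  define g where "g = l * (smult (of_real (1 / \<beta>)) (l + [:of_real b:])) ^ N"
  have poly_g: "poly g z = poly l z * ((poly l z + of_real b) / of_real \<beta>) ^ N" for z
    by (simp add: g_def field_simps)
  define p' where "p' = p - smult (cnj u2) g"
  define q' where "q' = q + smult (cnj u1) g"
  have l': "smult (cnj u1) p' + smult (cnj u2) q' = l"
    by (simp add: p'_def q'_def l_def smult_add_right smult_diff_right mult.commute)
  have diff: "norm (poly_curve p' q' z - poly_curve p q z) = norm (poly g z)" for z
  proof -
    have "poly_curve p' q' z - poly_curve p q z = (- cnj u2 * poly g z, cnj u1 * poly g z)"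
      by (simp add: poly_curve_def p'_def q'_def)
    then have "(norm (poly_curve p' q' z - poly_curve p q z))\<^sup>2 = (norm (poly g z))\<^sup>2 * (norm u)\<^sup>2"
      by (simp add: norm_prod_def u12 norm_mult power_mult_distrib algebra_simps)
    then show ?thesis using u by simp
  qed
  have herm': "herm (poly_curve p' q' z) u = poly l z" for z
    by (simp add: herm_def poly_curve_def u12 mult.commute flip: l')
  show thesis
  proof (rule that[of p' q'])
    show "poly_embedding p' q'"
      unfolding poly_embedding_def
    proof (intro conjI allI impI injI)
      fix x y assume eq: "poly_curve p' q' x = poly_curve p' q' y"
      then have "poly l x = poly l y" using herm' by metis
      then have "poly g x = poly g y" by (simp add: poly_g)
      then have "poly_curve p q x = poly_curve p q y" using eq by (simp add: poly_curve_def p'_def q'_def)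
      then show "x = y" using inj by (simp add: inj_eq)
    next
      fix z show "poly (pderiv p') z \<noteq> 0 \<or> poly (pderiv q') z \<noteq> 0"
      proof (rule ccontr)
        assume "\<not> (poly (pderiv p') z \<noteq> 0 \<or> poly (pderiv q') z \<noteq> 0)"
        then have 0: "poly (pderiv p') z = 0" "poly (pderiv q') z = 0" by auto
        have dl: "poly (pderiv l) z = 0"
          by (simp add: pderiv_add pderiv_smult 0 flip: l')
        have "poly (pderiv g) z = 0"
          by (simp add: g_def pderiv_mult pderiv_power pderiv_add pderiv_smult pderiv_pCons dl)
        then show False using imm[of z] 0 by (simp add: p'_def q'_def pderiv_add pderiv_smult pderiv_diff)
      qed
    next
      fix a b' :: complex assume ab: "(a, b') \<noteq> (0, 0)"
      define w where "w = b' * cnj u1 - a * cnj u2"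
      have eq: "smult a p' + smult b' q' = (smult a p + smult b' q) + smult w g"
        by (simp add: p'_def q'_def w_def smult_add_right smult_diff_right smult_diff_left algebra_simps)
      show "0 < degree (smult a p' + smult b' q')"
      proof (cases "w = 0")
        case True
        then show ?thesis using deg[OF ab] by (simp add: eq)
      next
        case False
        have "l + [:of_real b:] \<noteq> 0" "l \<noteq> 0"
          using degl degree_add_eq_left[of "[:of_real b:]" l] by auto
        then have "degree g = degree l + N * degree (l + [:of_real b:])"
          using \<beta>(1) by (simp add: g_def degree_mult_eq degree_power_eq)
        also have "degree (l + [:of_real b:]) = degree l"
          using degl by (intro degree_add_eq_left) simp
        finally have "degree g \<ge> N" using degl by (simp add: trans_le_add2)
        then have "degree (smult w g) > degree p + degree q" using N(3) False by simp
        moreover have "degree (smult a p + smult b' q) \<le> degree p + degree q"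
          by (intro degree_add_le) (auto intro: order_trans[OF degree_smult_le])
        ultimately show ?thesis
          unfolding eq by (subst degree_add_eq_right) auto
      qed
    qed
  next
    fix z
    show "herm (poly_curve p' q' z) u = herm (poly_curve p q z) u" by (simp add: herm' herm_l)
    show "poly_curve p' q' z \<notin> plate u \<rho> t"
    proof
      assume "poly_curve p' q' z \<in> plate u \<rho> t"
      then have P: "poly_curve p' q' z \<bullet> u = \<rho>" "norm (poly_curve p' q' z - \<rho> *\<^sub>R u) \<le> t"
        by (auto simp: plate_def)
      have n: "norm (poly_curve p' q' z) \<le> \<rho> + t"
        using P(2) norm_triangle_sub[of "poly_curve p' q' z" "\<rho> *\<^sub>R u"] u \<rho> by simp
      then have "norm (poly l z) \<le> \<rho> + t"
        using norm_herm_le[of "poly_curve p' q' z" u] u by (simp add: herm')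
      then have "norm (poly_curve p q z) \<le> M" by (rule M)
      then have "norm (poly g z) \<le> M + \<rho> + t"
        using n norm_triangle_ineq4[of "poly_curve p' q' z" "poly_curve p q z"] by (simp add: diff)
      moreover have "\<rho> * ((\<rho> + b) / \<beta>) ^ N \<le> norm (poly g z)"
      proof -
        have Re: "Re (poly l z) = \<rho>" using P(1) by (simp flip: herm' add: Re_herm)
        have "\<rho> \<le> norm (poly l z)" using complex_Re_le_cmod[of "poly l z"] Re by simp
        moreover have "\<rho> + b \<le> norm (poly l z + of_real b)"
          using complex_Re_le_cmod[of "poly l z + of_real b"] Re by simp
        ultimately show ?thesis
          using \<beta>(1) \<rho> b by (auto simp: poly_g norm_mult norm_power norm_divide
              intro!: mult_mono power_mono divide_right_mono)
      qed
      ultimately show False using N(2) by simp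
    qed
    show "norm (poly_curve p' q' z - poly_curve p q z) < \<eta>"
      if H: "poly_curve p q z \<bullet> u \<le> \<rho>'" "norm (herm (poly_curve p q z) u) \<le> R"
    proof -
      have lR: "norm (poly l z) \<le> R" "Re (poly l z) \<le> \<rho>'" using H by (simp_all flip: herm_l add: Re_herm)
      have "(norm (poly l z + of_real b))\<^sup>2 = (norm (poly l z))\<^sup>2 + 2 * b * Re (poly l z) + b\<^sup>2"
        unfolding cmod_power2 by (simp add: power2_eq_square algebra_simps)
      also have "\<dots> \<le> R\<^sup>2 + 2 * b * \<rho>' + b\<^sup>2"
        using lR b by (intro add_mono power_mono mult_left_mono) auto
      also have "\<dots> \<le> s\<^sup>2" by (simp add: s_def)
      finally have "norm (poly l z + of_real b) \<le> s" using s(1) by (rule power2_le_imp_le)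
      then have "norm (poly g z) \<le> R * (s / \<beta>) ^ N"
        using lR(1) \<beta>(1) \<open>0 \<le> R\<close> by (auto simp: poly_g norm_mult norm_power norm_divide
              intro!: mult_mono power_mono divide_right_mono)
      then show ?thesis using N(1) by (simp add: diff)
    qed
    show "poly_curve p' q' z = 0" if "poly_curve p q z = 0"
    proof -
      have "poly l z = 0" using that by (simp flip: herm_l add: herm_def)
      then have "norm (poly_curve p' q' z - poly_curve p q z) = 0" by (simp only: diff) (simp add: poly_g)
      then show ?thesis using that by simp
    qed
  qed
qed

text \<open>
  The plates are treated in their order. The curve misses the earlier plates by a
  positive distance \<open>d\<close>. Since the next shear preserves the functional of its plate, a point that it moved
  onto an earlier plate would have come from the half-space on which it moves points by less than \<open>d\<close>.
\<close>

lemma shear_off_plates: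
  assumes "sorted_wrt (\<lambda>(u, \<rho>) (u', \<rho>'). \<forall>x\<in>plate u \<rho> t. x \<bullet> u' < \<rho>') xs"
    and "\<And>u \<rho>. (u, \<rho>) \<in> set xs \<Longrightarrow> norm u = 1 \<and> a < \<rho>" and "0 < a"
    and "poly_embedding p q" "0 < \<eta>"
  shows "\<exists>p' q'. poly_embedding p' q' \<and>
    (\<forall>z. poly_curve p q z = 0 \<longrightarrow> poly_curve p' q' z = 0) \<and>
    (\<forall>z. norm (poly_curve p q z) \<le> a \<longrightarrow> norm (poly_curve p' q' z - poly_curve p q z) < \<eta>) \<and>
    (\<forall>z. \<forall>(u, \<rho>)\<in>set xs. poly_curve p' q' z \<notin> plate u \<rho> t)"
  using assms
proof (induction xs arbitrary: \<eta> rule: rev_induct)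
  case Nil
  then show ?case by (intro exI[of _ p] exI[of _ q]) auto
next
  case (snoc y xs)
  obtain u \<rho> where y: "y = (u, \<rho>)" by (cases y)
  have u: "norm u = 1" "a < \<rho>" using snoc.prems(2)[of u \<rho>] by (auto simp: y)
  define T where "T = (\<Union>(u, \<rho>)\<in>set xs. plate u \<rho> t)"
  have cT: "compact T" unfolding T_def by (intro compact_UN) (auto simp: compact_plate)
  have Tu: "x \<bullet> u < \<rho>" if "x \<in> T" for x
    using snoc.prems(1) that by (fastforce simp: T_def y sorted_wrt_append)
  define \<eta>1 where "\<eta>1 = min (\<eta> / 2) ((\<rho> - a) / 2)"
  have \<eta>1: "0 < \<eta>1" "\<eta>1 \<le> \<eta> / 2" "a + \<eta>1 < \<rho>" using snoc.prems(5) u(2) by (auto simp: \<eta>1_def min_def field_simps)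
  have "sorted_wrt (\<lambda>(u, \<rho>) (u', \<rho>'). \<forall>x\<in>plate u \<rho> t. x \<bullet> u' < \<rho>') xs"
    using snoc.prems(1) by (simp add: sorted_wrt_append)
  moreover have "\<And>u \<rho>. (u, \<rho>) \<in> set xs \<Longrightarrow> norm u = 1 \<and> a < \<rho>"
    by (rule snoc.prems(2)) simp
  ultimately have "\<exists>p' q'. poly_embedding p' q' \<and>
    (\<forall>z. poly_curve p q z = 0 \<longrightarrow> poly_curve p' q' z = 0) \<and>
    (\<forall>z. norm (poly_curve p q z) \<le> a \<longrightarrow> norm (poly_curve p' q' z - poly_curve p q z) < \<eta>1) \<and>
    (\<forall>z. \<forall>(u, \<rho>)\<in>set xs. poly_curve p' q' z \<notin> plate u \<rho> t)"
    using snoc.prems(3,4) \<eta>1(1) by (rule snoc.IH)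
  then obtain p1 q1 where 1: "poly_embedding p1 q1" "\<And>z. poly_curve p q z = 0 \<Longrightarrow> poly_curve p1 q1 z = 0"
    "\<And>z. norm (poly_curve p q z) \<le> a \<Longrightarrow> norm (poly_curve p1 q1 z - poly_curve p q z) < \<eta>1"
    "\<And>z. \<forall>(u, \<rho>)\<in>set xs. poly_curve p1 q1 z \<notin> plate u \<rho> t"
    by blast
  have T1: "poly_curve p1 q1 z \<notin> T" for z using 1(4)[of z] by (auto simp: T_def)
  obtain d where d: "0 < d" "\<And>x z. x \<in> T \<Longrightarrow> d \<le> dist x (poly_curve p1 q1 z)"
    by (rule poly_curve_separated_from_compact[OF 1(1) cT T1]) blast
  obtain B where B: "\<And>x. x \<in> T \<Longrightarrow> norm x \<le> B" using compact_imp_bounded[OF cT] by (auto simp: bounded_iff)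
  obtain r where r: "r < \<rho>" "a + \<eta>1 \<le> r" "\<And>x. x \<in> T \<Longrightarrow> x \<bullet> u \<le> r"
  proof (cases "T = {}")
    case True
    then show thesis using that[of "a + \<eta>1"] \<eta>1 by auto
  next
    case False
    have "continuous_on T (\<lambda>x. x \<bullet> u)" by (intro continuous_intros)
    then obtain x0 where "x0 \<in> T" "\<And>x. x \<in> T \<Longrightarrow> x \<bullet> u \<le> x0 \<bullet> u"
      using continuous_attains_sup[OF cT False] by blast
    then show thesis using that[of "max (a + \<eta>1) (x0 \<bullet> u)"] \<eta>1 Tu by (auto intro: max.coboundedI2)
  qed
  define R where "R = max (a + \<eta>1) B"
  have R: "0 \<le> R" using snoc.prems(3) \<eta>1(1) by (simp add: R_def)
  have "0 < \<rho>" "0 < min d (\<eta> / 2)" using u(2) snoc.prems d by auto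
  then obtain p2 q2 where 2: "poly_embedding p2 q2"
    "\<And>z. poly_curve p2 q2 z \<notin> plate u \<rho> t"
    "\<And>z. herm (poly_curve p2 q2 z) u = herm (poly_curve p1 q1 z) u"
    "\<And>z. \<lbrakk>poly_curve p1 q1 z \<bullet> u \<le> r; norm (herm (poly_curve p1 q1 z) u) \<le> R\<rbrakk>
       \<Longrightarrow> norm (poly_curve p2 q2 z - poly_curve p1 q1 z) < min d (\<eta> / 2)"
    "\<And>z. poly_curve p1 q1 z = 0 \<Longrightarrow> poly_curve p2 q2 z = 0"
    using shear_off_plate[OF 1(1) u(1) _ r(1) _ R, of "min d (\<eta> / 2)" t] by blast
  show ?case
  proof (rule exI[of _ p2], rule exI[of _ q2], intro conjI allI impI ballI)
    show "poly_embedding p2 q2" by (rule 2)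
    fix z
    show "poly_curve p2 q2 z = 0" if "poly_curve p q z = 0" using 1(2) 2(5) that by blast
    show "norm (poly_curve p2 q2 z - poly_curve p q z) < \<eta>" if a: "norm (poly_curve p q z) \<le> a"
    proof -
      have n: "norm (poly_curve p1 q1 z) \<le> a + \<eta>1"
        using 1(3)[OF a] a norm_triangle_sub[of "poly_curve p1 q1 z" "poly_curve p q z"] by simp
      have "poly_curve p1 q1 z \<bullet> u \<le> r"
        using norm_cauchy_schwarz[of "poly_curve p1 q1 z" u] n u r(2) by simp
      moreover have "norm (herm (poly_curve p1 q1 z) u) \<le> R"
      proof -
        have "norm (herm (poly_curve p1 q1 z) u) \<le> norm (poly_curve p1 q1 z)"
          using norm_herm_le[of "poly_curve p1 q1 z" u] u by simp
        also have "\<dots> \<le> R" unfolding R_def using order_trans[OF n max.cobounded1[of _ B]] by simp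
        finally show ?thesis .
      qed
      ultimately have "norm (poly_curve p2 q2 z - poly_curve p1 q1 z) < \<eta> / 2" using 2(4)[of z] by simp
      then show ?thesis
        using 1(3)[OF a] \<eta>1(2)
          norm_triangle_ineq[of "poly_curve p2 q2 z - poly_curve p1 q1 z" "poly_curve p1 q1 z - poly_curve p q z"]
        by simp
    qed
    fix w assume w: "w \<in> set (xs @ [y])"
    have "poly_curve p2 q2 z \<notin> T"
    proof
      assume T: "poly_curve p2 q2 z \<in> T"
      have "poly_curve p1 q1 z \<bullet> u \<le> r"
        using r(3)[OF T] 2(3)[of z] by (metis Re_herm)
      moreover have "norm (herm (poly_curve p1 q1 z) u) \<le> R"
      proof -
        have "norm (herm (poly_curve p1 q1 z) u) \<le> norm (poly_curve p2 q2 z)"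
          using norm_herm_le[of "poly_curve p2 q2 z" u] u by (simp add: 2(3))
        also have "\<dots> \<le> B" using B[OF T] by simp
        also have "\<dots> \<le> R" by (simp add: R_def)
        finally show ?thesis .
      qed
      ultimately have "norm (poly_curve p2 q2 z - poly_curve p1 q1 z) < d" using 2(4)[of z] by simp
      then show False using d(2)[OF T, of z] by (simp add: dist_norm)
    qed
    then show "case w of (u, \<rho>) \<Rightarrow> poly_curve p2 q2 z \<notin> plate u \<rho> t"
      using w 2(2)[of z] by (auto simp: T_def y)
  qed
qed


section \<open>Stability of holomorphic embeddings\<close>

lemma C1_on_Pair:
  fixes f :: "'a::euclidean_space \<Rightarrow> 'b::euclidean_space" and g :: "'a \<Rightarrow> 'c::euclidean_space"
  assumes "C1_on f U" "C1_on g U"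
  shows "C1_on (\<lambda>x. (f x, g x)) U"
proof -
  obtain f' where f': "\<And>x. x \<in> U \<Longrightarrow> (f has_derivative blinfun_apply (f' x)) (at x)" "continuous_on U f'"
    using assms(1) by (auto simp: C1_on_def)
  obtain g' where g': "\<And>x. x \<in> U \<Longrightarrow> (g has_derivative blinfun_apply (g' x)) (at x)" "continuous_on U g'"
    using assms(2) by (auto simp: C1_on_def)
  define i1 :: "'b \<Rightarrow>\<^sub>L ('b \<times> 'c)" where "i1 = Blinfun (\<lambda>w. (w, 0))"
  define i2 :: "'c \<Rightarrow>\<^sub>L ('b \<times> 'c)" where "i2 = Blinfun (\<lambda>w. (0, w))"
  have i: "blinfun_apply i1 v = (v, 0)" "blinfun_apply i2 w = (0, w)" for v w
    unfolding i1_def i2_def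
    by (subst bounded_linear_Blinfun_apply; intro bounded_linear_Pair bounded_linear_ident bounded_linear_zero refl)+
  define F where "F = (\<lambda>x. (i1 o\<^sub>L f' x) + (i2 o\<^sub>L g' x))"
  have F: "blinfun_apply (F x) = (\<lambda>v. (blinfun_apply (f' x) v, blinfun_apply (g' x) v))" for x
    by (auto simp: F_def blinfun.add_left i fun_eq_iff)
  show ?thesis
    unfolding C1_on_def
  proof (intro exI[of _ F] conjI ballI)
    show "((\<lambda>x. (f x, g x)) has_derivative blinfun_apply (F x)) (at x)" if "x \<in> U" for x
      unfolding F using f'(1)[OF that] g'(1)[OF that] by (rule has_derivative_Pair)
    show "continuous_on U F"
      unfolding F_def using f'(2) g'(2) by (intro continuous_intros
        bounded_linear.continuous_on[OF bounded_bilinear.bounded_linear_right[OF bounded_bilinear_blinfun_compose]])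
  qed
qed

lemma holomorphic_on_imp_C1_on:
  assumes "open U" "f holomorphic_on U"
  shows "C1_on f U"
  unfolding C1_on_def
proof (intro exI[of _ "\<lambda>z. blinfun_mult_right (deriv f z)"] conjI ballI)
  show "(f has_derivative blinfun_apply (blinfun_mult_right (deriv f z))) (at z)" if "z \<in> U" for z
    using holomorphic_derivI[OF assms(2,1) that] by (simp add: has_field_derivative_def)
  show "continuous_on U (\<lambda>z. blinfun_mult_right (deriv f z))"
    using assms by (intro bounded_linear.continuous_on[OF bounded_linear_blinfun_mult_right]
        holomorphic_on_imp_continuous_on holomorphic_deriv)
qed

lemma holomorphic_map_on_imp_C1_on:
  assumes "open U" "holomorphic_map_on f U"
  shows "C1_on f U"
  using C1_on_Pair[OF holomorphic_on_imp_C1_on holomorphic_on_imp_C1_on, OF assms(1) _ assms(1)] assms(2)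
  by (fastforce simp: holomorphic_map_on_def)

text \<open>
  Near \<open>a\<close> the map differs from its differential at \<open>a\<close>, which is bounded below, by a map with
  small Lipschitz constant.
\<close>

lemma C1_immersion_locally_expanding:
  fixes f :: "'a::euclidean_space \<Rightarrow> 'b::euclidean_space"
  assumes "C1_on f U" "open U" "a \<in> U" "inj (frechet_derivative f (at a))"
  obtains c \<delta> where "0 < c" "0 < \<delta>" "ball a \<delta> \<subseteq> U"
    "\<And>x y. \<lbrakk>x \<in> ball a \<delta>; y \<in> ball a \<delta>\<rbrakk> \<Longrightarrow> c * norm (x - y) \<le> norm (f x - f y)"
proof -
  obtain f' where f': "\<And>x. x \<in> U \<Longrightarrow> (f has_derivative blinfun_apply (f' x)) (at x)"
    and cont: "continuous_on U f'"
    using assms(1) by (auto simp: C1_on_def)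
  have "frechet_derivative f (at a) = blinfun_apply (f' a)"
    using frechet_derivative_at[OF f'[OF assms(3)]] by simp
  then have "inj (blinfun_apply (f' a))" using assms(4) by simp
  then obtain m where m: "m > 0" "\<And>v. m * norm v \<le> norm (blinfun_apply (f' a) v)"
    using linear_inj_bounded_below_pos[of "blinfun_apply (f' a)"] blinfun.bounded_linear_right bounded_linear.linear by blast
  have "isCont f' a" using cont assms(2,3) continuous_on_eq_continuous_at by blast
  then obtain d where d: "d > 0" "\<And>x. dist x a < d \<Longrightarrow> dist (f' x) (f' a) < m / 2"
    using m(1) unfolding continuous_at_eps_delta by (meson half_gt_zero)
  obtain e where e: "e > 0" "ball a e \<subseteq> U" using assms(2,3) openE by blast
  define \<delta> where "\<delta> = min d e"
  have sub: "ball a \<delta> \<subseteq> U" using e(2) by (auto simp: \<delta>_def)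
  show thesis
  proof (rule that[of "m / 2" \<delta>])
    fix x y assume xy: "x \<in> ball a \<delta>" "y \<in> ball a \<delta>"
    define g where "g = (\<lambda>z. f z - blinfun_apply (f' a) z)"
    have "norm (g x - g y) \<le> m / 2 * norm (x - y)"
    proof (rule differentiable_bound[of "ball a \<delta>" g "\<lambda>z. blinfun_apply (f' z - f' a)"])
      fix z assume z: "z \<in> ball a \<delta>"
      have "(f has_derivative blinfun_apply (f' z)) (at z within ball a \<delta>)"
        using f' sub z by (blast intro: has_derivative_at_withinI)
      then show "(g has_derivative blinfun_apply (f' z - f' a)) (at z within ball a \<delta>)"
        unfolding g_def blinfun.diff_left
        by (intro has_derivative_diff bounded_linear_imp_has_derivative blinfun.bounded_linear_right)
      have "norm (f' z - f' a) \<le> m / 2"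
        using d(2)[of z] z by (simp add: \<delta>_def dist_norm norm_minus_commute)
      then show "onorm (blinfun_apply (f' z - f' a)) \<le> m / 2"
        by (simp add: norm_blinfun.rep_eq)
    qed (use xy in auto)
    moreover have "f x - f y = (g x - g y) + blinfun_apply (f' a) (x - y)"
      by (simp add: g_def blinfun.diff_right)
    ultimately show "m / 2 * norm (x - y) \<le> norm (f x - f y)"
      using m(2)[of "x - y"] norm_triangle_ineq4[of "f x - f y" "g x - g y"] by simp
  qed (use m d e sub in \<open>auto simp: \<delta>_def\<close>)
qed

lemma expanding_imp_inj_derivative:
  fixes f :: "'a::euclidean_space \<Rightarrow> 'b::euclidean_space"
  assumes "f differentiable at a" "0 < c" "0 < \<delta>"
    and "\<And>x. norm (x - a) < \<delta> \<Longrightarrow> c * norm (x - a) \<le> norm (f x - f a)"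
  shows "inj (frechet_derivative f (at a))"
proof -
  let ?L = "frechet_derivative f (at a)"
  have D: "(f has_derivative ?L) (at a)" using assms(1) frechet_derivative_works by blast
  have lin: "linear ?L" by (rule linear_frechet_derivative[OF assms(1)])
  have "v = 0" if v: "?L v = 0" for v
  proof (rule ccontr)
    assume "v \<noteq> 0"
    obtain d where d: "d > 0" "\<And>y. norm (y - a) < d \<Longrightarrow> norm (f y - f a - ?L (y - a)) \<le> c / 2 * norm (y - a)"
      using D assms(2) unfolding has_derivative_at_alt by (meson half_gt_zero)
    define t where "t = min d \<delta> / (2 * norm v)"
    have t: "0 < t" "t * norm v < d" "t * norm v < \<delta>"
      using d(1) assms(3) \<open>v \<noteq> 0\<close> by (auto simp: t_def min_def field_simps)
    have n: "norm ((a + t *\<^sub>R v) - a) = t * norm v" using t(1) by simp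
    have "c * (t * norm v) \<le> norm (f (a + t *\<^sub>R v) - f a)"
      using assms(4)[of "a + t *\<^sub>R v"] t n by simp
    also have "\<dots> \<le> c / 2 * (t * norm v)"
      using d(2)[of "a + t *\<^sub>R v"] t n v lin by (simp add: linear_scale)
    finally show False using assms(2) t(1) \<open>v \<noteq> 0\<close> by simp
  qed
  then show ?thesis using lin linear_injective_0 by blast
qed

text \<open>
  If the claim failed, there would be pairs of points approaching \<open>K\<close> on which the map contracts
  more and more. The limits of such pairs have equal images, so they coincide by
  injectivity; but near this common limit the map is expanding.
\<close>

lemma C1_embedding_expanding_near_compact:
  fixes f :: "'a::euclidean_space \<Rightarrow> 'b::euclidean_space"
  assumes "C1_on f U" "open U" "compact K" "K \<subseteq> U" "inj_on f K" "immersion_on f K"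
  obtains c r where "0 < c" "0 < r" "\<And>a. a \<in> K \<Longrightarrow> cball a r \<subseteq> U"
    "\<And>a b x y. \<lbrakk>a \<in> K; b \<in> K; dist x a \<le> r; dist y b \<le> r\<rbrakk> \<Longrightarrow> c * norm (x - y) \<le> norm (f x - f y)"
proof (cases "K = {}")
  case True
  then show thesis using that[of 1 1] by auto
next
  case False
  obtain R where R: "R > 0" "(\<Union>a\<in>K. ball a R) \<subseteq> U"
    using compact_subset_open_imp_ball_epsilon_subset[OF assms(3,2,4)] by blast
  have "\<exists>n::nat. \<forall>a\<in>K. \<forall>b\<in>K. \<forall>x y. dist x a \<le> R / (real n + 2) \<longrightarrow> dist y b \<le> R / (real n + 2)
      \<longrightarrow> 1 / (real n + 2) * norm (x - y) \<le> norm (f x - f y)"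
  proof (rule ccontr)
    assume neg: "\<not> ?thesis"
    define P where "P = (\<lambda>(n::nat) (a, b, x, y). a \<in> K \<and> b \<in> K \<and> dist x a \<le> R / (real n + 2) \<and>
        dist y b \<le> R / (real n + 2) \<and> norm (f x - f y) < 1 / (real n + 2) * norm (x - y))"
    have "\<forall>n. \<exists>w. P n w"
    proof
      fix n
      have "\<exists>a b x y. P n (a, b, x, y)" using neg by (simp add: P_def not_le) blast
      then show "\<exists>w. P n w" by blast
    qed
    from choice[OF this] obtain w where w: "\<And>n. P n (w n)" by blast
    define a where "a = (\<lambda>n. fst (w n))"
    define b where "b = (\<lambda>n. fst (snd (w n)))"
    define x where "x = (\<lambda>n. fst (snd (snd (w n))))"
    define y where "y = (\<lambda>n. snd (snd (snd (w n))))"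
    have Pn: "P n (a n, b n, x n, y n)" for n using w[of n] by (simp add: a_def b_def x_def y_def)
    have K: "a n \<in> K" "b n \<in> K" and xa: "dist (x n) (a n) \<le> R / (real n + 2)"
      and yb: "dist (y n) (b n) \<le> R / (real n + 2)"
      and less: "norm (f (x n) - f (y n)) < 1 / (real n + 2) * norm (x n - y n)" for n
      using Pn[of n] by (simp_all add: P_def)
    obtain l s where l: "l \<in> K" "strict_mono s" "(a \<circ> s) \<longlonglongrightarrow> l"
      using seq_compactE[OF compact_imp_seq_compact[OF assms(3)], of a] K(1) by blast
    obtain l' s' where l': "l' \<in> K" "strict_mono s'" "((b \<circ> s) \<circ> s') \<longlonglongrightarrow> l'"
      using seq_compactE[OF compact_imp_seq_compact[OF assms(3)], of "b \<circ> s"] K(2) by auto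
    define q where "q = s \<circ> s'"
    have q: "strict_mono q" using l(2) l'(2) by (simp add: q_def strict_mono_o)
    have aq: "(\<lambda>n. a (q n)) \<longlonglongrightarrow> l"
      using LIMSEQ_subseq_LIMSEQ[OF l(3) l'(2)] by (simp add: q_def o_def)
    have bq: "(\<lambda>n. b (q n)) \<longlonglongrightarrow> l'" using l'(3) by (simp add: q_def o_def)
    have "(\<lambda>n::nat. R / (real n + 2)) \<longlonglongrightarrow> 0" by real_asymp
    then have z: "(\<lambda>n. R / (real (q n) + 2)) \<longlonglongrightarrow> 0"
      using LIMSEQ_subseq_LIMSEQ[OF _ q, of "\<lambda>n. R / (real n + 2)" 0] by (simp add: o_def)
    have xq: "(\<lambda>n. x (q n)) \<longlonglongrightarrow> l"
    proof -
      have "(\<lambda>n. x (q n) - a (q n)) \<longlonglongrightarrow> 0"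
        by (rule Lim_null_comparison[OF _ z]) (use xa in \<open>auto simp: dist_norm\<close>)
      from tendsto_add[OF this aq] show ?thesis by simp
    qed
    have yq: "(\<lambda>n. y (q n)) \<longlonglongrightarrow> l'"
    proof -
      have "(\<lambda>n. y (q n) - b (q n)) \<longlonglongrightarrow> 0"
        by (rule Lim_null_comparison[OF _ z]) (use yb in \<open>auto simp: dist_norm\<close>)
      from tendsto_add[OF this bq] show ?thesis by simp
    qed
    have cf: "isCont f l" "isCont f l'"
      using C1_on_imp_continuous_on[OF assms(1)] assms(2,4) l(1) l'(1)
      by (auto simp: continuous_on_eq_continuous_at)
    have "(\<lambda>n. f (x (q n)) - f (y (q n))) \<longlonglongrightarrow> f l - f l'"
      by (intro tendsto_diff isCont_tendsto_compose[OF cf(1) xq] isCont_tendsto_compose[OF cf(2) yq])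
    moreover have "(\<lambda>n. f (x (q n)) - f (y (q n))) \<longlonglongrightarrow> 0"
    proof (rule Lim_null_comparison)
      show "eventually (\<lambda>n. norm (f (x (q n)) - f (y (q n))) \<le> 1 / (real (q n) + 2) * norm (x (q n) - y (q n))) sequentially"
        by (intro always_eventually allI less_imp_le less)
      have "(\<lambda>n::nat. 1 / (real n + 2)) \<longlonglongrightarrow> 0" by real_asymp
      then have "(\<lambda>n. 1 / (real (q n) + 2)) \<longlonglongrightarrow> 0"
        using LIMSEQ_subseq_LIMSEQ[OF _ q, of "\<lambda>n. 1 / (real n + 2)" 0] by (simp add: o_def)
      then have "(\<lambda>n. 1 / (real (q n) + 2) * norm (x (q n) - y (q n))) \<longlonglongrightarrow> 0 * norm (l - l')"
        by (intro tendsto_intros xq yq)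
      then show "(\<lambda>n. 1 / (real (q n) + 2) * norm (x (q n) - y (q n))) \<longlonglongrightarrow> 0" by simp
    qed
    ultimately have "f l - f l' = 0" by (rule LIMSEQ_unique)
    then have ll: "l' = l" using assms(5) l(1) l'(1) by (auto dest: inj_onD)
    have "inj (frechet_derivative f (at l))" using assms(6) l(1) by (auto simp: immersion_on_def)
    then obtain c \<delta> where c: "0 < c" "0 < \<delta>"
      "\<And>x y. \<lbrakk>x \<in> ball l \<delta>; y \<in> ball l \<delta>\<rbrakk> \<Longrightarrow> c * norm (x - y) \<le> norm (f x - f y)"
      by (rule C1_immersion_locally_expanding[OF assms(1,2) subsetD[OF assms(4) l(1)]]) blast
    have "eventually (\<lambda>n. dist (x (q n)) l < \<delta>) sequentially" "eventually (\<lambda>n. dist (y (q n)) l < \<delta>) sequentially"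
      using tendstoD[OF xq c(2)] tendstoD[OF yq[unfolded ll] c(2)] by auto
    moreover have "eventually (\<lambda>n. 1 / (real (q n) + 2) < c) sequentially"
    proof -
      have "(\<lambda>n::nat. 1 / (real n + 2)) \<longlonglongrightarrow> 0" by real_asymp
      then have "(\<lambda>n. 1 / (real (q n) + 2)) \<longlonglongrightarrow> 0"
        using LIMSEQ_subseq_LIMSEQ[OF _ q, of "\<lambda>n. 1 / (real n + 2)" 0] by (simp add: o_def)
      then show ?thesis using c(1) by (rule order_tendstoD)
    qed
    ultimately have "eventually (\<lambda>n. False) sequentially"
    proof eventually_elim
      case (elim n)
      have "c * norm (x (q n) - y (q n)) \<le> norm (f (x (q n)) - f (y (q n)))"
        using c(3) elim by (simp add: dist_commute)
      also have "\<dots> < 1 / (real (q n) + 2) * norm (x (q n) - y (q n))" using less[of "q n"] by simp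
      also have "\<dots> \<le> c * norm (x (q n) - y (q n))" using elim by (intro mult_right_mono) auto
      finally show False by simp
    qed
    then show False by simp
  qed
  then obtain n :: nat where n: "\<And>a b x y. \<lbrakk>a \<in> K; b \<in> K; dist x a \<le> R / (real n + 2); dist y b \<le> R / (real n + 2)\<rbrakk>
      \<Longrightarrow> 1 / (real n + 2) * norm (x - y) \<le> norm (f x - f y)"
    by blast
  show thesis
  proof (rule that[of "1 / (real n + 2)" "R / (real n + 2)"])
    fix a assume "a \<in> K"
    moreover have "R / (real n + 2) < R" using R(1) by (simp add: pos_divide_less_eq add_pos_nonneg)
    ultimately show "cball a (R / (real n + 2)) \<subseteq> U" using R(2) by (force simp: subset_iff)
  qed (use R n in auto)
qed

text \<open>
  By the Cauchy estimates a uniformly small holomorphic perturbation has a small Lipschitz constant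
  on small discs, and for points further apart its size matters only; in both cases
  it cannot compensate the expansion of \<open>F\<close>.
\<close>

lemma holomorphic_embedding_stable:
  assumes F: "holomorphic_map_on F U" "open U" and K: "compact K" "K \<subseteq> U" "inj_on F K" "immersion_on F K"
  obtains \<sigma> where "0 < \<sigma>"
    "\<And>H. \<lbrakk>holomorphic_map_on H U; \<And>z. z \<in> U \<Longrightarrow> norm (H z - F z) \<le> \<sigma>\<rbrakk> \<Longrightarrow> inj_on H K \<and> immersion_on H K"
proof -
  obtain c r where c: "0 < c" "0 < r" "\<And>a. a \<in> K \<Longrightarrow> cball a r \<subseteq> U"
    "\<And>a b x y. \<lbrakk>a \<in> K; b \<in> K; dist x a \<le> r; dist y b \<le> r\<rbrakk> \<Longrightarrow> c * norm (x - y) \<le> norm (F x - F y)"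
    by (rule C1_embedding_expanding_near_compact[OF holomorphic_map_on_imp_C1_on[OF F(2,1)] F(2) K]) blast
  define \<sigma> where "\<sigma> = c * r / 8"
  show thesis
  proof (rule that[of \<sigma>])
    show "0 < \<sigma>" using c by (simp add: \<sigma>_def)
    fix H assume H: "holomorphic_map_on H U" and close: "\<And>z. z \<in> U \<Longrightarrow> norm (H z - F z) \<le> \<sigma>"
    define E where "E = (\<lambda>z. H z - F z)"
    have hol: "(\<lambda>z. fst (E z)) holomorphic_on U" "(\<lambda>z. snd (E z)) holomorphic_on U"
      using F(1) H by (auto simp: E_def holomorphic_map_on_def fst_diff snd_diff intro!: holomorphic_intros)
    have comp: "norm (fst (E z)) \<le> \<sigma>" "norm (snd (E z)) \<le> \<sigma>" if "z \<in> U" for z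
    proof -
      have "norm (E z) \<le> \<sigma>" using close[OF that] by (simp add: E_def)
      then show "norm (fst (E z)) \<le> \<sigma>" "norm (snd (E z)) \<le> \<sigma>"
        using norm_fst_le[of "fst (E z)" "snd (E z)"] norm_snd_le[of "snd (E z)" "fst (E z)"] by simp_all
    qed
    have lip1: "norm (e x - e y) \<le> 2 * \<sigma> / r * norm (x - y)"
      if e: "e holomorphic_on U" "\<And>z. z \<in> U \<Longrightarrow> norm (e z) \<le> \<sigma>" and a: "a \<in> K" and xy: "x \<in> ball a (r/2)" "y \<in> ball a (r/2)"
      for e :: "complex \<Rightarrow> complex" and a x y
    proof (rule field_differentiable_bound[of "ball a (r/2)" e "deriv e"])
      fix z assume z: "z \<in> ball a (r/2)"
      have sub: "cball z (r/2) \<subseteq> U"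
      proof
        fix w assume "w \<in> cball z (r/2)"
        then have "dist a w \<le> r" using z dist_triangle[of a w z] by simp
        then show "w \<in> U" using c(3)[OF a] by auto
      qed
      have "norm ((deriv ^^ 1) e z) \<le> fact 1 * \<sigma> / (r/2) ^ 1"
      proof (rule Cauchy_inequality)
        show "e holomorphic_on ball z (r/2)" using e(1) sub by (meson ball_subset_cball holomorphic_on_subset order_trans)
        show "continuous_on (cball z (r/2)) e" using e(1) sub by (meson holomorphic_on_imp_continuous_on continuous_on_subset)
        show "norm (e w) \<le> \<sigma>" if "norm (z - w) = r/2" for w
          using e(2)[of w] sub that by (auto simp: subset_iff dist_norm)
      qed (use c in auto)
      then show "norm (deriv e z) \<le> 2 * \<sigma> / r" by (simp add: field_simps)
      have "z \<in> U" using sub c(2) by auto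
      then show "(e has_field_derivative deriv e z) (at z within ball a (r/2))"
        using e(1) F(2) by (meson holomorphic_derivI)
    qed (use xy in auto)
    have lip: "norm (E x - E y) \<le> c / 2 * norm (x - y)" if a: "a \<in> K" and xy: "x \<in> ball a (r/2)" "y \<in> ball a (r/2)" for a x y
    proof -
      have "norm (E x - E y) \<le> norm (fst (E x) - fst (E y)) + norm (snd (E x) - snd (E y))"
        by (rule norm_Pair_le[of "fst (E x - E y)" "snd (E x - E y)", unfolded prod.collapse, unfolded fst_diff snd_diff])
      also have "\<dots> \<le> 2 * \<sigma> / r * norm (x - y) + 2 * \<sigma> / r * norm (x - y)"
        by (intro add_mono lip1[OF hol(1) comp(1) a xy] lip1[OF hol(2) comp(2) a xy])
      also have "\<dots> = c / 2 * norm (x - y)" using c(2) by (simp add: \<sigma>_def field_simps)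
      finally show ?thesis .
    qed
    have HF: "norm (H x - H y) \<ge> norm (F x - F y) - norm (E x - E y)" for x y
      using norm_triangle_ineq4[of "H x - H y" "E x - E y"] by (simp add: E_def algebra_simps)
    have loc: "c / 2 * norm (x - y) \<le> norm (H x - H y)" if "x \<in> K" "norm (x - y) < r / 2" for x y
    proof -
      have "norm (E x - E y) \<le> c / 2 * norm (x - y)"
        by (rule lip[OF that(1)]) (use c that in \<open>auto simp: dist_norm\<close>)
      moreover have "c * norm (x - y) \<le> norm (F x - F y)"
        using c(4)[OF that(1) that(1), of x y] that c(2) by (simp add: dist_norm norm_minus_commute)
      ultimately show ?thesis using HF[of x y] by simp
    qed
    have "inj_on H K"
    proof (rule inj_onI, rule ccontr)
      fix x y assume xy: "x \<in> K" "y \<in> K" "H x = H y" "x \<noteq> y"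
      show False
      proof (cases "norm (x - y) < r / 2")
        case True
        then have "c / 2 * norm (x - y) \<le> 0" using loc[OF xy(1) True] xy(3) by simp
        then show False using c(1) xy(4) by (simp add: mult_le_0_iff)
      next
        case False
        have "norm (E x - E y) \<le> 2 * \<sigma>"
          using norm_triangle_ineq4[of "E x" "E y"] close[of x] close[of y] xy K(2) by (auto simp: E_def subset_iff)
        moreover have "c * norm (x - y) \<le> norm (F x - F y)"
          using c(4)[OF xy(1,2), of x y] c(2) by simp
        moreover have "c * (r / 2) \<le> c * norm (x - y)" using False c(1) by simp
        moreover have "2 * \<sigma> < c * (r / 2)" using c by (simp add: \<sigma>_def)
        ultimately show False using HF[of x y] xy(3) by simp
      qed
    qed
    moreover have "immersion_on H K"
      unfolding immersion_on_def
    proof (intro ballI conjI)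
      fix x assume x: "x \<in> K"
      show d: "H differentiable at x"
        using C1_on_imp_differentiable[OF holomorphic_map_on_imp_C1_on[OF F(2) H]] x K(2) by auto
      show "inj (frechet_derivative H (at x))"
        by (rule expanding_imp_inj_derivative[OF d, of "c / 2" "r / 2"])
          (use c loc[OF x] in \<open>auto simp: norm_minus_commute\<close>)
    qed
    ultimately show "inj_on H K \<and> immersion_on H K" ..
  qed
qed


section \<open>Stretching a polynomial curve inside the ball\<close>

definition sublevel_component :: "complex poly \<Rightarrow> complex poly \<Rightarrow> real \<Rightarrow> complex set"
  where "sublevel_component p q s = connected_component_set {z. norm (poly_curve p q z) < s} 0"

lemma open_sublevel_component: "open (sublevel_component p q s)"
  unfolding sublevel_component_def
  by (intro open_connected_component open_Collect_less continuous_intros continuous_on_poly_curve)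

lemma connected_sublevel_component: "connected (sublevel_component p q s)"
  by (simp add: sublevel_component_def)

lemma sublevel_component_less: "z \<in> sublevel_component p q s \<Longrightarrow> norm (poly_curve p q z) < s"
  using connected_component_subset unfolding sublevel_component_def by blast

lemma connected_subset_sublevel_component:
  assumes "connected C" "z \<in> C" "z \<in> sublevel_component p q s" "\<And>w. w \<in> C \<Longrightarrow> norm (poly_curve p q w) < s"
  shows "C \<subseteq> sublevel_component p q s"
proof -
  have "C \<subseteq> connected_component_set {z. norm (poly_curve p q z) < s} z"
    using assms by (intro connected_component_maximal) auto
  also have "\<dots> = sublevel_component p q s"
    using assms(3) unfolding sublevel_component_def by (metis connected_component_eq)
  finally show ?thesis .
qed

lemma zero_in_sublevel_component: "norm (poly_curve p q 0) < s \<Longrightarrow> 0 \<in> sublevel_component p q s"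
  unfolding sublevel_component_def by simp

lemma closure_sublevel_component_le:
  assumes "z \<in> closure (sublevel_component p q s)"
  shows "norm (poly_curve p q z) \<le> s"
proof -
  have "closure (sublevel_component p q s) \<subseteq> {z. norm (poly_curve p q z) \<le> s}"
    by (intro closure_minimal closed_Collect_le continuous_intros continuous_on_poly_curve)
      (auto intro: less_imp_le sublevel_component_less)
  then show ?thesis using assms by blast
qed

lemma compact_closure_sublevel_component:
  assumes "poly_embedding p q"
  shows "compact (closure (sublevel_component p q s))"
proof -
  have "closure (sublevel_component p q s) \<subseteq> {z. norm (poly_curve p q z) \<le> s}"
    using closure_sublevel_component_le by blast
  then show ?thesis
    using compact_poly_curve_sublevel[OF assms, of s] by (metis bounded_subset closed_closure compact_eq_bounded_closed)
qed

lemma holomorphic_poly: "poly p holomorphic_on S"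
  for p :: "complex poly"
  by (intro holomorphic_intros)

lemma holomorphic_map_on_poly_curve: "holomorphic_map_on (poly_curve p q) S"
  by (simp add: holomorphic_map_on_def poly_curve_def holomorphic_poly)

text \<open>
  The maximum principle for the scalar function obtained by pairing with the value at \<open>z\<close>.
\<close>

lemma poly_curve_maximum_modulus:
  assumes "bounded S" "z \<in> S" "\<And>w. w \<in> frontier S \<Longrightarrow> norm (poly_curve p q w) \<le> B"
  shows "norm (poly_curve p q z) \<le> B"
proof (cases "poly_curve p q z = 0")
  case True
  obtain w where "w \<in> frontier S"
    using assms(1,2) frontier_not_empty[of S] not_bounded_UNIV by blast
  then show ?thesis using True assms(3) norm_ge_zero order_trans by (metis norm_zero)
next
  case False
  define v where "v = poly_curve p q z"
  have "norm (herm (poly_curve p q z) v) \<le> B * norm v"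
  proof (rule maximum_modulus_frontier[OF _ _ assms(1) _ assms(2), of "\<lambda>w. herm (poly_curve p q w) v"])
    show "(\<lambda>w. herm (poly_curve p q w) v) holomorphic_on interior S"
      unfolding herm_def poly_curve_def by (simp, intro holomorphic_intros)
    show "continuous_on (closure S) (\<lambda>w. herm (poly_curve p q w) v)"
      unfolding herm_def poly_curve_def by (simp, intro continuous_intros)
    show "norm (herm (poly_curve p q w) v) \<le> B * norm v" if "w \<in> frontier S" for w
      using norm_herm_le[of "poly_curve p q w" v] assms(3)[OF that]
      by (meson mult_right_mono norm_ge_zero order_trans)
  qed
  moreover have "norm v * norm v \<le> norm (herm v v)"
    using complex_Re_le_cmod[of "herm v v"] by (simp add: Re_herm power2_norm_eq_inner[symmetric] power2_eq_square)
  ultimately have "norm v * norm v \<le> B * norm v" by (simp add: v_def)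
  then show ?thesis using False by (simp add: v_def)
qed

text \<open>
  By the maximum principle the bounded components of the complement of a loop belong to every
  sublevel component that contains the loop. This is why the domains below have no holes.
\<close>

lemma inside_loop_subset_sublevel_component:
  assumes "compact P" "P \<subseteq> sublevel_component p q s"
  shows "inside P \<subseteq> sublevel_component p q s"
proof
  fix z assume z: "z \<in> inside P"
  define C where "C = connected_component_set (- P) z"
  have C: "bounded C" "z \<in> C" "connected C" using z by (auto simp: inside_def C_def)
  have fr: "frontier C \<subseteq> P"
  proof -
    have "frontier C \<subseteq> frontier (- P)" unfolding C_def by (rule frontier_of_connected_component_subset)
    also have "\<dots> \<subseteq> P" using compact_imp_closed[OF assms(1)] frontier_subset_closed by (simp add: frontier_complement)
    finally show ?thesis .
  qed
  obtain y where y: "y \<in> frontier C"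
    using C(1,2) frontier_not_empty[of C] not_bounded_UNIV by blast
  have Pne: "P \<noteq> {}" using y fr by blast
  obtain x where x: "x \<in> P" "\<And>w. w \<in> P \<Longrightarrow> norm (poly_curve p q w) \<le> norm (poly_curve p q x)"
    using continuous_attains_sup[OF assms(1) Pne, of "\<lambda>w. norm (poly_curve p q w)"]
    by (auto intro: continuous_intros continuous_on_poly_curve)
  have xs: "norm (poly_curve p q x) < s" using x(1) assms(2) sublevel_component_less by blast
  have "norm (poly_curve p q w) < s" if "w \<in> closure C" for w
  proof (cases "w \<in> C")
    case True
    then have "norm (poly_curve p q w) \<le> norm (poly_curve p q x)"
      by (rule poly_curve_maximum_modulus[OF C(1)]) (use fr x(2) in blast)
    then show ?thesis using xs by simp
  next
    case False
    then have "w \<in> frontier C" using that interior_subset by (auto simp: frontier_def)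
    then show ?thesis using fr x(2) xs by fastforce
  qed
  moreover have "y \<in> closure C" using y by (simp add: frontier_def)
  moreover have "y \<in> sublevel_component p q s" using y fr assms(2) by blast
  ultimately have "closure C \<subseteq> sublevel_component p q s"
    using connected_subset_sublevel_component[OF connected_imp_connected_closure[OF C(3)]] by blast
  then show "z \<in> sublevel_component p q s" using C(2) closure_subset by blast
qed

text \<open>
  Stopping at the first time at which the norm reaches \<open>b\<close> keeps the path in the component, where
  nearby maps can be compared.
\<close>

lemma exit_sublevel_component:
  fixes \<gamma> :: "real \<Rightarrow> complex"
  assumes cont: "continuous_on {0..1} \<gamma>" and start: "\<gamma> 0 \<in> sublevel_component p q s"
    and stop: "\<gamma> 1 \<notin> sublevel_component p q s" and b: "norm (poly_curve p q (\<gamma> 0)) < b" "b < s"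
  obtains \<beta> where "\<beta> \<in> {0..1}" "\<gamma> ` {0..\<beta>} \<subseteq> sublevel_component p q s" "norm (poly_curve p q (\<gamma> \<beta>)) = b"
proof -
  define f where "f = (\<lambda>t. norm (poly_curve p q (\<gamma> t)))"
  have cf: "continuous_on {0..1} f"
    unfolding f_def by (intro continuous_intros continuous_on_compose2[OF continuous_on_poly_curve cont]) auto
  define C where "C = {t \<in> {0..1}. b \<le> f t}"
  have inside: "\<gamma> ` {0..t} \<subseteq> sublevel_component p q s" if "t \<in> {0..1}" "\<And>u. u \<in> {0..t} \<Longrightarrow> f u < s" for t
  proof (rule connected_subset_sublevel_component[OF _ _ start])
    have "{0..t} \<subseteq> {0..1}" using that(1) by auto
    then show "connected (\<gamma> ` {0..t})"
      by (intro connected_continuous_image continuous_on_subset[OF cont] connected_Icc)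
    show "\<gamma> 0 \<in> \<gamma> ` {0..t}" using that(1) by auto
  qed (use that in \<open>auto simp: f_def\<close>)
  have "C \<noteq> {}"
  proof
    assume "C = {}"
    then have "f u < s" if "u \<in> {0..1}" for u using that b(2) by (force simp: C_def)
    then have "\<gamma> ` {0..1} \<subseteq> sublevel_component p q s" using inside[of 1] by simp
    moreover have "\<gamma> 1 \<in> \<gamma> ` {0..1}" by (rule imageI) simp
    ultimately show False using stop by blast
  qed
  moreover have "compact C"
  proof -
    have "C = {0..1} \<inter> f -` {b..}" by (auto simp: C_def)
    then have "closed C" using continuous_closed_preimage[OF cf] by simp
    moreover have "C = {0..1} \<inter> C" by (auto simp: C_def)
    ultimately show ?thesis by (metis compact_Int_closed compact_Icc)
  qed
  ultimately obtain \<beta> where \<beta>: "\<beta> \<in> C" "\<And>t. t \<in> C \<Longrightarrow> \<beta> \<le> t"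
    using compact_attains_inf[of C] by auto
  have \<beta>01: "\<beta> \<in> {0..1}" "b \<le> f \<beta>" using \<beta>(1) by (auto simp: C_def)
  have "continuous_on {0..\<beta>} f" by (rule continuous_on_subset[OF cf]) (use \<beta>01 in auto)
  then obtain t where t: "0 \<le> t" "t \<le> \<beta>" "f t = b"
    using IVT'[of f 0 b \<beta>] b(1) \<beta>01 by (auto simp: f_def)
  then have "t \<in> C" using \<beta>01 by (auto simp: C_def)
  then have eq: "f \<beta> = b" using \<beta>(2)[of t] t by auto
  have "f u < s" if "u \<in> {0..\<beta>}" for u
  proof (rule ccontr)
    assume "\<not> f u < s"
    then have "u \<in> C" using that \<beta>01 b(2) by (auto simp: C_def)
    then have "u = \<beta>" using \<beta>(2)[of u] that by auto
    then show False using \<open>\<not> f u < s\<close> eq b(2) by simp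
  qed
  then show thesis using that[of \<beta>] inside[OF \<beta>01(1)] \<beta>01(1) eq by (auto simp: f_def)
qed

lemma has_derivative_poly_curve:
  "(poly_curve p q has_derivative (\<lambda>h. (poly (pderiv p) z * h, poly (pderiv q) z * h))) (at z)"
proof -
  have "(poly p has_derivative (\<lambda>h. poly (pderiv p) z * h)) (at z)"
       "(poly q has_derivative (\<lambda>h. poly (pderiv q) z * h)) (at z)"
    using poly_DERIV[of p z] poly_DERIV[of q z] by (simp_all add: has_field_derivative_def)
  then show ?thesis
    unfolding poly_curve_def[abs_def] by (rule has_derivative_Pair)
qed

lemma immersion_on_poly_curve_iff:
  "immersion_on (poly_curve p q) S \<longleftrightarrow> (\<forall>z\<in>S. poly (pderiv p) z \<noteq> 0 \<or> poly (pderiv q) z \<noteq> 0)"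
proof -
  have "inj (\<lambda>h. (P * h, Q * h)) \<longleftrightarrow> P \<noteq> 0 \<or> Q \<noteq> 0" for P Q :: complex
  proof
    assume inj: "inj (\<lambda>h. (P * h, Q * h))"
    show "P \<noteq> 0 \<or> Q \<noteq> 0"
    proof (rule ccontr)
      assume "\<not> ?thesis"
      then have "(1::complex) = 0" by (intro injD[OF inj]) simp
      then show False by simp
    qed
  qed (auto simp: inj_def)
  then show ?thesis
    by (auto simp: immersion_on_def differentiable_def intro: has_derivative_poly_curve
        simp flip: frechet_derivative_at[OF has_derivative_poly_curve])
qed

text \<open>
  What the limit of the iteration has to inherit from the stage \<open>F\<close>: embedding of \<open>K\<close>, and length
  one for paths from \<open>K\<close> to the complement of \<open>U\<close>. The path need not stay in \<open>U\<close>, since its part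
  before the exit already has this length.
\<close>

definition survives_perturbation ::
    "real \<Rightarrow> (complex \<Rightarrow> complex \<times> complex) \<Rightarrow> complex set \<Rightarrow> complex set \<Rightarrow> bool"
  where "survives_perturbation \<sigma> F K U \<longleftrightarrow>
    (\<forall>H. holomorphic_map_on H U \<and> (\<forall>z\<in>U. norm (H z - F z) \<le> \<sigma>) \<longrightarrow>
      inj_on H K \<and> immersion_on H K \<and>
      (\<forall>\<gamma>. continuous_on {0..1} \<gamma> \<and> \<gamma> 0 \<in> K \<and> \<gamma> 1 \<notin> U \<longrightarrow> variation_ge (H \<circ> \<gamma>) 0 1 1))"

text \<open>
  The labyrinth is placed in the middle third of the shell between the radii \<open>s\<close> and \<open>s'\<close>. The outer thirds
  absorb the error of the shears and that of the perturbation \<open>H\<close>, whose image also misses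
  the plates if it is closer to the curve than the plates are.
\<close>

lemma stretching_step:
  assumes emb: "poly_embedding p q" and 0: "poly_curve p q 0 = 0" and s: "0 < s" "s < s'" and "0 < \<tau>"
  obtains p' q' \<sigma> where "poly_embedding p' q'" "poly_curve p' q' 0 = 0" "0 < \<sigma>"
    "\<And>z. norm (poly_curve p q z) \<le> s \<Longrightarrow> norm (poly_curve p' q' z - poly_curve p q z) < \<tau>"
    "closure (sublevel_component p q s) \<subseteq> sublevel_component p' q' s'"
    "survives_perturbation \<sigma> (poly_curve p' q') (closure (sublevel_component p q s)) (sublevel_component p' q' s')"
proof -
  define h where "h = (s' - s) / 3"
  have h: "0 < h" "s' = s + 3 * h" using s by (auto simp: h_def field_simps)
  have ab: "0 < s + h" "s + h < s' - h" using s h by auto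
  obtain t :: real and xs :: "((complex \<times> complex) \<times> real) list" where lab: "0 < t"
    "\<And>u \<rho>. (u, \<rho>) \<in> set xs \<Longrightarrow> norm u = 1 \<and> s + h < \<rho>"
    "sorted_wrt (\<lambda>(u, \<rho>) (u', \<rho>'). \<forall>x\<in>plate u \<rho> t. x \<bullet> u' < \<rho>') xs"
    "\<And>c \<alpha> \<beta>. \<lbrakk>\<alpha> \<le> \<beta>; continuous_on {\<alpha>..\<beta>} c; norm (c \<alpha>) \<le> s + h; s' - h \<le> norm (c \<beta>);
        \<And>r u \<rho>. \<lbrakk>r \<in> {\<alpha>..\<beta>}; (u, \<rho>) \<in> set xs\<rbrakk> \<Longrightarrow> c r \<notin> plate u \<rho> t\<rbrakk> \<Longrightarrow> variation_ge c \<alpha> \<beta> 1"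
    by (rule ex_labyrinth[OF ab, where 'a = "complex \<times> complex"]) blast
  define \<tau>' where "\<tau>' = min \<tau> (h / 2)"
  have \<tau>': "0 < \<tau>'" "\<tau>' \<le> \<tau>" "\<tau>' \<le> h / 2" using h(1) \<open>0 < \<tau>\<close> by (auto simp: \<tau>'_def)
  obtain p' q' where pq: "poly_embedding p' q'" "poly_curve p' q' 0 = 0"
    "\<And>z. norm (poly_curve p q z) \<le> s + h \<Longrightarrow> norm (poly_curve p' q' z - poly_curve p q z) < \<tau>'"
    "\<And>z. \<forall>(u, \<rho>)\<in>set xs. poly_curve p' q' z \<notin> plate u \<rho> t"
    using shear_off_plates[OF lab(3,2) ab(1) emb \<tau>'(1)] 0 by blast
  define T where "T = (\<Union>(u, \<rho>)\<in>set xs. plate u \<rho> t)"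
  have "compact T" unfolding T_def by (intro compact_UN) (auto simp: compact_plate)
  moreover have "poly_curve p' q' z \<notin> T" for z using pq(4)[of z] by (auto simp: T_def)
  ultimately obtain d where d: "0 < d" "\<And>x z. x \<in> T \<Longrightarrow> d \<le> dist x (poly_curve p' q' z)"
    using poly_curve_separated_from_compact[OF pq(1)] by blast
  let ?K = "closure (sublevel_component p q s)" and ?U = "sublevel_component p' q' s'"
  have K': "norm (poly_curve p' q' z) < s + h / 2" if "z \<in> ?K" for z
  proof -
    have "norm (poly_curve p q z) \<le> s" by (rule closure_sublevel_component_le[OF that])
    then show ?thesis
      using pq(3)[of z] \<tau>'(3) h(1) norm_triangle_sub[of "poly_curve p' q' z" "poly_curve p q z"] by simp
  qed
  have "0 \<in> sublevel_component p q s" using 0 s by (intro zero_in_sublevel_component) simp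
  then have zK: "0 \<in> ?K" using closure_subset by blast
  have KU: "?K \<subseteq> ?U"
  proof (rule connected_subset_sublevel_component)
    show "connected ?K" by (intro connected_imp_connected_closure connected_sublevel_component)
    show "0 \<in> ?K" by (rule zK)
    show "0 \<in> ?U" using pq(2) s by (intro zero_in_sublevel_component) simp
    show "norm (poly_curve p' q' z) < s'" if "z \<in> ?K" for z using K'[OF that] h by simp
  qed
  have "inj_on (poly_curve p' q') ?K" using pq(1) by (auto simp: poly_embedding_def intro: inj_on_subset)
  moreover have "immersion_on (poly_curve p' q') ?K"
    using pq(1) by (simp add: immersion_on_poly_curve_iff poly_embedding_def)
  ultimately obtain \<sigma>1 where \<sigma>1: "0 < \<sigma>1" "\<And>H. \<lbrakk>holomorphic_map_on H ?U; \<And>z. z \<in> ?U \<Longrightarrow> norm (H z - poly_curve p' q' z) \<le> \<sigma>1\<rbrakk>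
      \<Longrightarrow> inj_on H ?K \<and> immersion_on H ?K"
    by (rule holomorphic_embedding_stable[OF holomorphic_map_on_poly_curve open_sublevel_component
          compact_closure_sublevel_component[OF emb] KU]) blast
  define \<sigma> where "\<sigma> = min \<sigma>1 (min (h / 2) (d / 2))"
  have \<sigma>: "0 < \<sigma>" "\<sigma> \<le> \<sigma>1" "\<sigma> \<le> h / 2" "\<sigma> < d" using \<sigma>1(1) h(1) d(1) by (auto simp: \<sigma>_def min_def)
  show thesis
  proof (rule that[OF pq(1,2) \<sigma>(1) _ KU])
    show "norm (poly_curve p' q' z - poly_curve p q z) < \<tau>" if "norm (poly_curve p q z) \<le> s" for z
      using pq(3)[of z] that h(1) \<tau>'(2) by simp
    show "survives_perturbation \<sigma> (poly_curve p' q') ?K ?U"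
      unfolding survives_perturbation_def
    proof (intro allI impI, elim conjE)
      fix H assume H: "holomorphic_map_on H ?U" and close: "\<forall>z\<in>?U. norm (H z - poly_curve p' q' z) \<le> \<sigma>"
      have "inj_on H ?K \<and> immersion_on H ?K" using H close \<sigma>(2) by (intro \<sigma>1(2)) fastforce+
      moreover have "variation_ge (H \<circ> \<gamma>) 0 1 1"
        if \<gamma>: "continuous_on {0..1} \<gamma>" "\<gamma> 0 \<in> ?K" "\<gamma> 1 \<notin> ?U" for \<gamma>
      proof -
        have "\<gamma> 0 \<in> ?U" using \<gamma>(2) KU by blast
        moreover have "norm (poly_curve p' q' (\<gamma> 0)) < s' - h / 2" "s' - h / 2 < s'"
          using K'[OF \<gamma>(2)] h by auto
        ultimately obtain \<beta> where \<beta>: "\<beta> \<in> {0..1}" "\<gamma> ` {0..\<beta>} \<subseteq> ?U" "norm (poly_curve p' q' (\<gamma> \<beta>)) = s' - h / 2"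
          using exit_sublevel_component[OF \<gamma>(1) _ \<gamma>(3)] by blast
        have cH: "continuous_on ?U H"
          using C1_on_imp_continuous_on[OF holomorphic_map_on_imp_C1_on[OF open_sublevel_component H]] .
        have inU: "\<gamma> r \<in> ?U" if "r \<in> {0..\<beta>}" for r using \<beta>(2) that by blast
        have "variation_ge (H \<circ> \<gamma>) 0 \<beta> 1"
        proof (rule lab(4))
          show "0 \<le> \<beta>" using \<beta>(1) by simp
          show "continuous_on {0..\<beta>} (H \<circ> \<gamma>)"
            using \<beta>(1,2) by (intro continuous_on_compose continuous_on_subset[OF \<gamma>(1)] continuous_on_subset[OF cH]) auto
          have "norm (H (\<gamma> 0) - poly_curve p' q' (\<gamma> 0)) \<le> h / 2" using close \<open>\<gamma> 0 \<in> ?U\<close> \<sigma>(3) by fastforce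
          then show "norm ((H \<circ> \<gamma>) 0) \<le> s + h"
            using K'[OF \<gamma>(2)] norm_triangle_sub[of "H (\<gamma> 0)" "poly_curve p' q' (\<gamma> 0)"] by simp
          have "norm (H (\<gamma> \<beta>) - poly_curve p' q' (\<gamma> \<beta>)) \<le> h / 2" using close inU[of \<beta>] \<beta>(1) \<sigma>(3) by fastforce
          then show "s' - h \<le> norm ((H \<circ> \<gamma>) \<beta>)"
            using \<beta>(3) norm_triangle_sub[of "poly_curve p' q' (\<gamma> \<beta>)" "H (\<gamma> \<beta>)"] by (simp add: norm_minus_commute)
          fix r u \<rho> assume r: "r \<in> {0..\<beta>}" "(u, \<rho>) \<in> set xs"
          have "norm (H (\<gamma> r) - poly_curve p' q' (\<gamma> r)) < d" using close inU[OF r(1)] \<sigma>(4) by fastforce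
          then have "H (\<gamma> r) \<notin> T" using d(2)[of "H (\<gamma> r)" "\<gamma> r"] by (auto simp: dist_norm)
          then show "(H \<circ> \<gamma>) r \<notin> plate u \<rho> t" using r(2) by (auto simp: T_def)
        qed
        then show ?thesis by (rule variation_ge_initial) (use \<beta>(1) in auto)
      qed
      ultimately show "inj_on H ?K \<and> immersion_on H ?K \<and>
          (\<forall>\<gamma>. continuous_on {0..1} \<gamma> \<and> \<gamma> 0 \<in> ?K \<and> \<gamma> 1 \<notin> ?U \<longrightarrow> variation_ge (H \<circ> \<gamma>) 0 1 1)"
        by blast
    qed
  qed
qed


text \<open>
  The stretching step is iterated from the curve \<open>(z, \<eta> z\<^sup>2 / 4)\<close>, which lies in no complex line. Each stage
  comes with a tolerance \<open>\<mu>\<close>, at most half of the preceding one, and moves the curve by less than half of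
  the preceding tolerance; so the total later motion on the domain of a stage is below its tolerance,
  and the limit inherits all properties recorded there.
\<close>

theorem ex_complete_embedding_of_planar_domain:
  fixes \<eta> :: real
  assumes \<eta>: "0 < \<eta>" "\<eta> < 1"
  obtains \<Omega> :: "complex set" and F :: "complex \<Rightarrow> complex \<times> complex" and K :: "nat \<Rightarrow> complex set"
  where "open \<Omega>" "simply_connected \<Omega>" "ball 0 (1 - \<eta>) \<subseteq> \<Omega>"
    "holomorphic_map_on F \<Omega>" "inj_on F \<Omega>" "immersion_on F \<Omega>" "F 0 = 0"
    "\<And>z. z \<in> \<Omega> \<Longrightarrow> norm (F z) < 1"
    "\<And>z. z \<in> ball 0 (1 - \<eta>) \<Longrightarrow> norm (fst (F z) - z) \<le> \<eta> / 8"
    "\<And>n. compact (K n)" "\<And>n. K n \<subseteq> \<Omega>" "\<Omega> \<subseteq> (\<Union>n. K n)"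
    "\<And>n \<gamma>. \<lbrakk>continuous_on {0..1} \<gamma>; \<gamma> 0 \<in> K n; \<gamma> 1 \<notin> K (Suc n)\<rbrakk> \<Longrightarrow> variation_ge (F \<circ> \<gamma>) 0 1 1"
proof -
  define s where "s = (\<lambda>n::nat. 1 - \<eta> / 2 ^ Suc n)"
  have s: "0 < s n" "s n < s (Suc n)" for n
  proof -
    have "\<eta> / 2 ^ Suc n < 1 / 1" using \<eta> one_le_power[of "2::real" "Suc n"] by (intro frac_less) auto
    then show "0 < s n" by (simp add: s_def)
    show "s n < s (Suc n)" using \<eta> by (simp add: s_def divide_strict_left_mono)
  qed
  define p0 q0 :: "complex poly" where "p0 = [:0, 1:]" and "q0 = [:0, 0, of_real (\<eta> / 4):]"
  have F0: "poly_curve p0 q0 z = (z, of_real (\<eta> / 4) * z\<^sup>2)" for z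
    by (simp add: poly_curve_def p0_def q0_def power2_eq_square)
  define P :: "nat \<Rightarrow> complex poly \<times> complex poly \<times> real \<Rightarrow> bool"
    where "P = (\<lambda>n (p, q, \<mu>). poly_embedding p q \<and> poly_curve p q 0 = 0 \<and> 0 < \<mu> \<and> (n = 0 \<longrightarrow> (p, q, \<mu>) = (p0, q0, \<eta> / 8)))"
  define Q :: "nat \<Rightarrow> complex poly \<times> complex poly \<times> real \<Rightarrow> complex poly \<times> complex poly \<times> real \<Rightarrow> bool"
    where "Q = (\<lambda>n (p, q, \<mu>) (p', q', \<mu>'). \<mu>' \<le> \<mu> / 2 \<and>
      (\<forall>z. norm (poly_curve p q z) \<le> s n \<longrightarrow> norm (poly_curve p' q' z - poly_curve p q z) < \<mu> / 2) \<and>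
      closure (sublevel_component p q (s n)) \<subseteq> sublevel_component p' q' (s (Suc n)) \<and>
      survives_perturbation \<mu>' (poly_curve p' q') (closure (sublevel_component p q (s n))) (sublevel_component p' q' (s (Suc n))))"
  have "\<exists>f. \<forall>n. P n (f n) \<and> Q n (f n) (f (Suc n))"
  proof (rule dependent_nat_choice)
    have "poly_embedding p0 q0"
      unfolding poly_embedding_def
    proof (intro conjI allI impI injI)
      show "x = y" if "poly_curve p0 q0 x = poly_curve p0 q0 y" for x y using that by (simp add: F0)
      show "poly (pderiv p0) z \<noteq> 0 \<or> poly (pderiv q0) z \<noteq> 0" for z by (simp add: p0_def pderiv_pCons)
      show "0 < degree (smult a p0 + smult b q0)" if "(a, b) \<noteq> (0, 0)" for a b
        using that \<eta> by (auto simp: p0_def q0_def)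
    qed
    then show "\<exists>x. P 0 x" using \<eta> by (intro exI[of _ "(p0, q0, \<eta> / 8)"]) (simp add: P_def F0 zero_prod_def)
  next
    fix x n assume "P n x"
    then obtain p q \<mu> where x: "x = (p, q, \<mu>)" "poly_embedding p q" "poly_curve p q 0 = 0" "0 < \<mu>"
      by (cases x) (auto simp: P_def)
    have "0 < \<mu> / 2" using x(4) by simp
    then obtain p' q' \<sigma> where st: "poly_embedding p' q'" "poly_curve p' q' 0 = 0" "0 < \<sigma>"
      "\<And>z. norm (poly_curve p q z) \<le> s n \<Longrightarrow> norm (poly_curve p' q' z - poly_curve p q z) < \<mu> / 2"
      "closure (sublevel_component p q (s n)) \<subseteq> sublevel_component p' q' (s (Suc n))"
      "survives_perturbation \<sigma> (poly_curve p' q') (closure (sublevel_component p q (s n))) (sublevel_component p' q' (s (Suc n)))"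
      by (rule stretching_step[OF x(2,3) s]) blast
    have "survives_perturbation (min \<sigma> (\<mu> / 2)) (poly_curve p' q') (closure (sublevel_component p q (s n))) (sublevel_component p' q' (s (Suc n)))"
      using st(6) unfolding survives_perturbation_def by auto
    then show "\<exists>y. P (Suc n) y \<and> Q n x y"
      using st x by (intro exI[of _ "(p', q', min \<sigma> (\<mu> / 2))"]) (auto simp: P_def Q_def)
  qed
  then obtain f where f: "\<And>n. P n (f n)" "\<And>n. Q n (f n) (f (Suc n))" by blast
  define p where "p = (\<lambda>n. fst (f n))"
  define q where "q = (\<lambda>n. fst (snd (f n)))"
  define \<mu> where "\<mu> = (\<lambda>n. snd (snd (f n)))"
  define G where "G = (\<lambda>n. poly_curve (p n) (q n))"
  define D where "D = (\<lambda>n. sublevel_component (p n) (q n) (s n))"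
  have fn: "f n = (p n, q n, \<mu> n)" for n by (simp add: p_def q_def \<mu>_def)
  have emb: "poly_embedding (p n) (q n)" and G0: "G n 0 = 0" and \<mu>pos: "0 < \<mu> n" for n
    using f(1)[of n] by (simp_all add: fn P_def G_def)
  have init: "p 0 = p0" "q 0 = q0" "\<mu> 0 = \<eta> / 8" using f(1)[of 0] by (simp_all add: fn P_def)
  have \<mu>half: "\<mu> (Suc n) \<le> \<mu> n / 2"
    and close: "norm (G n z) \<le> s n \<Longrightarrow> norm (G (Suc n) z - G n z) < \<mu> n / 2"
    and Dsub: "closure (D n) \<subseteq> D (Suc n)"
    and surv: "survives_perturbation (\<mu> (Suc n)) (G (Suc n)) (closure (D n)) (D (Suc n))" for n z
    using f(2)[of n] by (simp_all add: fn Q_def G_def D_def)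
  have Dmono: "D m \<subseteq> D n" if "m \<le> n" for m n
    using that by (rule lift_Suc_mono_le[rotated]) (use Dsub closure_subset in blast)
  have Dopen: "open (D n)" and Dconn: "connected (D n)" for n
    by (simp_all add: D_def open_sublevel_component connected_sublevel_component)
  have Dless: "norm (G n z) < s n" if "z \<in> D n" for n z
    using that sublevel_component_less by (auto simp: D_def G_def)
  have D0: "0 \<in> D n" for n
    using G0[of n] s(1)[of n] by (auto simp: D_def G_def intro: zero_in_sublevel_component)
\<comment> \<open>Each motion by less than half of the tolerance is paid for by the decrease of the tolerance.\<close>
  have tele: "norm (G (n + k) z - G n z) \<le> \<mu> n - \<mu> (n + k)" if z: "z \<in> D n" for n k z
  proof (induction k)
    case (Suc k)
    have "z \<in> D (n + k)" using z Dmono[of n "n + k"] by auto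
    then have "norm (G (Suc (n + k)) z - G (n + k) z) < \<mu> (n + k) / 2"
      using Dless by (intro close) fastforce
    then show ?case
      using Suc \<mu>half[of "n + k"] norm_triangle_ineq[of "G (Suc (n + k)) z - G (n + k) z" "G (n + k) z - G n z"]
      by simp
  qed simp
  have \<mu>bound: "\<mu> n \<le> (\<eta> / 8) / 2 ^ n" for n
  proof (induction n)
    case (Suc n)
    then show ?case using \<mu>half[of n] by simp
  qed (simp add: init)
  have \<mu>lim: "\<mu> \<longlonglongrightarrow> 0"
  proof (rule tendsto_sandwich[OF _ _ tendsto_const])
    show "(\<lambda>n. (\<eta> / 8) / 2 ^ n) \<longlonglongrightarrow> 0" by real_asymp
  qed (use \<mu>bound \<mu>pos in \<open>auto intro!: always_eventually less_imp_le\<close>)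
  define \<Omega> where "\<Omega> = (\<Union>n. D n)"
  define F where "F = (\<lambda>z. lim (\<lambda>n. G n z))"
  have conv: "(\<lambda>n. G n z) \<longlonglongrightarrow> F z" if z: "z \<in> \<Omega>" for z
  proof -
    obtain n where n: "z \<in> D n" using z by (auto simp: \<Omega>_def)
    have "Cauchy (\<lambda>n. G n z)"
    proof (rule metric_CauchyI)
      fix e :: real assume e: "e > 0"
      obtain N where N: "\<And>m. m \<ge> N \<Longrightarrow> \<mu> m < e / 2"
        using order_tendstoD(2)[OF \<mu>lim, of "e / 2"] e by (auto simp: eventually_sequentially)
      define M where "M = max N n"
      have zM: "z \<in> D M" using n Dmono[of n M] by (auto simp: M_def)
      have "dist (G m z) (G M z) < e / 2" if "m \<ge> M" for m
        using tele[OF zM, of "m - M"] N[of M] that \<mu>pos[of m] by (simp add: M_def dist_norm)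
      then show "\<exists>M. \<forall>m\<ge>M. \<forall>n\<ge>M. dist (G m z) (G n z) < e"
        by (meson dist_triangle_half_l)
    qed
    then show ?thesis unfolding F_def by (simp add: Cauchy_convergent convergent_LIMSEQ_iff[symmetric])
  qed
  have FG: "norm (F z - G n z) \<le> \<mu> n" if z: "z \<in> D n" for z n
  proof (rule tendsto_le[OF sequentially_bot tendsto_const])
    show "(\<lambda>k. norm (G (k + n) z - G n z)) \<longlonglongrightarrow> norm (F z - G n z)"
      using LIMSEQ_ignore_initial_segment[OF conv] z by (intro tendsto_intros) (auto simp: \<Omega>_def)
    show "eventually (\<lambda>k. norm (G (k + n) z - G n z) \<le> \<mu> n) sequentially"
      using tele[OF z] \<mu>pos by (intro always_eventually allI) (metis add.commute diff_le_eq le_add_same_cancel1 less_imp_le order_trans)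
  qed
  have unif: "uniform_limit (D n) G F sequentially" for n
    unfolding uniform_limit_iff
  proof (intro allI impI)
    fix e :: real assume e: "e > 0"
    have "eventually (\<lambda>m. \<mu> m < e) sequentially" using \<mu>lim e by (rule order_tendstoD)
    then show "eventually (\<lambda>m. \<forall>z\<in>D n. dist (G m z) (F z) < e) sequentially"
      using eventually_ge_at_top[of n]
    proof eventually_elim
      case (elim m)
      show ?case
      proof
        fix z assume "z \<in> D n"
        then have "z \<in> D m" using Dmono[OF elim(2)] by blast
        then show "dist (G m z) (F z) < e" using FG[of z m] elim(1) by (simp add: dist_norm norm_minus_commute)
      qed
    qed
  qed
  have holD: "holomorphic_map_on F (D n)" for n
  proof -
    have u: "uniform_limit (D n) (\<lambda>m z. fst (G m z)) (\<lambda>z. fst (F z)) sequentially"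
            "uniform_limit (D n) (\<lambda>m z. snd (G m z)) (\<lambda>z. snd (F z)) sequentially"
      using bounded_linear.uniform_limit[OF bounded_linear_fst unif] bounded_linear.uniform_limit[OF bounded_linear_snd unif] by auto
    have "\<exists>d. 0 < d \<and> cball z d \<subseteq> D n" if "z \<in> D n" for z
      using Dopen[of n] that by (simp add: open_contains_cball)
    then have "\<exists>d. 0 < d \<and> cball z d \<subseteq> D n \<and> uniform_limit (cball z d) (\<lambda>m z. fst (G m z)) (\<lambda>z. fst (F z)) sequentially"
              "\<exists>d. 0 < d \<and> cball z d \<subseteq> D n \<and> uniform_limit (cball z d) (\<lambda>m z. snd (G m z)) (\<lambda>z. snd (F z)) sequentially"
      if "z \<in> D n" for z
      using that uniform_limit_on_subset[OF u(1)] uniform_limit_on_subset[OF u(2)] by metis+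
    moreover have "(\<lambda>z. fst (G m z)) holomorphic_on D n" "(\<lambda>z. snd (G m z)) holomorphic_on D n" for m
      by (simp_all add: G_def poly_curve_def holomorphic_poly)
    ultimately show ?thesis
      unfolding holomorphic_map_on_def
      using holomorphic_uniform_sequence[OF Dopen, of "\<lambda>m z. fst (G m z)"]
        holomorphic_uniform_sequence[OF Dopen, of "\<lambda>m z. snd (G m z)"] by blast
  qed
  have robust: "inj_on F (closure (D n))" "immersion_on F (closure (D n))"
      "\<And>\<gamma>. \<lbrakk>continuous_on {0..1} \<gamma>; \<gamma> 0 \<in> closure (D n); \<gamma> 1 \<notin> D (Suc n)\<rbrakk> \<Longrightarrow> variation_ge (F \<circ> \<gamma>) 0 1 1" for n
  proof -
    have "holomorphic_map_on F (D (Suc n)) \<and> (\<forall>z\<in>D (Suc n). norm (F z - G (Suc n) z) \<le> \<mu> (Suc n))"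
      using holD FG by blast
    from surv[of n, unfolded survives_perturbation_def, THEN spec, THEN mp, OF this]
    show "inj_on F (closure (D n))" "immersion_on F (closure (D n))"
      "\<And>\<gamma>. \<lbrakk>continuous_on {0..1} \<gamma>; \<gamma> 0 \<in> closure (D n); \<gamma> 1 \<notin> D (Suc n)\<rbrakk> \<Longrightarrow> variation_ge (F \<circ> \<gamma>) 0 1 1"
      by blast+
  qed
  have cover: "\<exists>n. S \<subseteq> D n" if S: "compact S" "S \<subseteq> \<Omega>" for S
  proof -
    have "S \<subseteq> (\<Union>n\<in>UNIV. D n)" using S(2) by (simp add: \<Omega>_def)
    then obtain N where "finite N" "S \<subseteq> (\<Union>n\<in>N. D n)"
      by (rule compactE_image[OF S(1) Dopen])
    moreover have "(\<Union>n\<in>N. D n) \<subseteq> D (Max N)" using \<open>finite N\<close> Dmono by (intro UN_least) auto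
    ultimately show ?thesis by blast
  qed
  have opn: "open \<Omega>" using Dopen by (auto simp: \<Omega>_def)
  have "connected \<Omega>" unfolding \<Omega>_def 
  proof (rule connected_Union)
    have "0 \<in> (\<Inter>n. D n)" using D0 by blast
    then show "(\<Inter>n. D n) \<noteq> {}" by blast
  qed (use Dconn in auto)
  moreover have "winding_number g z = 0"
    if g: "path g" "path_image g \<subseteq> \<Omega>" "pathfinish g = pathstart g" "z \<notin> \<Omega>" for g z
  proof -
    obtain n where n: "path_image g \<subseteq> D n" using cover[OF compact_path_image[OF g(1)] g(2)] by blast
    have "inside (path_image g) \<subseteq> D n"
      using inside_loop_subset_sublevel_component[OF compact_path_image[OF g(1)]] n by (simp add: D_def)
    then have "z \<notin> inside (path_image g)" "z \<notin> path_image g" using g(2,4) by (auto simp: \<Omega>_def)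
    then have "z \<in> outside (path_image g)" using inside_Un_outside by blast
    then show ?thesis by (rule winding_number_zero_in_outside[OF g(1,3)])
  qed
  ultimately have sc: "simply_connected \<Omega>"
    using simply_connected_eq_winding_number_zero[OF opn] by blast
  have ball: "ball 0 (1 - \<eta>) \<subseteq> D 0"
    unfolding D_def
  proof (rule connected_subset_sublevel_component)
    show "0 \<in> ball (0::complex) (1 - \<eta>)" using \<eta> by simp
    show "0 \<in> sublevel_component (p 0) (q 0) (s 0)" using D0[of 0] by (simp add: D_def)
    fix w :: complex assume "w \<in> ball 0 (1 - \<eta>)"
    then have w: "norm w < 1 - \<eta>" by simp
    have "norm (poly_curve (p 0) (q 0) w) \<le> norm w + norm (of_real (\<eta> / 4) * w\<^sup>2)"
      unfolding init F0 by (rule norm_Pair_le)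
    also have "norm (of_real (\<eta> / 4) * w\<^sup>2) \<le> \<eta> / 4 * 1"
      unfolding norm_mult norm_power using \<eta> w by (intro mult_mono power_le_one) auto
    finally show "norm (poly_curve (p 0) (q 0) w) < s 0" using w \<eta> by (simp add: s_def)
  qed simp
  show thesis
  proof (rule that[of \<Omega> F "\<lambda>n. closure (D n)"])
    show "ball 0 (1 - \<eta>) \<subseteq> \<Omega>" using ball by (auto simp: \<Omega>_def)
    show "holomorphic_map_on F \<Omega>"
      using holD Dopen unfolding holomorphic_map_on_def \<Omega>_def by (auto intro!: holomorphic_on_UN_open)
    show "inj_on F \<Omega>"
    proof (rule inj_onI)
      fix x y assume xy: "x \<in> \<Omega>" "y \<in> \<Omega>" "F x = F y"
      have "\<exists>n. {x, y} \<subseteq> D n" using xy by (intro cover) auto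
      then obtain n where "x \<in> D n" "y \<in> D n" by auto
      then have "x \<in> closure (D n)" "y \<in> closure (D n)" using closure_subset by blast+
      then show "x = y" using robust(1)[of n] xy(3) by (auto dest: inj_onD)
    qed
    show "immersion_on F \<Omega>"
      using robust(2) closure_subset unfolding immersion_on_def \<Omega>_def by (metis UN_E subsetD)
    show "F 0 = 0"
    proof -
      have "(\<lambda>n. G n 0) \<longlonglongrightarrow> F 0" using D0 by (intro conv) (auto simp: \<Omega>_def)
      then show ?thesis by (simp add: G0 LIMSEQ_const_iff)
    qed
    show "norm (F z) < 1" if z: "z \<in> \<Omega>" for z
    proof -
      obtain n where n: "z \<in> D n" using z by (auto simp: \<Omega>_def)
      have "norm (F z) < s n + \<mu> n"
        using FG[OF n] Dless[OF n] norm_triangle_sub[of "F z" "G n z"] by simp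
      also have "\<dots> \<le> 1" using \<mu>bound[of n] \<eta> by (simp add: s_def field_simps)
      finally show ?thesis .
    qed
    show "norm (fst (F z) - z) \<le> \<eta> / 8" if "z \<in> ball 0 (1 - \<eta>)" for z
    proof -
      have "norm (F z - G 0 z) \<le> \<eta> / 8" using FG[of z 0] ball that init by auto
      moreover have "fst (F z) - z = fst (F z - G 0 z)" by (simp add: G_def init F0 fst_diff)
      ultimately show ?thesis by (metis norm_fst_le order_trans prod.collapse)
    qed
    show "compact (closure (D n))" for n
      unfolding D_def by (rule compact_closure_sublevel_component[OF emb])
    show "closure (D n) \<subseteq> \<Omega>" for n using Dsub[of n] by (auto simp: \<Omega>_def)
    show "\<Omega> \<subseteq> (\<Union>n. closure (D n))" using closure_subset by (auto simp: \<Omega>_def)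
    show "variation_ge (F \<circ> \<gamma>) 0 1 1"
      if "continuous_on {0..1} \<gamma>" "\<gamma> 0 \<in> closure (D n)" "\<gamma> 1 \<notin> closure (D (Suc n))" for n \<gamma>
      using that closure_subset by (intro robust(3)[of _ n]) blast+
  qed (fact opn sc)+
qed


section \<open>Reparametrisation by the disc\<close>

text \<open>
  A quantitative form of the strong maximum principle, obtained from the Schwarz lemma after a Moebius
  map that moves the value at \<open>0\<close> to the origin. The factor \<open>\<kappa>\<close> makes the values
  strictly smaller than one in modulus, as the Moebius map requires.
\<close>

lemma holomorphic_disc_near_one:
  assumes h: "h holomorphic_on ball 0 1" "\<And>z. z \<in> ball 0 1 \<Longrightarrow> norm (h z) \<le> 1"
    and a: "h 0 = of_real a" "1 - \<delta> \<le> a" and \<delta>: "0 < \<delta>" "\<delta> < 1" and z: "norm z \<le> r" "r < 1"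
  shows "norm (h z - 1) \<le> 7 * \<delta> / (1 - r)"
proof -
  define \<kappa> where "\<kappa> = 1 - \<delta>"
  define A where "A = \<kappa> * a"
  define H where "H = (\<lambda>z. of_real \<kappa> * h z)"
  have "\<bar>a\<bar> \<le> 1" using h(2)[of 0] a(1) by simp
  then have a1: "a \<le> 1" by simp
  have \<kappa>: "0 < \<kappa>" "\<kappa> < 1" using \<delta> by (auto simp: \<kappa>_def)
  have A: "0 < A" "A < 1" "\<kappa>\<^sup>2 \<le> A"
  proof -
    have "0 < a" using a(2) \<delta> by simp
    then show "0 < A" using \<kappa> by (simp add: A_def)
    have "A \<le> \<kappa> * 1" unfolding A_def using a1 \<kappa> by (intro mult_left_mono) auto
    then show "A < 1" using \<kappa> by simp
    show "\<kappa>\<^sup>2 \<le> A" unfolding A_def power2_eq_square using a(2) \<kappa> by (intro mult_left_mono) (auto simp: \<kappa>_def)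
  qed
  have H1: "norm (H w) < 1" if "w \<in> ball 0 1" for w
  proof -
    have "norm (H w) = \<kappa> * norm (h w)" using \<kappa> by (simp add: H_def norm_mult)
    also have "\<dots> \<le> \<kappa> * 1" using h(2)[OF that] \<kappa> by (intro mult_left_mono) auto
    finally show ?thesis using \<kappa> by simp
  qed
  define M where "M = Moebius_function 0 (of_real A)"
  have nA: "norm (of_real A :: complex) < 1" using A by simp
  have H0: "H 0 = of_real A" by (simp add: H_def a(1) A_def)
  have holH: "H holomorphic_on ball 0 1" unfolding H_def by (intro holomorphic_intros h(1))
  have MH: "(M \<circ> H) holomorphic_on ball 0 1"
    unfolding M_def
    by (rule holomorphic_on_compose_gen[OF holH Moebius_function_holomorphic[OF nA]]) (use H1 in auto)
  have MH0: "(M \<circ> H) 0 = 0" by (simp add: M_def H0 Moebius_function_eq_zero)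
  have MH1: "norm ((M \<circ> H) w) < 1" if "norm w < 1" for w
    using Moebius_function_norm_lt_1[OF nA, of "H w"] H1[of w] that by (simp add: M_def)
  have "norm ((M \<circ> H) z) \<le> norm z"
    using Schwarz_Lemma(1)[OF MH MH0 MH1, of z] z by simp
  then have w: "norm (M (H z)) \<le> r" using z by simp
  have zb: "z \<in> ball 0 1" using z by simp
  have nz: "1 - of_real A * H z \<noteq> 0"
  proof
    assume "1 - of_real A * H z = 0"
    then have "norm (of_real A * H z) = 1" by simp
    moreover have "norm (of_real A * H z) < 1 * 1"
      unfolding norm_mult using nA H1[OF zb] A by (intro mult_strict_mono) auto
    ultimately show False by simp
  qed
  have r: "0 \<le> r" using z norm_ge_zero order_trans by blast
  have "H z - of_real A = M (H z) * (1 - of_real A * H z)"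
    using nz by (simp add: M_def Moebius_function_def)
  then have "norm (H z - of_real A) \<le> r * norm (1 - of_real A * H z)"
    using w by (simp add: norm_mult mult_right_mono)
  also have "norm (1 - of_real A * H z) \<le> (1 - A\<^sup>2) + norm (H z - of_real A)"
  proof -
    have "1 - of_real A * H z = of_real (1 - A\<^sup>2) - of_real A * (H z - of_real A)"
      by (simp add: algebra_simps power2_eq_square)
    then have "norm (1 - of_real A * H z) \<le> norm (of_real (1 - A\<^sup>2) :: complex) + norm (of_real A * (H z - of_real A))"
      by (simp only: norm_triangle_ineq4)
    also have "norm (of_real (1 - A\<^sup>2) :: complex) = 1 - A\<^sup>2"
      unfolding norm_of_real using A by (simp add: power_le_one)
    also have "norm (of_real A * (H z - of_real A)) \<le> 1 * norm (H z - of_real A)"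
      unfolding norm_mult using nA by (intro mult_right_mono) auto
    finally show ?thesis by simp
  qed
  finally have "norm (H z - of_real A) \<le> r * ((1 - A\<^sup>2) + norm (H z - of_real A))"
    using r by (simp add: mult_left_mono)
  moreover have "r * (1 - A\<^sup>2) \<le> 1 - A\<^sup>2" using z(2) A by (simp add: mult_left_le_one_le r power_le_one)
  ultimately have "norm (H z - of_real A) * (1 - r) \<le> 1 - A\<^sup>2" by (simp add: algebra_simps)
  also have "1 - A\<^sup>2 \<le> 4 * \<delta>"
  proof -
    have "1 - 2 * (1 - A) \<le> A\<^sup>2" using zero_le_power2[of "1 - A"] by (simp add: power2_eq_square algebra_simps)
    moreover have "1 - 2 * \<delta> \<le> \<kappa>\<^sup>2" by (simp add: \<kappa>_def power2_eq_square algebra_simps)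
    moreover have "2 * \<kappa>\<^sup>2 \<le> 2 * A" using A(3) by simp
    ultimately show ?thesis by simp
  qed
  finally have 1: "norm (H z - of_real A) \<le> 4 * \<delta> / (1 - r)" using z(2) by (simp add: pos_le_divide_eq)
  have 2: "norm (h z - H z) \<le> \<delta>"
  proof -
    have "h z - H z = of_real \<delta> * h z" by (simp add: H_def \<kappa>_def algebra_simps)
    then have "norm (h z - H z) = \<delta> * norm (h z)" using \<delta> by (simp add: norm_mult)
    also have "\<dots> \<le> \<delta> * 1" using h(2)[OF zb] \<delta> by (intro mult_left_mono) auto
    finally show ?thesis by simp
  qed
  have 3: "norm (of_real A - 1 :: complex) \<le> 2 * \<delta>"
  proof -
    have "norm (of_real A - 1 :: complex) = 1 - A"
      using A(2) by (metis abs_minus_commute abs_of_pos diff_gt_0_iff_gt norm_of_real of_real_1 of_real_diff)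
    moreover have "1 - 2 * \<delta> \<le> \<kappa>\<^sup>2" by (simp add: \<kappa>_def power2_eq_square algebra_simps)
    ultimately show ?thesis using A(3) by linarith
  qed
  have "norm (h z - 1) \<le> norm (h z - H z) + norm (H z - of_real A) + norm (of_real A - 1 :: complex)"
    using norm_triangle_ineq[of "h z - H z" "H z - of_real A"]
      norm_triangle_ineq[of "h z - of_real A" "of_real A - 1"] by simp
  also have "\<dots> \<le> 3 * \<delta> + 4 * \<delta> / (1 - r)" using 1 2 3 by simp
  also have "3 * \<delta> \<le> 3 * \<delta> / (1 - r)" using \<delta> z(2) r by (simp add: pos_le_divide_eq mult_left_le)
  finally show ?thesis by (simp add: add_divide_distrib[symmetric])
qed

text \<open>
  Precompose with a Riemann map \<open>\<phi>\<close> fixing the origin. As the domain contains the disc of radius \<open>1 - \<eta>\<close>, the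
  Schwarz lemma for the inverse of \<open>\<phi>\<close> gives \<open>|\<phi>' 0| \<ge> 1 - \<eta>\<close>, so the first coordinate \<open>k\<close> of the
  composition has derivative almost one in modulus. After a rotation by \<open>u\<close> the quotient of \<open>k\<close> and
  \<open>z\<close> is a function into the closed unit disc with value almost one at the origin.
\<close>

theorem ex_complete_disc_near_coordinate_disc:
  fixes r \<epsilon> :: real
  assumes r: "0 < r" "r < 1" and "0 < \<epsilon>"
  obtains f :: "complex \<Rightarrow> complex \<times> complex" and K :: "nat \<Rightarrow> complex set"
  where "holomorphic_map_on f (ball 0 1)" "inj_on f (ball 0 1)" "immersion_on f (ball 0 1)"
    "\<And>z. z \<in> ball 0 1 \<Longrightarrow> norm (f z) < 1"
    "\<And>z. norm z \<le> r \<Longrightarrow> norm (fst (f z) - z) < \<epsilon>"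
    "\<And>n. compact (K n)" "\<And>n. K n \<subseteq> ball 0 1" "ball 0 1 \<subseteq> (\<Union>n. K n)"
    "\<And>n \<gamma>. \<lbrakk>continuous_on {0..1} \<gamma>; \<gamma> ` {0..1} \<subseteq> ball 0 1; \<gamma> 0 \<in> K n; \<gamma> 1 \<notin> K (Suc n)\<rbrakk>
       \<Longrightarrow> variation_ge (f \<circ> \<gamma>) 0 1 1"
proof -
\<comment> \<open>The derivative at the origin will be at least \<open>1 - 2 \<eta>\<close>, which leads to the error \<open>14 \<eta> / (1 - r)\<close>.\<close>
  define \<eta> where "\<eta> = min (1 / 4) (\<epsilon> * (1 - r) / 15)"
  have \<eta>: "0 < \<eta>" "\<eta> \<le> 1 / 4" "\<eta> \<le> \<epsilon> * (1 - r) / 15" using assms by (auto simp: \<eta>_def)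
  have \<eta>1: "\<eta> < 1" using \<eta> by simp
  obtain \<Omega> F K where \<Omega>: "open \<Omega>" "simply_connected \<Omega>" "ball 0 (1 - \<eta>) \<subseteq> \<Omega>"
    and F: "holomorphic_map_on F \<Omega>" "inj_on F \<Omega>" "immersion_on F \<Omega>" "F 0 = 0"
    "\<And>z. z \<in> \<Omega> \<Longrightarrow> norm (F z) < 1"
    "\<And>z. z \<in> ball 0 (1 - \<eta>) \<Longrightarrow> norm (fst (F z) - z) \<le> \<eta> / 8"
    and K: "\<And>n. compact (K n)" "\<And>n. K n \<subseteq> \<Omega>" "\<Omega> \<subseteq> (\<Union>n. K n)"
    "\<And>n \<gamma>. \<lbrakk>continuous_on {0..1} \<gamma>; \<gamma> 0 \<in> K n; \<gamma> 1 \<notin> K (Suc n)\<rbrakk> \<Longrightarrow> variation_ge (F \<circ> \<gamma>) 0 1 1"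
    by (rule ex_complete_embedding_of_planar_domain[OF \<eta>(1) \<eta>1]) blast
  have z\<Omega>: "0 \<in> \<Omega>" using \<Omega>(3) \<eta>1 by auto
  have nUNIV: "\<Omega> \<noteq> UNIV"
  proof
    assume U: "\<Omega> = UNIV"
    have "(\<lambda>z. fst (F z)) holomorphic_on UNIV" "(\<lambda>z. snd (F z)) holomorphic_on UNIV"
      using F(1) U by (auto simp: holomorphic_map_on_def)
    moreover have "norm (fst (F z)) \<le> 1" "norm (snd (F z)) \<le> 1" for z
      using F(5)[of z] norm_fst_le[of "fst (F z)" "snd (F z)"] norm_snd_le[of "snd (F z)" "fst (F z)"] U by auto
    ultimately have "(\<lambda>z. fst (F z)) constant_on UNIV" "(\<lambda>z. snd (F z)) constant_on UNIV"
      by (auto intro!: Liouville_theorem boundedI)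
    then have "F 0 = F 1" unfolding constant_on_def by (metis UNIV_I prod.expand)
    then show False using F(2) U by (auto dest: inj_onD)
  qed
  obtain f0 g0 where fg: "f0 holomorphic_on \<Omega>" "g0 holomorphic_on ball 0 1"
    "\<And>z. z \<in> \<Omega> \<Longrightarrow> f0 z \<in> ball 0 1 \<and> g0 (f0 z) = z"
    "\<And>z. z \<in> ball 0 1 \<Longrightarrow> g0 z \<in> \<Omega> \<and> f0 (g0 z) = z"
    using simply_connected_eq_biholomorphic_to_disc[OF \<Omega>(1)] \<Omega>(2) z\<Omega> nUNIV by blast
  have "f0 0 \<in> ball 0 1" using fg(3)[OF z\<Omega>] by blast
  then obtain m m' where m: "m (f0 0) = 0" "m holomorphic_on ball 0 1" "m ` ball 0 1 \<subseteq> ball 0 1"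
    "m' holomorphic_on ball 0 1" "m' ` ball 0 1 \<subseteq> ball 0 1"
    "\<And>z. z \<in> ball 0 1 \<Longrightarrow> m (m' z) = z" "\<And>z. z \<in> ball 0 1 \<Longrightarrow> m' (m z) = z"
    by (rule ball_biholomorphism_exists) blast
  define \<psi> where "\<psi> = m \<circ> f0"
  define \<phi> where "\<phi> = g0 \<circ> m'"
  have hol: "\<psi> holomorphic_on \<Omega>" "\<phi> holomorphic_on ball 0 1"
    unfolding \<psi>_def \<phi>_def
    by (rule holomorphic_on_compose_gen[OF fg(1) m(2)], use fg(3) in blast)
       (rule holomorphic_on_compose_gen[OF m(4) fg(2) m(5)])
  have \<psi>: "\<psi> z \<in> ball 0 1" "\<phi> (\<psi> z) = z" if "z \<in> \<Omega>" for z
    using fg(3)[OF that] m(3,7) by (auto simp: \<psi>_def \<phi>_def image_subset_iff)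
  have \<phi>: "\<phi> z \<in> \<Omega>" "\<psi> (\<phi> z) = z" if "z \<in> ball 0 1" for z
    using fg(4)[of "m' z"] m(5,6) that by (auto simp: \<psi>_def \<phi>_def image_subset_iff)
  have \<psi>0: "\<psi> 0 = 0" by (simp add: \<psi>_def m(1))
  have \<phi>0: "\<phi> 0 = 0" using \<psi>(2)[OF z\<Omega>] \<psi>0 by simp
  define B where "B = deriv \<phi> 0"
  have dB: "(\<phi> has_field_derivative B) (at 0)"
    using hol(2) by (auto simp: B_def intro: holomorphic_derivI)
  have nB: "1 - \<eta> \<le> norm B"
  proof -
    define C where "C = deriv \<psi> 0"
    have dC: "(\<psi> has_field_derivative C) (at (\<phi> 0))"
      using hol(1) \<Omega>(1) z\<Omega> by (auto simp: C_def \<phi>0 intro: holomorphic_derivI)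
    have "((\<lambda>z. \<psi> (\<phi> z)) has_field_derivative C * B) (at 0)"
      by (rule DERIV_chain2[OF dC dB])
    moreover have "((\<lambda>z. \<psi> (\<phi> z)) has_field_derivative 1) (at 0)"
      by (rule has_field_derivative_transform_within_open[OF DERIV_ident, of "ball 0 1"]) (use \<phi> in auto)
    ultimately have CB: "C * B = 1" by (rule DERIV_unique)
    define c :: complex where "c = of_real (1 - \<eta>)"
    have nc: "norm c = 1 - \<eta>" unfolding c_def norm_of_real using \<eta>1 by simp
    define S where "S = (\<lambda>z. \<psi> (c * z))"
    have inb: "c * z \<in> \<Omega>" if "norm z < 1" for z
    proof -
      have "norm (c * z) = (1 - \<eta>) * norm z" by (simp only: norm_mult nc)
      also have "\<dots> < (1 - \<eta>) * 1" using \<eta>1 that by (intro mult_strict_left_mono) auto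
      finally show ?thesis using \<Omega>(3) by auto
    qed
    have "S holomorphic_on ball 0 1"
      unfolding S_def
      by (rule holomorphic_on_compose_gen[OF _ hol(1), unfolded o_def]) (auto intro!: holomorphic_intros inb)
    moreover have "S 0 = 0" by (simp add: S_def \<psi>0)
    moreover have "norm (S z) < 1" if "norm z < 1" for z using \<psi>(1)[OF inb[OF that]] by (simp add: S_def)
    ultimately have "norm (deriv S 0) \<le> 1" by (intro Schwarz_Lemma(2)[of S 0]) auto
    moreover have "deriv S 0 = C * c"
    proof (rule DERIV_imp_deriv)
      have "(\<psi> has_field_derivative C) (at (c * 0))" using dC by (simp add: \<phi>0)
      then show "(S has_field_derivative C * c) (at 0)"
        unfolding S_def by (rule DERIV_chain2) (auto intro!: derivative_eq_intros)
    qed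
    ultimately have "norm C * (1 - \<eta>) \<le> 1" by (simp add: norm_mult nc)
    then have "norm B * (norm C * (1 - \<eta>)) \<le> norm B * 1" by (intro mult_left_mono) auto
    moreover have "norm C * norm B = 1" using CB by (metis norm_mult norm_one)
    ultimately show ?thesis by (simp add: mult.assoc[symmetric] mult.commute[of "norm B"])
  qed
  define F1 where "F1 = (\<lambda>z. fst (F z))"
  have holF1: "F1 holomorphic_on \<Omega>" using F(1) by (simp add: F1_def holomorphic_map_on_def)
  define A where "A = deriv F1 0"
  have dA: "(F1 has_field_derivative A) (at 0)"
    using holF1 \<Omega>(1) z\<Omega> by (auto simp: A_def intro: holomorphic_derivI)
  have nA: "1 - \<eta> / 4 \<le> norm A"
  proof -
    define e where "e = (\<lambda>z. F1 z - z)"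
    have sub: "cball 0 (1/2) \<subseteq> ball (0::complex) (1 - \<eta>)" using \<eta>(2) by auto
    have hole: "e holomorphic_on \<Omega>" unfolding e_def by (intro holomorphic_intros holF1)
    have "norm ((deriv ^^ 1) e 0) \<le> fact 1 * (\<eta> / 8) / (1/2) ^ 1"
    proof (rule Cauchy_inequality)
      show "e holomorphic_on ball 0 (1/2)" using hole sub \<Omega>(3) by (meson ball_subset_cball holomorphic_on_subset order_trans)
      show "continuous_on (cball 0 (1/2)) e" using hole sub \<Omega>(3) by (meson holomorphic_on_imp_continuous_on continuous_on_subset order_trans)
      show "norm (e x) \<le> \<eta> / 8" if "norm (0 - x) = 1/2" for x
        using F(6)[of x] \<eta>(2) that by (auto simp: e_def F1_def)
    qed simp
    moreover have "deriv e 0 = A - 1"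
      by (rule DERIV_imp_deriv) (auto simp: e_def intro!: derivative_eq_intros dA)
    ultimately have "norm (A - 1) \<le> \<eta> / 4" by simp
    then show ?thesis using norm_triangle_sub[of 1 A] by (simp add: norm_minus_commute)
  qed
  define k where "k = F1 \<circ> \<phi>"
  have holk: "k holomorphic_on ball 0 1"
    unfolding k_def by (rule holomorphic_on_compose_gen[OF hol(2) holF1]) (use \<phi> in auto)
  have k0: "k 0 = 0" by (simp add: k_def \<phi>0 F1_def F(4))
  have k1: "norm (k z) < 1" if "norm z < 1" for z
  proof -
    have "norm (F (\<phi> z)) < 1" using F(5) \<phi>(1)[of z] that by simp
    then show ?thesis using norm_fst_le[of "fst (F (\<phi> z))" "snd (F (\<phi> z))"] by (simp add: k_def F1_def)
  qed
  have "deriv k 0 = A * B"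
  proof (rule DERIV_imp_deriv)
    have "(F1 has_field_derivative A) (at (\<phi> 0))" using dA by (simp add: \<phi>0)
    then show "(k has_field_derivative A * B) (at 0)"
      unfolding k_def o_def by (rule DERIV_chain2[OF _ dB])
  qed
  moreover obtain h where h: "h holomorphic_on ball 0 1" "\<And>z. norm z < 1 \<Longrightarrow> k z = z * h z" "deriv k 0 = h 0"
    by (rule Schwarz3[OF holk k0]) blast
  ultimately have h0: "h 0 = A * B" by simp
  have h1: "norm (h z) \<le> 1" if "norm z < 1" for z
  proof (cases "z = 0")
    case True
    have "norm (deriv k 0) \<le> 1" using Schwarz_Lemma(2)[OF holk k0 k1, of 0] by simp
    then show ?thesis using True h(3) by simp
  next
    case False
    have "norm (k z) \<le> norm z" using Schwarz_Lemma(1)[OF holk k0 k1 that] .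
    then show ?thesis using False h(2)[OF that] by (simp add: norm_mult)
  qed
  have nd: "1 - 2 * \<eta> \<le> norm (A * B)"
  proof -
    have "1 - 2 * \<eta> \<le> (1 - \<eta> / 4) * (1 - \<eta>)" using \<eta>(1) by (simp add: algebra_simps)
    also have "\<dots> \<le> norm A * norm B" using nA nB \<eta>1 by (intro mult_mono) auto
    finally show ?thesis by (simp add: norm_mult)
  qed
  have ABnz: "A * B \<noteq> 0" using nd \<eta>(2) by auto
  define u where "u = cnj (A * B) / norm (A * B)"
  have u: "norm u = 1" "u * (A * B) = norm (A * B)"
  proof -
    define w where "w = A * B"
    have w: "w \<noteq> 0" "u = cnj w / norm w" using ABnz by (simp_all add: w_def u_def)
    then show "norm u = 1" by (simp add: norm_divide)
    have "u * w = (w * cnj w) / norm w" by (simp add: w(2))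
    also have "\<dots> = norm w" using w(1) by (simp flip: complex_norm_square add: power2_eq_square)
    finally show "u * (A * B) = norm (A * B)" by (simp add: w_def)
  qed
  have unz: "u \<noteq> 0" using u(1) by auto
  have rot: "u * z \<in> ball 0 1 \<longleftrightarrow> z \<in> ball 0 1" for z using u(1) by (simp add: norm_mult)
  define f where "f = (\<lambda>z. F (\<phi> (u * z)))"
  define \<Phi> where "\<Phi> = (\<lambda>z. \<phi> (u * z))"
  have hol\<Phi>: "\<Phi> holomorphic_on ball 0 1"
    unfolding \<Phi>_def by (rule holomorphic_on_compose_gen[OF _ hol(2), unfolded o_def]) (use rot in \<open>auto intro!: holomorphic_intros\<close>)
  have \<Phi>\<Omega>: "\<Phi> z \<in> \<Omega>" if "z \<in> ball 0 1" for z using \<phi>(1) rot that by (auto simp: \<Phi>_def)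
  have \<psi>\<Phi>: "\<psi> (\<Phi> z) / u = z" if "z \<in> ball 0 1" for z using \<phi>(2)[of "u * z"] rot[of z] that unz by (simp add: \<Phi>_def)
  have \<Phi>\<psi>: "\<Phi> (\<psi> w / u) = w" if "w \<in> \<Omega>" for w using \<psi>(2)[OF that] unz by (simp add: \<Phi>_def)
  have inj\<Phi>: "inj_on \<Phi> (ball 0 1)" by (rule inj_on_inverseI[where g = "\<lambda>w. \<psi> w / u"]) (rule \<psi>\<Phi>)
  define K' where "K' = (\<lambda>n. (\<lambda>w. \<psi> w / u) ` K n)"
  show thesis
  proof (rule that[of f K'])
    show "holomorphic_map_on f (ball 0 1)"
      using F(1) \<Phi>\<Omega> unfolding holomorphic_map_on_def f_def
      by (auto intro!: holomorphic_on_compose_gen[OF hol\<Phi>, unfolded o_def \<Phi>_def] simp: \<Phi>_def)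
    show "inj_on f (ball 0 1)"
    proof (rule inj_onI)
      fix x y :: complex assume xy: "x \<in> ball 0 1" "y \<in> ball 0 1" "f x = f y"
      then have "\<Phi> x = \<Phi> y" using F(2) \<Phi>\<Omega> by (intro inj_onD[OF F(2)]) (auto simp: f_def \<Phi>_def)
      then show "x = y" using inj\<Phi> xy by (blast dest: inj_onD)
    qed
    show "immersion_on f (ball 0 1)"
      unfolding immersion_on_def
    proof (intro ballI)
      fix z :: complex assume z: "z \<in> ball 0 1"
      have D1: "(\<Phi> has_derivative (\<lambda>v. deriv \<Phi> z * v)) (at z)"
        using hol\<Phi> z by (auto intro!: holomorphic_derivI simp: has_field_derivative_def[symmetric])
      have D2: "(F has_derivative frechet_derivative F (at (\<Phi> z))) (at (\<Phi> z))"
        and i2: "inj (frechet_derivative F (at (\<Phi> z)))"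
        using F(3) \<Phi>\<Omega>[OF z] by (auto simp: immersion_on_def frechet_derivative_works)
      have D: "(f has_derivative frechet_derivative F (at (\<Phi> z)) \<circ> (\<lambda>v. deriv \<Phi> z * v)) (at z)"
        using diff_chain_at[OF D1 D2] by (simp add: f_def \<Phi>_def o_def)
      have "deriv \<Phi> z \<noteq> 0" by (rule holomorphic_injective_imp_regular[OF hol\<Phi> _ inj\<Phi> z]) simp
      then have "inj (frechet_derivative F (at (\<Phi> z)) \<circ> (\<lambda>v. deriv \<Phi> z * v))"
        by (intro inj_compose i2) (auto simp: inj_def)
      then show "f differentiable (at z) \<and> inj (frechet_derivative f (at z))"
        using D frechet_derivative_at[OF D] by (auto simp: differentiable_def)
    qed
    show "norm (f z) < 1" if "z \<in> ball 0 1" for z using F(5)[OF \<Phi>\<Omega>[OF that]] by (simp add: f_def \<Phi>_def)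
    show "norm (fst (f z) - z) < \<epsilon>" if z: "norm z \<le> r" for z
    proof -
      have z1: "norm (u * z) < 1" using z r u(1) by (simp add: norm_mult)
      have "fst (f z) = k (u * z)" by (simp add: f_def k_def F1_def)
      also have "\<dots> = z * (u * h (u * z))" by (simp add: h(2)[OF z1])
      finally have "norm (fst (f z) - z) = norm z * norm (u * h (u * z) - 1)"
        by (simp add: norm_mult[symmetric] algebra_simps)
      also have "\<dots> \<le> 1 * norm (u * h (u * z) - 1)" using z r by (intro mult_right_mono) auto
      also have "norm (u * h (u * z) - 1) \<le> 7 * (2 * \<eta>) / (1 - r)"
      proof (rule holomorphic_disc_near_one[where a = "norm (A * B)" and h = "\<lambda>z. u * h (u * z)"])
        show "(\<lambda>z. u * h (u * z)) holomorphic_on ball 0 1"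
          by (intro holomorphic_intros holomorphic_on_compose_gen[OF _ h(1), unfolded o_def]) (use rot in auto)
        show "norm (u * h (u * w)) \<le> 1" if "w \<in> ball 0 1" for w
          using h1[of "u * w"] that u(1) by (simp add: norm_mult)
        show "u * h (u * 0) = of_real (norm (A * B))" using u(2) h0 by simp
      qed (use nd \<eta> z r in auto)
      also have "\<dots> < \<epsilon>"
      proof -
        have "14 * \<eta> < \<epsilon> * (1 - r)" using \<eta>(1,3) assms by simp
        then show ?thesis using r(2) by (simp add: pos_divide_less_eq)
      qed
      finally show ?thesis by simp
    qed
    show "compact (K' n)" for n
      unfolding K'_def
      by (intro compact_continuous_image K(1) continuous_intros)
        (use unz hol(1) K(2) in \<open>auto intro: holomorphic_on_imp_continuous_on holomorphic_on_subset\<close>)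
    show "K' n \<subseteq> ball 0 1" for n
      using \<psi>(1) K(2)[of n] u(1) by (auto simp: K'_def norm_divide)
    show "ball 0 1 \<subseteq> (\<Union>n. K' n)"
    proof
      fix z :: complex assume z: "z \<in> ball 0 1"
      obtain n where "\<Phi> z \<in> K n" using K(3) \<Phi>\<Omega>[OF z] by blast
      then have "z \<in> K' n" unfolding K'_def using \<psi>\<Phi>[OF z] by (metis image_eqI)
      then show "z \<in> (\<Union>n. K' n)" by blast
    qed
    show "variation_ge (f \<circ> \<gamma>) 0 1 1"
      if \<gamma>: "continuous_on {0..1} \<gamma>" "\<gamma> ` {0..1} \<subseteq> ball 0 1" "\<gamma> 0 \<in> K' n" "\<gamma> 1 \<notin> K' (Suc n)" for n \<gamma>
    proof -
      have "continuous_on {0..1} (\<Phi> \<circ> \<gamma>)"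
        by (intro continuous_on_compose \<gamma>(1) continuous_on_subset[OF holomorphic_on_imp_continuous_on[OF hol\<Phi>] \<gamma>(2)])
      moreover have "(\<Phi> \<circ> \<gamma>) 0 \<in> K n" using \<gamma>(3) \<Phi>\<psi> K(2)[of n] by (auto simp: K'_def)
      moreover have "(\<Phi> \<circ> \<gamma>) 1 \<notin> K (Suc n)"
      proof
        assume a: "(\<Phi> \<circ> \<gamma>) 1 \<in> K (Suc n)"
        have "\<gamma> 1 \<in> \<gamma> ` {0..1}" by (rule imageI) simp
        then have "\<gamma> 1 = \<psi> ((\<Phi> \<circ> \<gamma>) 1) / u" using \<psi>\<Phi>[of "\<gamma> 1"] \<gamma>(2) by (simp add: subset_iff)
        then show False using a \<gamma>(4) unfolding K'_def by (metis image_eqI)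
      qed
      ultimately have "variation_ge (F \<circ> (\<Phi> \<circ> \<gamma>)) 0 1 1" by (rule K(4))
      then show ?thesis by (simp add: f_def \<Phi>_def o_def)
    qed
  qed
qed


section \<open>Tubular coordinates around a polynomial disc\<close>

text \<open>
  A nonzero combination of least degree divides both polynomials, so its zeros are common zeros.
\<close>

lemma poly_bezout_without_common_zeros:
  fixes p q :: "complex poly"
  assumes "\<And>z. z \<in> S \<Longrightarrow> poly p z \<noteq> 0 \<or> poly q z \<noteq> 0"
  shows "\<exists>a b. \<forall>z\<in>S. poly (a * p + b * q) z \<noteq> 0"
proof (cases "p = 0 \<and> q = 0")
  case True
  then show ?thesis using assms by auto
next
  case False
  define I where "I = {f. \<exists>a b. f = a * p + b * q}"
  have "p = 1 * p + 0 * q" "q = 0 * p + 1 * q" by simp_all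
  then have pI: "p \<in> I" and qI: "q \<in> I" unfolding I_def by blast+
  obtain f0 where "f0 \<in> I \<and> f0 \<noteq> 0" using False pI qI by blast
  then obtain g where g: "g \<in> I" "g \<noteq> 0" "\<And>f. \<lbrakk>f \<in> I; f \<noteq> 0\<rbrakk> \<Longrightarrow> degree g \<le> degree f"
    using ex_has_least_nat[of "\<lambda>f. f \<in> I \<and> f \<noteq> 0" f0 degree] by blast
  obtain a b where ab: "g = a * p + b * q" using g(1) by (auto simp: I_def)
  have dvd: "g dvd f" if f: "f \<in> I" for f
  proof -
    obtain c d where cd: "f = c * p + d * q" using f by (auto simp: I_def)
    have "f mod g = f - (f div g) * g" by (simp add: minus_div_mult_eq_mod)
    also have "\<dots> = (c - (f div g) * a) * p + (d - (f div g) * b) * q"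
      by (subst (1) cd, subst (2) ab) (simp add: algebra_simps)
    finally have "f mod g \<in> I" unfolding I_def by blast
    then have "f mod g = 0"
      using g(3)[of "f mod g"] degree_mod_less[OF g(2), of f] by (meson not_le)
    then show ?thesis by (simp add: mod_eq_0_iff_dvd)
  qed
  have "poly g z \<noteq> 0" if "z \<in> S" for z
    using assms[OF that] dvd[OF pI] dvd[OF qI] by (metis dvd_trans poly_eq_0_iff_dvd)
  then show ?thesis using ab by blast
qed

lemma holomorphic_poly_approximation:
  assumes "f holomorphic_on ball 0 R" "0 < R'" "R' < R" "0 < e"
  obtains p :: "complex poly" where "\<And>z. z \<in> cball 0 R' \<Longrightarrow> norm (poly p z - f z) < e"
proof -
  define a where "a = (\<lambda>n. (deriv ^^ n) f 0 / fact n)"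
  obtain R'' where R'': "R' < R''" "R'' < R" using assms(3) dense by blast
  have sums: "(\<lambda>n. a n * w ^ n) sums f w" if "w \<in> ball 0 R" for w
    using holomorphic_power_series[OF assms(1) that] by (simp add: a_def)
  have "summable (\<lambda>n. a n * of_real R'' ^ n)"
    using sums[of "of_real R''"] R'' assms(2) by (simp add: sums_iff)
  then have "norm (of_real R'' :: complex) \<le> conv_radius a" by (rule conv_radius_geI)
  moreover have "norm (of_real R'' :: complex) = R''" using R'' assms(2) by simp
  ultimately have "R' < conv_radius a" using R''(1) by (metis ereal_less(2) ereal_less_eq(3) less_ereal.simps(1) order_less_le_trans)
  from powser_uniform_limit[OF this, of 0]
  have "eventually (\<lambda>n. \<forall>x\<in>cball 0 R'. dist (\<Sum>i<n. a i * (x - 0) ^ i) (suminf (\<lambda>i. a i * (x - 0) ^ i)) < e) sequentially"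
    using assms(4) by (rule uniform_limitD)
  then obtain n where n: "\<forall>x\<in>cball 0 R'. dist (\<Sum>i<n. a i * (x - 0) ^ i) (suminf (\<lambda>i. a i * (x - 0) ^ i)) < e"
    using eventually_happens'[OF sequentially_bot] by blast
  show thesis
  proof (rule that[of "\<Sum>i<n. monom (a i) i"])
    fix z :: complex assume z: "z \<in> cball 0 R'"
    then have eq: "suminf (\<lambda>i. a i * z ^ i) = f z" using sums[of z] assms(3) by (simp add: sums_iff)
    have "dist (\<Sum>i<n. a i * (z - 0) ^ i) (suminf (\<lambda>i. a i * (z - 0) ^ i)) < e"
      using n z by (rule bspec)
    then show "norm (poly (\<Sum>i<n. monom (a i) i) z - f z) < e"
      by (simp add: eq poly_sum poly_monom dist_norm)
  qed
qed

text \<open>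
  The curve \<open>(p, q)\<close> thickened in the direction \<open>(a, b)\<close>.
\<close>

definition tube :: "complex poly \<Rightarrow> complex poly \<Rightarrow> complex poly \<Rightarrow> complex poly \<Rightarrow> complex \<times> complex \<Rightarrow> complex \<times> complex"
  where "tube p q a b x =
    (poly p (fst x) + snd x * poly a (fst x), poly q (fst x) + snd x * poly b (fst x))"

lemma has_derivative_poly_fst:
  fixes p :: "complex poly"
  shows "((\<lambda>x :: complex \<times> complex. poly p (fst x)) has_derivative (\<lambda>v. poly (pderiv p) (fst x) * fst v)) (at x within S)"
proof -
  have "(poly p has_derivative (\<lambda>h. poly (pderiv p) (fst x) * h)) (at (fst x))"
    using poly_DERIV[of p "fst x"] by (simp add: has_field_derivative_def)
  moreover have "(fst has_derivative fst) (at x within S)"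
    by (rule bounded_linear_imp_has_derivative) (rule bounded_linear_fst)
  ultimately show ?thesis
    using diff_chain_within[of fst fst x S "poly p"] by (simp add: o_def has_derivative_at_withinI)
qed

lemma has_derivative_tube_component:
  fixes p a :: "complex poly"
  shows "((\<lambda>x. poly p (fst x) + snd x * poly a (fst x)) has_derivative
    (\<lambda>v. poly (pderiv p) (fst x) * fst v + (snd x * (poly (pderiv a) (fst x) * fst v) + snd v * poly a (fst x)))) (at x)"
  by (intro has_derivative_add has_derivative_mult has_derivative_poly_fst
      bounded_linear_imp_has_derivative bounded_linear_snd)

lemma C1_on_tube: "C1_on (tube p q a b) UNIV"
proof -
  have "C1_on (\<lambda>x :: complex \<times> complex. poly p (fst x) + snd x * poly a (fst x)) UNIV" for p a
  proof -
    define f' where "f' = (\<lambda>x :: complex \<times> complex.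
       (blinfun_mult_right (poly (pderiv p) (fst x) + snd x * poly (pderiv a) (fst x)) o\<^sub>L fst_blinfun)
       + (blinfun_mult_right (poly a (fst x)) o\<^sub>L snd_blinfun))"
    have "blinfun_apply (f' x) = (\<lambda>v. poly (pderiv p) (fst x) * fst v
        + (snd x * (poly (pderiv a) (fst x) * fst v) + snd v * poly a (fst x)))" for x
      by (auto simp: f'_def blinfun.add_left fun_eq_iff algebra_simps)
    moreover have "continuous_on UNIV f'"
      unfolding f'_def
      by (intro continuous_intros bounded_linear.continuous_on[OF bounded_linear_blinfun_mult_right]
          bounded_linear.continuous_on[OF bounded_bilinear.bounded_linear_left[OF bounded_bilinear_blinfun_compose]])
    ultimately show ?thesis
      unfolding C1_on_def by (intro exI[of _ f'] conjI ballI) (simp_all add: has_derivative_tube_component)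
  qed
  from C1_on_Pair[OF this this] show ?thesis by (simp add: tube_def[abs_def])
qed

text \<open>
  The differential of the tube along its core has determinant \<open>p' b - q' a\<close>, which by Bezout's
  identity can be made to have no zeros on the closed disc. So the tube is an
  embedding of the core with injective differential, and it is expanding nearby.
\<close>

lemma ex_expanding_tube:
  assumes "inj_on (poly_curve p q) (cball 0 1)"
    and "\<And>z. z \<in> cball 0 1 \<Longrightarrow> poly (pderiv p) z \<noteq> 0 \<or> poly (pderiv q) z \<noteq> 0"
  shows "\<exists>a b c r. 0 < c \<and> 0 < r \<and>
    (\<forall>x y. fst x \<in> cball 0 1 \<and> norm (snd x) \<le> r \<and> fst y \<in> cball 0 1 \<and> norm (snd y) \<le> r
      \<longrightarrow> c * norm (x - y) \<le> norm (tube p q a b x - tube p q a b y))"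
proof -
  obtain b a' where "\<And>z. z \<in> cball 0 1 \<Longrightarrow> poly (b * pderiv p + a' * pderiv q) z \<noteq> 0"
    using poly_bezout_without_common_zeros[of "cball 0 1" "pderiv p" "pderiv q"] assms(2) by blast
  moreover define a where "a = - a'"
  ultimately have ab: "poly (b * pderiv p - a * pderiv q) z \<noteq> 0" if "z \<in> cball 0 1" for z
    using that by simp
  define K :: "(complex \<times> complex) set" where "K = cball 0 1 \<times> {0}"
  have "compact K" by (simp add: K_def compact_Times)
  moreover have "inj_on (tube p q a b) K"
    using assms(1) by (auto simp: inj_on_def K_def tube_def poly_curve_def)
  moreover have "immersion_on (tube p q a b) K"
    unfolding immersion_on_def
  proof (intro ballI)
    fix x assume x: "x \<in> K"
    then obtain z where z: "x = (z, 0)" "z \<in> cball 0 1" by (auto simp: K_def)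
    define P Q A B where "P = poly (pderiv p) z" and "Q = poly (pderiv q) z" and "A = poly a z" and "B = poly b z"
    have D: "(tube p q a b has_derivative (\<lambda>v. (P * fst v + snd v * A, Q * fst v + snd v * B))) (at x)"
      using has_derivative_Pair[OF has_derivative_tube_component[of p a x] has_derivative_tube_component[of q b x]]
      by (simp add: tube_def[abs_def] z P_def Q_def A_def B_def)
    have det: "B * P - A * Q \<noteq> 0" using ab[OF z(2)] by (simp add: A_def B_def P_def Q_def)
    have "v = 0" if v: "(P * fst v + snd v * A, Q * fst v + snd v * B) = 0" for v :: "complex \<times> complex"
    proof -
      have 0: "P * fst v + snd v * A = 0" "Q * fst v + snd v * B = 0" using v by (simp_all add: zero_prod_def)
      have "(B * P - A * Q) * fst v = B * (P * fst v + snd v * A) - A * (Q * fst v + snd v * B)"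
           "(B * P - A * Q) * snd v = P * (Q * fst v + snd v * B) - Q * (P * fst v + snd v * A)"
        by (simp_all add: algebra_simps)
      then show ?thesis using det by (simp add: 0 prod_eq_iff)
    qed
    then have "inj (\<lambda>v. (P * fst v + snd v * A, Q * fst v + snd v * B))"
      using has_derivative_linear[OF D] linear_injective_0 by blast
    then show "tube p q a b differentiable at x \<and> inj (frechet_derivative (tube p q a b) (at x))"
      using D frechet_derivative_at[OF D] by (auto simp: differentiable_def)
  qed
  ultimately obtain c r where c: "0 < c" "0 < r"
    "\<And>a' b' x y. \<lbrakk>a' \<in> K; b' \<in> K; dist x a' \<le> r; dist y b' \<le> r\<rbrakk>
      \<Longrightarrow> c * norm (x - y) \<le> norm (tube p q a b x - tube p q a b y)"
    using C1_embedding_expanding_near_compact[OF C1_on_tube open_UNIV _ subset_UNIV, of K p q a b] by metis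
  show ?thesis
  proof (intro exI conjI allI impI)
    fix x y :: "complex \<times> complex"
    assume "fst x \<in> cball 0 1 \<and> norm (snd x) \<le> r \<and> fst y \<in> cball 0 1 \<and> norm (snd y) \<le> r"
    then have x: "fst x \<in> cball 0 1" "norm (snd x) \<le> r" and y: "fst y \<in> cball 0 1" "norm (snd y) \<le> r" by auto
    have "(fst x, 0) \<in> K" "(fst y, 0) \<in> K" using x y by (auto simp: K_def)
    moreover have "dist x (fst x, 0) \<le> r" "dist y (fst y, 0) \<le> r"
      using x y by (auto simp: dist_prod_def dist_norm)
    ultimately show "c * norm (x - y) \<le> norm (tube p q a b x - tube p q a b y)" by (rule c(3))
  qed (fact c)+
qed

text \<open>
  Up to the factor \<open>c\<close>, the length of the image under \<open>F\<close> dominates the displacements under \<open>f\<close>, to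
  which the lower bounds on the variation apply.
\<close>

lemma complete_immersion_on_expanding_compose:
  fixes f :: "complex \<Rightarrow> complex \<times> complex"
  assumes f: "holomorphic_map_on f (ball 0 1)" "inj_on f (ball 0 1)" "immersion_on f (ball 0 1)"
    and K: "\<And>n. compact (K n)" "\<And>n. K n \<subseteq> ball 0 1" "ball 0 1 \<subseteq> (\<Union>n. K n)"
    and long: "\<And>n \<gamma>. \<lbrakk>continuous_on {0..1} \<gamma>; \<gamma> ` {0..1} \<subseteq> ball 0 1; \<gamma> 0 \<in> K n; \<gamma> 1 \<notin> K (Suc n)\<rbrakk>
       \<Longrightarrow> variation_ge (f \<circ> \<gamma>) 0 1 1"
    and F: "holomorphic_map_on F (ball 0 1)" and c: "0 < c"
    and exp: "\<And>z w. \<lbrakk>z \<in> ball 0 1; w \<in> ball 0 1\<rbrakk> \<Longrightarrow> c * norm (f z - f w) \<le> norm (F z - F w)"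
  shows "inj_on F (ball 0 1)" "complete_immersion_on F (ball 0 1)"
proof -
  have C1: "C1_on f (ball 0 1)" "C1_on F (ball 0 1)"
    by (intro holomorphic_map_on_imp_C1_on open_ball f(1) F)+
  show injF: "inj_on F (ball 0 1)"
  proof (rule inj_onI)
    fix z w :: complex assume zw: "z \<in> ball 0 1" "w \<in> ball 0 1" "F z = F w"
    then have "c * norm (f z - f w) \<le> 0" using exp[of z w] by simp
    then have "f z = f w" using c by (simp add: mult_le_0_iff)
    then show "z = w" using f(2) zw by (blast dest: inj_onD)
  qed
  have "immersion_on F (ball 0 1)"
    unfolding immersion_on_def
  proof (intro ballI conjI)
    fix z :: complex assume z: "z \<in> ball 0 1"
    show d: "F differentiable (at z)" by (rule C1_on_imp_differentiable[OF C1(2) z])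
    have "inj (frechet_derivative f (at z))" using f(3) z by (simp add: immersion_on_def)
    then obtain m \<delta> where m: "0 < m" "0 < \<delta>" "ball z \<delta> \<subseteq> ball 0 1"
      "\<And>x y. \<lbrakk>x \<in> ball z \<delta>; y \<in> ball z \<delta>\<rbrakk> \<Longrightarrow> m * norm (x - y) \<le> norm (f x - f y)"
      by (rule C1_immersion_locally_expanding[OF C1(1) open_ball z]) blast
    show "inj (frechet_derivative F (at z))"
    proof (rule expanding_imp_inj_derivative[OF d, of "c * m" \<delta>])
      fix x assume x: "norm (x - z) < \<delta>"
      have xz: "x \<in> ball z \<delta>" "z \<in> ball z \<delta>" using x m(2) by (auto simp: dist_norm norm_minus_commute)
      have "c * m * norm (x - z) \<le> c * norm (f x - f z)" using m(4)[OF xz] c by simp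
      also have "\<dots> \<le> norm (F x - F z)" using m(3) xz(1) z by (intro exp) auto
      finally show "c * m * norm (x - z) \<le> norm (F x - F z)" .
    qed (use c m in auto)
  qed
  moreover have "Metric_space.mcomplete (ball 0 1) (pullback_dist F (ball 0 1))"
  proof (rule mcomplete_pullback_dist[OF C1(2) injF convex_ball open_ball K c])
    fix n and \<gamma> :: "real \<Rightarrow> complex"
    assume \<gamma>: "valid_path \<gamma>" "path_image \<gamma> \<subseteq> ball 0 1" "pathstart \<gamma> \<in> K n" "pathfinish \<gamma> \<notin> K (Suc n)"
    have "variation_ge (f \<circ> \<gamma>) 0 1 1"
      using \<gamma> valid_path_imp_path[OF \<gamma>(1)]
      by (intro long[of \<gamma> n]) (auto simp: path_def path_image_def pathstart_def pathfinish_def)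
    then have "ennreal 1 \<le> ennreal (1 / c) * arc_length F \<gamma> 0 1"
    proof (rule variation_geD[where L = "\<lambda>x y. ennreal (1 / c) * arc_length F \<gamma> x y"])
      fix x y z :: real assume xyz: "0 \<le> x" "x \<le> y" "y \<le> z" "z \<le> 1"
      show "ennreal (1 / c) * arc_length F \<gamma> x y + ennreal (1 / c) * arc_length F \<gamma> y z
          \<le> ennreal (1 / c) * arc_length F \<gamma> x z"
        using arc_length_superadditive[OF C1(2) \<gamma>(1,2) xyz] by (simp flip: distrib_left)
    next
      fix x y :: real assume xy: "0 \<le> x" "x \<le> y" "y \<le> 1"
      have "x \<in> {0..1}" "y \<in> {0..1}" using xy by auto
      then have "\<gamma> x \<in> ball 0 1" "\<gamma> y \<in> ball 0 1" using \<gamma>(2) unfolding path_image_def by blast+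
      then have "c * norm (f (\<gamma> y) - f (\<gamma> x)) \<le> norm (F (\<gamma> y) - F (\<gamma> x))" by (intro exp)
      then have "norm (f (\<gamma> y) - f (\<gamma> x)) \<le> 1 / c * norm (F (\<gamma> y) - F (\<gamma> x))"
        using c by (simp add: field_simps)
      then have "ennreal (norm (f (\<gamma> y) - f (\<gamma> x))) \<le> ennreal (1 / c) * ennreal (norm (F (\<gamma> y) - F (\<gamma> x)))"
        using c by (simp add: ennreal_leI flip: ennreal_mult)
      also have "\<dots> \<le> ennreal (1 / c) * arc_length F \<gamma> x y"
        by (intro mult_left_mono displacement_le_arc_length[OF C1(2) \<gamma>(1,2) xy]) auto
      finally show "ennreal (norm ((f \<circ> \<gamma>) y - (f \<circ> \<gamma>) x)) \<le> ennreal (1 / c) * arc_length F \<gamma> x y" by simp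
    qed
    then have "ennreal c * 1 \<le> ennreal c * (ennreal (1 / c) * arc_length F \<gamma> 0 1)"
      by (intro mult_left_mono) auto
    also have "\<dots> = ennreal c * ennreal (1 / c) * arc_length F \<gamma> 0 1"
      by (simp only: mult.assoc)
    also have "ennreal c * ennreal (1 / c) = ennreal (c * (1 / c))"
      by (rule ennreal_mult[symmetric]) (use c in auto)
    finally show "ennreal c \<le> pullback_length F \<gamma>"
      using c by (simp add: pullback_length_eq_arc_length)
  qed
  ultimately show "complete_immersion_on F (ball 0 1)" by (simp add: complete_immersion_on_def)
qed

lemma C1_embedding_on_cball_imp:
  assumes "C1_embedding_on G (cball 0 1)"
  shows "continuous_on (cball 0 1) G" "inj_on G (cball 0 1)" "immersion_on G (ball 0 1)"
proof -
  obtain G' where "\<forall>x\<in>cball 0 1. (G has_derivative blinfun_apply (G' x)) (at x within cball 0 1)"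
    "\<forall>x\<in>cball 0 1. inj (blinfun_apply (G' x))"
    using assms unfolding C1_embedding_on_def by blast
  then have G': "(G has_derivative blinfun_apply (G' x)) (at x within cball 0 1)" "inj (blinfun_apply (G' x))"
    if "x \<in> cball 0 1" for x
    using that by blast+
  show "continuous_on (cball 0 1) G"
    unfolding continuous_on_eq_continuous_within by (intro ballI has_derivative_continuous[OF G'(1)])
  have "embedding_map (top_of_set (cball 0 1)) euclidean G" using assms by (simp add: C1_embedding_on_def)
  then show "inj_on G (cball 0 1)"
    using homeomorphic_imp_injective_map by (fastforce simp: embedding_map_def)
  show "immersion_on G (ball 0 1)"
    unfolding immersion_on_def
  proof (intro ballI)
    fix x :: 'a assume x: "x \<in> ball 0 1"
    have "at x within cball 0 1 = at x"
      using x by (intro at_within_interior) simp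
    then have D: "(G has_derivative blinfun_apply (G' x)) (at x)" using G'(1)[of x] x by simp
    then show "G differentiable (at x) \<and> inj (frechet_derivative G (at x))"
      using G'(2)[of x] x frechet_derivative_at[OF D] by (auto simp: differentiable_def)
  qed
qed

lemma hausdorff_dist_closure_less:
  fixes A B :: "'a::metric_space set"
  assumes "\<And>a. a \<in> A \<Longrightarrow> \<exists>b\<in>B. dist a b \<le> d" "\<And>b. b \<in> B \<Longrightarrow> \<exists>a\<in>A. dist a b \<le> d"
    and "0 \<le> d" "d < e"
  shows "hausdorff_dist (closure A) B < ennreal e"
proof -
  obtain d' where d': "d < d'" "d' < e" using assms(4) dense by blast
  have "(SUP a\<in>closure A. INF b\<in>B. ennreal (dist a b)) \<le> ennreal d'"
  proof (rule SUP_least)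
    fix a assume "a \<in> closure A"
    then obtain a' where a': "a' \<in> A" "dist a' a < d' - d" 
      using d'(1) unfolding closure_approachable by (meson diff_gt_0_iff_gt)
    obtain b where b: "b \<in> B" "dist a' b \<le> d" using assms(1)[OF a'(1)] by blast
    have "dist a b \<le> d'" using a'(2) b(2) dist_triangle[of a b a'] by (simp add: dist_commute)
    then show "(INF b\<in>B. ennreal (dist a b)) \<le> ennreal d'"
      using b(1) by (intro INF_lower2[of b]) (auto intro: ennreal_leI)
  qed
  moreover have "(SUP b\<in>B. INF a\<in>closure A. ennreal (dist a b)) \<le> ennreal d'"
  proof (rule SUP_least)
    fix b assume "b \<in> B"
    then obtain a where a: "a \<in> A" "dist a b \<le> d" using assms(2) by blast
    then show "(INF a\<in>closure A. ennreal (dist a b)) \<le> ennreal d'"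
      using d'(1) closure_subset[of A] by (intro INF_lower2[of a]) (auto intro!: ennreal_leI)
  qed
  ultimately have "hausdorff_dist (closure A) B \<le> ennreal d'" by (simp add: hausdorff_dist_def)
  also have "\<dots> < ennreal e" using d' assms(3) by (simp add: ennreal_lessI)
  finally show ?thesis .
qed

text \<open>
  Dilations push a map that is continuous on the closed disc and holomorphic inside to one that is holomorphic
  across the boundary.
\<close>

lemma uniformly_close_dilation:
  fixes G :: "complex \<Rightarrow> complex \<times> complex"
  assumes "continuous_on (cball 0 1) G" "0 < e" "0 < s" "s < 1"
  obtains r where "s < r" "r < 1" "\<And>z. z \<in> cball 0 1 \<Longrightarrow> norm (G (of_real r * z) - G z) < e"
proof -
  have "uniformly_continuous_on (cball 0 1) G"
    using assms(1) by (intro compact_uniformly_continuous) auto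
  then obtain d where d: "d > 0" "\<And>x y. \<lbrakk>x \<in> cball 0 1; y \<in> cball 0 1; dist y x < d\<rbrakk> \<Longrightarrow> dist (G y) (G x) < e"
    using assms(2) unfolding uniformly_continuous_on_def by metis
  define r where "r = max ((1 + s) / 2) (1 - d / 2)"
  have r: "s < r" "r < 1" "1 - r < d" 
    unfolding r_def using assms(3,4) d(1) by (auto simp: less_max_iff_disj max_def field_simps)
  show thesis
  proof (rule that[OF r(1,2)])
    fix z :: complex assume z: "z \<in> cball 0 1"
    have "norm (of_real r * z) \<le> 1 * 1"
      unfolding norm_mult norm_of_real using z r assms(3) by (intro mult_mono) auto
    moreover have "dist (of_real r * z) z < d"
    proof -
      have "dist (of_real r * z) z = norm (of_real (1 - r) * z)"
        by (simp add: dist_norm norm_minus_commute algebra_simps)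
      also have "\<dots> = (1 - r) * norm z" unfolding norm_mult norm_of_real using r by simp
      also have "\<dots> \<le> (1 - r) * 1" using z r by (intro mult_left_mono) auto
      finally show ?thesis using r(3) by simp
    qed
    ultimately show "norm (G (of_real r * z) - G z) < e" using d(2)[of z "of_real r * z"] z by (simp add: dist_norm)
  qed
qed

text \<open>
  A slight dilation of \<open>G\<close> embeds a neighbourhood of the closed disc, and so do its Taylor
  polynomials of high degree, by stability.
\<close>

lemma ex_polynomial_embedding_near:
  assumes G: "continuous_on (cball 0 1) G" "inj_on G (cball 0 1)" "immersion_on G (ball 0 1)"
    "holomorphic_map_on G (ball 0 1)" and "0 < e"
  obtains p q where "inj_on (poly_curve p q) (cball 0 1)"
    "\<And>z. z \<in> cball 0 1 \<Longrightarrow> poly (pderiv p) z \<noteq> 0 \<or> poly (pderiv q) z \<noteq> 0"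
    "\<And>z. z \<in> cball 0 1 \<Longrightarrow> norm (poly_curve p q z - G z) < e"
proof -
  have "0 < e / 2" using \<open>0 < e\<close> by simp
  then obtain r where r: "1 / 2 < r" "r < 1" "\<And>z. z \<in> cball 0 1 \<Longrightarrow> norm (G (of_real r * z) - G z) < e / 2"
    by (rule uniformly_close_dilation[OF G(1), of _ "1/2"]) auto
  define g where "g = (\<lambda>z. G (of_real r * z))"
  have inb: "of_real r * z \<in> ball 0 1 \<longleftrightarrow> z \<in> ball 0 (1 / r)" for z :: complex
    using r by (simp add: norm_mult field_simps)
  have r1: "1 < 1 / r" using r by simp
  have inb1: "of_real r * z \<in> ball 0 1" if "z \<in> cball 0 1" for z :: complex
    unfolding inb using that order_le_less_trans[OF _ r1, of "norm z"] by simp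
  obtain R where R: "1 < R" "R < 1 / r" using dense[OF r1] by blast
  have holg: "holomorphic_map_on g (ball 0 (1 / r))"
  proof -
    have "(\<lambda>z. of_real r * z) holomorphic_on ball 0 (1 / r)" by (intro holomorphic_intros)
    moreover have "(\<lambda>z. of_real r * z) ` ball 0 (1 / r) \<subseteq> ball (0::complex) 1" using inb by blast
    ultimately show ?thesis
      using G(4) holomorphic_on_compose_gen[of "\<lambda>z. of_real r * z" "ball 0 (1 / r)" "\<lambda>z. fst (G z)" "ball 0 1"]
        holomorphic_on_compose_gen[of "\<lambda>z. of_real r * z" "ball 0 (1 / r)" "\<lambda>z. snd (G z)" "ball 0 1"]
      unfolding holomorphic_map_on_def g_def o_def by blast
  qed
  have sub: "cball 0 1 \<subseteq> ball (0::complex) R" "ball (0::complex) R \<subseteq> cball 0 R" "ball (0::complex) R \<subseteq> ball 0 (1 / r)"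
    using R by auto
  have hol: "holomorphic_map_on g (ball 0 R)"
    using holg sub(3) by (auto simp: holomorphic_map_on_def elim: holomorphic_on_subset)
  have C1: "C1_on G (ball 0 1)" "C1_on g (ball 0 R)"
    by (intro holomorphic_map_on_imp_C1_on open_ball G(4) hol)+
  have injg: "inj_on g (cball 0 1)"
  proof (rule inj_onI)
    fix x y :: complex assume xy: "x \<in> cball 0 1" "y \<in> cball 0 1" "g x = g y"
    have "of_real r * x \<in> ball 0 1" "of_real r * y \<in> ball 0 1" using inb1 xy by blast+
    then have "of_real r * x = of_real r * y"
      using xy(3) G(2) by (intro inj_onD[OF G(2)]) (auto simp: g_def)
    then show "x = y" using r(1) by simp
  qed
  have immg: "immersion_on g (cball 0 1)"
    unfolding immersion_on_def
  proof (intro ballI conjI)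
    fix z :: complex assume z: "z \<in> cball 0 1"
    show d: "g differentiable (at z)" using C1_on_imp_differentiable[OF C1(2)] z sub(1) by blast
    have rz: "of_real r * z \<in> ball 0 1" using inb1 z by blast
    then have "inj (frechet_derivative G (at (of_real r * z)))" using G(3) by (simp add: immersion_on_def)
    then obtain m \<delta> where m: "0 < m" "0 < \<delta>" "ball (of_real r * z) \<delta> \<subseteq> ball 0 1"
      "\<And>x y. \<lbrakk>x \<in> ball (of_real r * z) \<delta>; y \<in> ball (of_real r * z) \<delta>\<rbrakk> \<Longrightarrow> m * norm (x - y) \<le> norm (G x - G y)"
      by (rule C1_immersion_locally_expanding[OF C1(1) open_ball rz]) blast
    show "inj (frechet_derivative g (at z))"
    proof (rule expanding_imp_inj_derivative[OF d, of "m * r" \<delta>])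
      fix x assume x: "norm (x - z) < \<delta>"
      have n: "norm (of_real r * x - of_real r * z) = r * norm (x - z)"
        using r by (simp add: norm_mult flip: right_diff_distrib)
      also have "\<dots> \<le> 1 * norm (x - z)" using r by (intro mult_right_mono) auto
      finally have "of_real r * x \<in> ball (of_real r * z) \<delta>" using x by (simp add: dist_norm norm_minus_commute)
      then have "m * norm (of_real r * x - of_real r * z) \<le> norm (g x - g z)"
        unfolding g_def using m(2) by (intro m(4)) auto
      then show "m * r * norm (x - z) \<le> norm (g x - g z)" by (simp add: n)
    qed (use m r in auto)
  qed
  obtain \<sigma> where \<sigma>: "0 < \<sigma>" "\<And>H. \<lbrakk>holomorphic_map_on H (ball 0 R); \<And>z. z \<in> ball 0 R \<Longrightarrow> norm (H z - g z) \<le> \<sigma>\<rbrakk>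
      \<Longrightarrow> inj_on H (cball 0 1) \<and> immersion_on H (cball 0 1)"
    by (rule holomorphic_embedding_stable[OF hol open_ball compact_cball sub(1) injg immg]) blast
  define e' where "e' = min \<sigma> (e / 2) / 2"
  have e': "0 < e'" "2 * e' \<le> \<sigma>" "2 * e' \<le> e / 2" using \<sigma>(1) \<open>0 < e\<close> by (auto simp: e'_def)
  have R0: "0 < R" using R by simp
  have "(\<lambda>z. fst (g z)) holomorphic_on ball 0 (1 / r)" "(\<lambda>z. snd (g z)) holomorphic_on ball 0 (1 / r)"
    using holg by (auto simp: holomorphic_map_on_def)
  note hol12 = this
  obtain p where p: "\<And>z. z \<in> cball 0 R \<Longrightarrow> norm (poly p z - fst (g z)) < e'"
    by (rule holomorphic_poly_approximation[OF hol12(1) R0 R(2) e'(1)]) (rule that)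
  obtain q where q: "\<And>z. z \<in> cball 0 R \<Longrightarrow> norm (poly q z - snd (g z)) < e'"
    by (rule holomorphic_poly_approximation[OF hol12(2) R0 R(2) e'(1)]) (rule that)
  have close: "norm (poly_curve p q z - g z) < 2 * e'" if "z \<in> cball 0 R" for z
  proof -
    have "poly_curve p q z - g z = (poly p z - fst (g z), poly q z - snd (g z))"
      by (simp add: poly_curve_def prod_eq_iff)
    then have "norm (poly_curve p q z - g z) \<le> norm (poly p z - fst (g z)) + norm (poly q z - snd (g z))"
      by (simp add: norm_Pair_le)
    then show ?thesis using p[OF that] q[OF that] by simp
  qed
  have "norm (poly_curve p q z - g z) \<le> \<sigma>" if "z \<in> ball 0 R" for z
    using close[of z] that e'(2) by simp
  then have emb: "inj_on (poly_curve p q) (cball 0 1)" "immersion_on (poly_curve p q) (cball 0 1)"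
    using \<sigma>(2)[OF holomorphic_map_on_poly_curve] by auto
  show thesis
  proof (rule that[OF emb(1)])
    fix z :: complex assume z: "z \<in> cball 0 1"
    have "norm (poly_curve p q z - g z) < e / 2" using close[of z] z R e'(3) by simp
    then show "norm (poly_curve p q z - G z) < e"
      using r(3)[OF z] norm_triangle_ineq[of "poly_curve p q z - g z" "g z - G z"] by (simp add: g_def)
    show "poly (pderiv p) z \<noteq> 0 \<or> poly (pderiv q) z \<noteq> 0"
      using emb(2) z by (simp add: immersion_on_poly_curve_iff)
  qed
qed

theorem corollary1p8:
  fixes G :: "complex \<Rightarrow> complex \<times> complex" and K :: "complex set" and \<epsilon> :: real
  assumes "C1_embedding_on G (cball 0 1)"
    and "holomorphic_map_on G (ball 0 1)"
    and "compact K" and "K \<subseteq> ball 0 1"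
    and "\<epsilon> > 0"
  shows "\<exists>F :: complex \<Rightarrow> complex \<times> complex.
    holomorphic_map_on F (ball 0 1) \<and>
    inj_on F (ball 0 1) \<and>
    complete_immersion_on F (ball 0 1) \<and>
    (\<forall>z\<in>K. norm (F z - G z) < \<epsilon>) \<and>
    hausdorff_dist (closure (F ` ball 0 1)) (G ` cball 0 1) < ennreal \<epsilon>"
proof -
  define e where "e = \<epsilon> / 8"
  have e: "0 < e" "\<epsilon> = 8 * e" using assms(5) by (auto simp: e_def)
  have G: "continuous_on (cball 0 1) G" "inj_on G (cball 0 1)" "immersion_on G (ball 0 1)"
    using C1_embedding_on_cball_imp[OF assms(1)] by auto
  obtain p q where pq: "inj_on (poly_curve p q) (cball 0 1)"
    "\<And>z. z \<in> cball 0 1 \<Longrightarrow> poly (pderiv p) z \<noteq> 0 \<or> poly (pderiv q) z \<noteq> 0"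
    and near: "\<And>z. z \<in> cball 0 1 \<Longrightarrow> norm (poly_curve p q z - G z) < e"
    by (rule ex_polynomial_embedding_near[OF G assms(2) e(1)]) blast
  obtain a b c \<rho> where c: "0 < c" and \<rho>: "0 < \<rho>"
    and tube: "\<And>x y. \<lbrakk>fst x \<in> cball 0 1; norm (snd x) \<le> \<rho>; fst y \<in> cball 0 1; norm (snd y) \<le> \<rho>\<rbrakk>
      \<Longrightarrow> c * norm (x - y) \<le> norm (tube p q a b x - tube p q a b y)"
    using ex_expanding_tube[OF pq] by blast
  obtain B where B: "0 < B" "\<And>z. z \<in> cball 0 1 \<Longrightarrow> norm (poly_curve a b z) \<le> B"
  proof -
    have "bounded (poly_curve a b ` cball 0 1)"
      by (intro compact_imp_bounded compact_continuous_image continuous_on_poly_curve compact_cball)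
    then show thesis using that by (auto simp: bounded_pos)
  qed
  define \<delta> where "\<delta> = min (min 1 \<rho>) (e / B)"
  have \<delta>: "0 < \<delta>" "\<delta> \<le> 1" "\<delta> \<le> \<rho>" "\<delta> * B \<le> e"
  proof -
    show "0 < \<delta>" "\<delta> \<le> 1" "\<delta> \<le> \<rho>" using \<rho> e B(1) by (auto simp: \<delta>_def)
    have "\<delta> \<le> e / B" by (simp add: \<delta>_def)
    then show "\<delta> * B \<le> e" using B(1) by (simp add: pos_le_divide_eq)
  qed
  have "uniformly_continuous_on (cball 0 1) (poly_curve p q)"
    by (intro compact_uniformly_continuous continuous_on_poly_curve compact_cball)
  then obtain \<theta> where \<theta>: "0 < \<theta>"
    "\<And>x y. \<lbrakk>x \<in> cball 0 1; y \<in> cball 0 1; dist y x < \<theta>\<rbrakk> \<Longrightarrow> dist (poly_curve p q y) (poly_curve p q x) < e"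
    using e(1) unfolding uniformly_continuous_on_def by metis
  obtain s where s: "0 < s" "s < 1" "K \<subseteq> cball 0 s"
  proof (cases "K = {}")
    case True
    then show thesis using that[of "1/2"] by auto
  next
    case False
    have "continuous_on K norm" by (intro continuous_intros)
    then obtain x where x: "x \<in> K" "\<And>y. y \<in> K \<Longrightarrow> norm y \<le> norm x"
      using continuous_attains_sup[OF assms(3) False] by blast
    then show thesis using that[of "max (1/2) (norm x)"] assms(4) by fastforce
  qed
  obtain r where r: "s < r" "r < 1" "\<And>z. z \<in> cball 0 1 \<Longrightarrow> norm (G (of_real r * z) - G z) < e"
    by (rule uniformly_close_dilation[OF G(1) e(1) s(1,2)]) blast
  have r0: "0 < r" using s r by simp
  obtain f C where f: "holomorphic_map_on f (ball 0 1)" "inj_on f (ball 0 1)" "immersion_on f (ball 0 1)"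
    "\<And>z. z \<in> ball 0 1 \<Longrightarrow> norm (f z) < 1"
    "\<And>z. norm z \<le> r \<Longrightarrow> norm (fst (f z) - z) < \<theta>"
    and C: "\<And>n. compact (C n)" "\<And>n. C n \<subseteq> ball 0 1" "ball 0 1 \<subseteq> (\<Union>n. C n)"
    "\<And>n \<gamma>. \<lbrakk>continuous_on {0..1} \<gamma>; \<gamma> ` {0..1} \<subseteq> ball 0 1; \<gamma> 0 \<in> C n; \<gamma> 1 \<notin> C (Suc n)\<rbrakk>
       \<Longrightarrow> variation_ge (f \<circ> \<gamma>) 0 1 1"
    by (rule ex_complete_disc_near_coordinate_disc[OF r0 r(2) \<theta>(1)]) blast
  have f1: "fst (f z) \<in> ball 0 1" "norm (snd (f z)) < 1" if "z \<in> ball 0 1" for z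
    using f(4)[OF that] norm_fst_le[of "fst (f z)" "snd (f z)"] norm_snd_le[of "snd (f z)" "fst (f z)"] by auto
  define F where "F = (\<lambda>z. tube p q a b (fst (f z), of_real \<delta> * snd (f z)))"
  have holf: "(\<lambda>z. fst (f z)) holomorphic_on ball 0 1" "(\<lambda>z. snd (f z)) holomorphic_on ball 0 1"
    using f(1) by (auto simp: holomorphic_map_on_def)
  have "(\<lambda>z. poly P (fst (f z))) holomorphic_on ball 0 1" for P
    using holomorphic_on_compose_gen[OF holf(1) holomorphic_poly[of P UNIV]] by (simp add: o_def)
  then have holF: "holomorphic_map_on F (ball 0 1)"
    unfolding holomorphic_map_on_def F_def tube_def by (simp, intro conjI holomorphic_intros holf)
  have exp: "c * \<delta> * norm (f z - f w) \<le> norm (F z - F w)" if zw: "z \<in> ball 0 1" "w \<in> ball 0 1" for z w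
  proof -
    define x where "x = (fst (f z), of_real \<delta> * snd (f z))"
    define y where "y = (fst (f w), of_real \<delta> * snd (f w))"
    have small: "\<delta> * norm t \<le> \<rho>" if "norm t < 1" for t :: complex
    proof -
      have "\<delta> * norm t \<le> \<delta> * 1" using that \<delta>(1) by (intro mult_left_mono) auto
      then show ?thesis using \<delta>(3) by simp
    qed
    have "\<delta> * norm (f z - f w) \<le> norm (x - y)"
    proof (rule power2_le_imp_le)
      define A D where "A = norm (fst (f z) - fst (f w))" and "D = norm (snd (f z) - snd (f w))"
      have "(norm (x - y))\<^sup>2 = A\<^sup>2 + (\<delta> * D)\<^sup>2"
        using \<delta>(1) by (simp add: x_def y_def A_def D_def norm_prod_def norm_mult flip: right_diff_distrib)
      moreover have "(\<delta> * norm (f z - f w))\<^sup>2 = \<delta>\<^sup>2 * A\<^sup>2 + (\<delta> * D)\<^sup>2"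
        by (simp add: A_def D_def norm_prod_def power_mult_distrib fst_diff snd_diff distrib_left)
      moreover have "\<delta>\<^sup>2 * A\<^sup>2 \<le> 1 * A\<^sup>2" using \<delta> by (intro mult_right_mono) (auto simp: power_le_one)
      ultimately show "(\<delta> * norm (f z - f w))\<^sup>2 \<le> (norm (x - y))\<^sup>2" by simp
    qed simp
    then have "c * (\<delta> * norm (f z - f w)) \<le> c * norm (x - y)" using c by simp
    also have "\<dots> \<le> norm (tube p q a b x - tube p q a b y)"
    proof (rule tube)
      show "fst x \<in> cball 0 1" "fst y \<in> cball 0 1" using f1(1)[OF zw(1)] f1(1)[OF zw(2)] by (auto simp: x_def y_def)
      show "norm (snd x) \<le> \<rho>" "norm (snd y) \<le> \<rho>"
        using small f1(2)[OF zw(1)] f1(2)[OF zw(2)] \<delta>(1) by (auto simp: x_def y_def norm_mult)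
    qed
    finally show ?thesis by (simp add: F_def x_def y_def mult.assoc)
  qed
  have "0 < c * \<delta>" using c \<delta>(1) by simp
  note complete = complete_immersion_on_expanding_compose[OF f(1-3) C holF this exp]
  have FP: "norm (F z - poly_curve p q (fst (f z))) \<le> e" if z: "z \<in> ball 0 1" for z
  proof -
    define w where "w = of_real \<delta> * snd (f z)"
    have "F z - poly_curve p q (fst (f z)) = (w * poly a (fst (f z)), w * poly b (fst (f z)))"
      by (simp add: F_def tube_def poly_curve_def w_def)
    then have "(norm (F z - poly_curve p q (fst (f z))))\<^sup>2 = (norm w * norm (poly_curve a b (fst (f z))))\<^sup>2"
      by (simp add: norm_prod_def poly_curve_def norm_mult power_mult_distrib algebra_simps)
    then have "norm (F z - poly_curve p q (fst (f z))) = norm w * norm (poly_curve a b (fst (f z)))"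
      by (simp add: power2_eq_iff_nonneg)
    also have "\<dots> \<le> \<delta> * B"
    proof (rule mult_mono)
      have "\<delta> * norm (snd (f z)) \<le> \<delta> * 1" using f1(2)[OF z] \<delta>(1) by (intro mult_left_mono) auto
      then show "norm w \<le> \<delta>" using \<delta>(1) by (simp add: w_def norm_mult)
      show "norm (poly_curve a b (fst (f z))) \<le> B" using f1(1)[OF z] by (intro B(2)) auto
    qed (use \<delta> in auto)
    finally show ?thesis using \<delta>(4) by simp
  qed
  have FG: "norm (F z - G z) < 3 * e" if z: "norm z \<le> r" for z
  proof -
    have zb: "z \<in> ball 0 1" "z \<in> cball 0 1" using z r(2) by auto
    have "dist (poly_curve p q (fst (f z))) (poly_curve p q z) < e"
      using \<theta>(2)[of z "fst (f z)"] f1(1)[OF zb(1)] zb(2) f(5)[OF z] by (simp add: dist_norm)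
    then show ?thesis
      using FP[OF zb(1)] near[OF zb(2)]
        norm_triangle_ineq[of "F z - poly_curve p q (fst (f z))" "poly_curve p q (fst (f z)) - poly_curve p q z"]
        norm_triangle_ineq[of "F z - poly_curve p q z" "poly_curve p q z - G z"]
      by (simp add: dist_norm)
  qed
  have "hausdorff_dist (closure (F ` ball 0 1)) (G ` cball 0 1) < ennreal \<epsilon>"
  proof (rule hausdorff_dist_closure_less[where d = "4 * e"])
    fix x assume "x \<in> F ` ball 0 1"
    then obtain z where z: "z \<in> ball 0 1" "x = F z" by blast
    have w: "fst (f z) \<in> cball 0 1" using f1(1)[OF z(1)] by simp
    have "dist x (G (fst (f z))) \<le> 4 * e"
      using FP[OF z(1)] near[OF w] e(1)
        norm_triangle_ineq[of "F z - poly_curve p q (fst (f z))" "poly_curve p q (fst (f z)) - G (fst (f z))"]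
      by (simp add: dist_norm z(2))
    then show "\<exists>y\<in>G ` cball 0 1. dist x y \<le> 4 * e" using w by blast
  next
    fix y assume "y \<in> G ` cball 0 1"
    then obtain z where z: "z \<in> cball 0 1" "y = G z" by blast
    have n: "norm (of_real r * z) \<le> r"
      using z(1) r0 mult_left_mono[of "norm z" 1 r] by (simp add: norm_mult)
    have "dist (F (of_real r * z)) y \<le> 4 * e"
      using FG[OF n] r(3)[OF z(1)] norm_triangle_ineq[of "F (of_real r * z) - G (of_real r * z)" "G (of_real r * z) - G z"]
      by (simp add: dist_norm z(2))
    moreover have "of_real r * z \<in> ball 0 1" using n r(2) by simp
    ultimately show "\<exists>x\<in>F ` ball 0 1. dist x y \<le> 4 * e" by blast
  qed (use e in auto)
  moreover have "norm (F z - G z) < \<epsilon>" if "z \<in> K" for z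
    using FG[of z] that s(3) r(1) e by (auto simp: subset_iff)
  ultimately show ?thesis
    by (intro exI[of _ F] conjI ballI holF complete)
qed


end
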